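(* $Q$ admits the partition $$Q=G\cdot P_1\ \sqcup\ G\cdot P_2\ \sqcup\ U,$$ where $P_1=[(1,0),(0,1)]$, $P_2=\left[\left(\tfrac1{\sqrt2},\tfrac{i}{\sqrt2}\right),\left(\tfrac{-i}{\sqrt2},\tfrac1{\sqrt2}\right)\right]$, and $$U=\left\{P=[(x,y),(x',y')]\in Q:\ (x,x')\text{ is linearly independent over }\mathbb{R}\text{ and }|\langle x,x'\rangle|+\big||x|-|x'|\big|\neq0\right\}$$ is an open subset of $Q$. Moreover $$G\cdot P_1=\{P\in Q:\ (x,x')\text{ is linearly dependent over }\mathbb{R}\},\qquad G\cdot P_2=\{P\in Q:\ \langle x,x'\rangle=0,\ |x|=|x'|\},$$ and for every $P\in U$ the orbit $G\cdot P$ is a compact submanifold of dimension $8$. Thus there are two degenerate orbits, $G\cdot P_1$ and $G\cdot P_2$, and all the other orbits have dimension $8$. Furthermore, for every $P\in Q$ one has $G^0\cdot P=G\cdot P$, and - if $P\in G\cdot P_1$, then $\mathrm{Stab}(P)_{|P}=\{\pm\mathrm{Id}_P\}$; - if $P\in G\cdot P_2$, then $\mathrm{Stab}(P)_{|P}=SO(P)$; - if $P\in U$, then $\mathrm{Stab}(P)_{|P}=\{\pm\mathrm{Id}_P\}$.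
   Context: $\mathbb{H}$ denotes the quaternions, $S^3$ the unit quaternions, $L_c(x)=cx$, $R_a(x)=xa$ on $\mathbb{H}$. $\mathbb{O}=\mathbb{H}^2=\mathbb{R}^8$ with its Euclidean structure, $S^7$ its unit sphere. For $q=(x,y)$, $q'=(x',y')$, $B(q,q')=x\overline{x'}+y'\overline{y}\in\mathbb{H}$, and $V=\{(q,q')\in S^7\times S^7: B(q,q')=0\}$ (the real part of $B$ is $\langle q,q'\rangle$, so such pairs are orthonormal). $[q,q']$ denotes the oriented plane with oriented orthonormal basis $(q,q')$, and $Q=\{[q,q']:(q,q')\in V\}=V/SO(2)$, a compact $9$-dimensional submanifold of the Grassmannian $Gr_2(\mathbb{R}^8)$ of oriented planes. For $P\in Q$ we write $P=[q,q']$ with $(q,q')\in V$, $q=(x,y)$, $q'=(x',y')$ (the conditions stated on $(x,x')$ do not depend on the choice of $(q,q')$). $G=\{g\in SO(8): \forall q,q',\ B(q,q')=0\Leftrightarrow B(gq,gq')=0\}$, acting on $Q$ by $g\cdot[q,q']=[gq,gq']$; its identity component is $G^0=\{\mathrm{Diag}(R_aL_c,R_bL_c): a,b,c\in S^3\}$, where $\mathrm{Diag}(A,D)(x,y)=(Ax,Dy)$, and $G=G^0\sqcup L_{E^\downarrow}G^0$ with $L_{E^\downarrow}(x,y)=(-y,x)$. An orbit is called degenerate if its dimension is less than $8$. $\mathrm{Stab}(P)$ is the stabilizer of $P$ for the action of $G$ on $Q$ (so that $G/\mathrm{Stab}(P)\cong G\cdot P$), and $\mathrm{Stab}(P)_{|P}$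 is the set of restrictions to $P$ of its elements; $SO(P)$ is the rotation group of the plane $P$.
   Formalization: In the first and third bullets Stab(P) is taken in G^0 instead of G: the map (x,y)->(-y,x) in G fixes P_1, and some plane in every orbit in U, rotating it by a right angle, so for G both bullets fail at every such P; the second bullet is proved for both groups. *)

theory Defs
  imports "HOL-Analysis.Analysis"
begin

section \<open>Quaternions\<close>

datatype quat = Quat (qRe: real) (qI: real) (qJ: real) (qK: real)

lemma quat_eq_iff: "p = q \<longleftrightarrow> qRe p = qRe q \<and> qI p = qI q \<and> qJ p = qJ q \<and> qK p = qK q"
  by (cases p; cases q) simp

lemma quat_eqI:
  "qRe p = qRe q \<Longrightarrow> qI p = qI q \<Longrightarrow> qJ p = qJ q \<Longrightarrow> qK p = qK q \<Longrightarrow> p = q"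
  by (simp add: quat_eq_iff)

instantiation quat :: "{ab_group_add, one, times, scaleR, sgn, inverse}"
begin

definition zero_quat where "0 = Quat 0 0 0 0"
definition plus_quat where
  "p + q = Quat (qRe p + qRe q) (qI p + qI q) (qJ p + qJ q) (qK p + qK q)"
definition uminus_quat where "- p = Quat (- qRe p) (- qI p) (- qJ p) (- qK p)"
definition minus_quat where
  "p - q = Quat (qRe p - qRe q) (qI p - qI q) (qJ p - qJ q) (qK p - qK q)"
definition one_quat where "1 = Quat 1 0 0 0"
definition times_quat where
  "p * q = Quat
     (qRe p * qRe q - qI p * qI q - qJ p * qJ q - qK p * qK q)
     (qRe p * qI q + qI p * qRe q + qJ p * qK q - qK p * qJ q)
     (qRe p * qJ q - qI p * qK q + qJ p * qRe q + qK p * qI q)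
     (qRe p * qK q + qI p * qJ q - qJ p * qI q + qK p * qRe q)"
definition scaleR_quat where
  "r *\<^sub>R p = Quat (r * qRe p) (r * qI p) (r * qJ p) (r * qK p)"
definition sgn_quat where
  "sgn p = inverse (sqrt ((qRe p)\<^sup>2 + (qI p)\<^sup>2 + (qJ p)\<^sup>2 + (qK p)\<^sup>2)) *\<^sub>R (p :: quat)"
definition inverse_quat where
  "inverse p = inverse ((qRe p)\<^sup>2 + (qI p)\<^sup>2 + (qJ p)\<^sup>2 + (qK p)\<^sup>2)
     *\<^sub>R Quat (qRe p) (- qI p) (- qJ p) (- qK p)"
definition divide_quat where "p div q = p * inverse (q :: quat)"

instance
  by standard (simp_all add: quat_eq_iff zero_quat_def plus_quat_def uminus_quat_def minus_quat_def)

end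

lemma quat_sel [simp]:
  "qRe 0 = 0" "qI 0 = 0" "qJ 0 = 0" "qK 0 = 0"
  "qRe 1 = 1" "qI 1 = 0" "qJ 1 = 0" "qK 1 = 0"
  "qRe (p + q) = qRe p + qRe q" "qI (p + q) = qI p + qI q"
  "qJ (p + q) = qJ p + qJ q" "qK (p + q) = qK p + qK q"
  "qRe (p - q) = qRe p - qRe q" "qI (p - q) = qI p - qI q"
  "qJ (p - q) = qJ p - qJ q" "qK (p - q) = qK p - qK q"
  "qRe (- p) = - qRe p" "qI (- p) = - qI p" "qJ (- p) = - qJ p" "qK (- p) = - qK p"
  "qRe (r *\<^sub>R p) = r * qRe p" "qI (r *\<^sub>R p) = r * qI p"
  "qJ (r *\<^sub>R p) = r * qJ p" "qK (r *\<^sub>R p) = r * qK p"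
  by (simp_all add: zero_quat_def one_quat_def plus_quat_def minus_quat_def uminus_quat_def
      scaleR_quat_def)

lemma quat_sel_times [simp]:
  "qRe (p * q) = qRe p * qRe q - qI p * qI q - qJ p * qJ q - qK p * qK q"
  "qI (p * q) = qRe p * qI q + qI p * qRe q + qJ p * qK q - qK p * qJ q"
  "qJ (p * q) = qRe p * qJ q - qI p * qK q + qJ p * qRe q + qK p * qI q"
  "qK (p * q) = qRe p * qK q + qI p * qJ q - qJ p * qI q + qK p * qRe q"
  by (simp_all add: times_quat_def)

lemma quat_sumsq_eq_0:
  "(a::real)\<^sup>2 + b\<^sup>2 + c\<^sup>2 + d\<^sup>2 = 0 \<longleftrightarrow> a = 0 \<and> b = 0 \<and> c = 0 \<and> d = 0"
  by (simp add: add_nonneg_eq_0_iff)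

instance quat :: real_algebra_1
  by standard (simp_all add: quat_eq_iff algebra_simps)

instance quat :: division_ring
proof
  fix p q :: quat
  define n where "n = (qRe p)\<^sup>2 + (qI p)\<^sup>2 + (qJ p)\<^sup>2 + (qK p)\<^sup>2"
  have n: "n \<noteq> 0" if "p \<noteq> 0"
    using that quat_sumsq_eq_0[of "qRe p" "qI p" "qJ p" "qK p"] by (auto simp: n_def quat_eq_iff)
  have inv: "inverse p = inverse n *\<^sub>R Quat (qRe p) (- qI p) (- qJ p) (- qK p)"
    by (simp add: inverse_quat_def n_def)
  have "Quat (qRe p) (- qI p) (- qJ p) (- qK p) * p = n *\<^sub>R 1"
    "p * Quat (qRe p) (- qI p) (- qJ p) (- qK p) = n *\<^sub>R 1"
    by (simp_all add: quat_eq_iff n_def power2_eq_square)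
  then show "p \<noteq> 0 \<Longrightarrow> inverse p * p = 1" "p \<noteq> 0 \<Longrightarrow> p * inverse p = 1"
    using n by (simp_all add: inv)
  show "p div q = p * inverse q" by (simp add: divide_quat_def)
  show "inverse (0::quat) = 0" by (simp add: inverse_quat_def)
qed

instance quat :: real_div_algebra ..

instantiation quat :: real_inner
begin

definition inner_quat where
  "inner p q = qRe p * qRe q + qI p * qI q + qJ p * qJ q + qK p * qK q"
definition norm_quat where
  "norm p = sqrt ((qRe p)\<^sup>2 + (qI p)\<^sup>2 + (qJ p)\<^sup>2 + (qK p)\<^sup>2)"
definition dist_quat where "dist p q = norm (p - q :: quat)"
definition uniformity_quat where
  "(uniformity :: (quat \<times> quat) filter) = (INF e\<in>{0 <..}. principal {(x, y). dist x y < e})"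
definition open_quat where
  "open (U :: quat set) \<longleftrightarrow> (\<forall>x\<in>U. eventually (\<lambda>(x', y). x' = x \<longrightarrow> y \<in> U) uniformity)"

instance
proof
  fix p q s :: quat and r :: real
  show "inner p q = inner q p" "inner (p + q) s = inner p s + inner q s"
    "inner (r *\<^sub>R p) q = r * inner p q" "0 \<le> inner p p"
    by (simp_all add: inner_quat_def algebra_simps)
  show "inner p p = 0 \<longleftrightarrow> p = 0"
    using quat_sumsq_eq_0[of "qRe p" "qI p" "qJ p" "qK p"]
    by (simp add: inner_quat_def quat_eq_iff power2_eq_square)
  show "norm p = sqrt (inner p p)"
    by (simp add: norm_quat_def inner_quat_def power2_eq_square)
  show "sgn p = p /\<^sub>R norm p" by (simp add: sgn_quat_def norm_quat_def)
qed (rule dist_quat_def uniformity_quat_def open_quat_def)+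

end

instance quat :: real_normed_div_algebra
proof
  fix p q :: quat
  show "norm (p * q) = norm p * norm q"
    unfolding norm_quat_def real_sqrt_mult[symmetric] quat_sel_times
    by (rule arg_cong[of _ _ sqrt]) algebra
qed

definition qi :: quat where "qi = Quat 0 1 0 0"
definition qj :: quat where "qj = Quat 0 0 1 0"
definition qk :: quat where "qk = Quat 0 0 0 1"

instantiation quat :: euclidean_space
begin

definition Basis_quat where "Basis = {1, qi, qj, qk}"

instance
proof
  fix x u v :: quat
  show "(Basis :: quat set) \<noteq> {}" "finite (Basis :: quat set)"
    by (simp_all add: Basis_quat_def)
  show "inner u v = (if u = v then 1 else 0)" if "u \<in> Basis" "v \<in> Basis"
    using that unfolding Basis_quat_def
    by (elim insertE emptyE) (simp_all add: inner_quat_def qi_def qj_def qk_def one_quat_def)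
  show "(\<forall>u\<in>Basis. inner x u = 0) \<longleftrightarrow> x = 0"
    unfolding Basis_quat_def
    by (simp add: inner_quat_def qi_def qj_def qk_def one_quat_def)
       (cases x; simp add: zero_quat_def)
qed

end

definition qcnj :: "quat \<Rightarrow> quat"
  where "qcnj p = Quat (qRe p) (- qI p) (- qJ p) (- qK p)"


section \<open>Oriented planes in \<open>\<real>\<^sup>8\<close>\<close>

type_synonym oct = "quat \<times> quat"

definition stiefel :: "(oct \<times> oct) set" where
  "stiefel = {(q, q'). norm q = 1 \<and> norm q' = 1 \<and> q \<bullet> q' = 0}"

text \<open>An oriented plane is represented by the set of all its oriented orthonormal bases.
  \<open>oplane a b\<close> is the oriented plane with oriented (not necessarily orthonormal) basis
  \<open>(a, b)\<close>; for \<open>(a, b) \<in> stiefel\<close> it is the \<open>SO(2)\<close>-orbit of \<open>(a, b)\<close>.\<close>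

type_synonym oplane = "(oct \<times> oct) set"

definition oplane :: "oct \<Rightarrow> oct \<Rightarrow> oplane" where
  "oplane a b = {(q, q') \<in> stiefel. \<exists>\<alpha> \<beta> \<gamma> \<delta>. q = \<alpha> *\<^sub>R a + \<beta> *\<^sub>R b \<and> q' = \<gamma> *\<^sub>R a + \<delta> *\<^sub>R b \<and>
     \<alpha> * \<delta> - \<beta> * \<gamma> > 0}"

definition Gr2 :: "oplane set" where
  "Gr2 = {oplane q q' |q q'. (q, q') \<in> stiefel}"

definition plane :: "oplane \<Rightarrow> oct set" where
  "plane P = span (fst ` P)"

text \<open>The quotient topology on \<open>Gr2\<close>.\<close>

definition Gr2_top :: "oplane topology" where
  "Gr2_top = topology (\<lambda>W. W \<subseteq> Gr2 \<and>
     openin (top_of_set stiefel) {b \<in> stiefel. oplane (fst b) (snd b) \<in> W})"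

lemma openin_Gr2_top:
  "openin Gr2_top W \<longleftrightarrow> W \<subseteq> Gr2 \<and>
     openin (top_of_set stiefel) {b \<in> stiefel. oplane (fst b) (snd b) \<in> W}"
proof -
  have "istopology (\<lambda>W. W \<subseteq> Gr2 \<and>
     openin (top_of_set stiefel) {b \<in> stiefel. oplane (fst b) (snd b) \<in> W})"
    (is "istopology (\<lambda>W. W \<subseteq> Gr2 \<and> openin ?T (?f W))")
    unfolding istopology_def
  proof (intro conjI allI impI)
    fix S T assume "S \<subseteq> Gr2 \<and> openin ?T (?f S)" "T \<subseteq> Gr2 \<and> openin ?T (?f T)"
    moreover have "?f (S \<inter> T) = ?f S \<inter> ?f T" by auto
    ultimately show "S \<inter> T \<subseteq> Gr2" "openin ?T (?f (S \<inter> T))" by auto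
  next
    fix K assume "\<forall>S\<in>K. S \<subseteq> Gr2 \<and> openin ?T (?f S)"
    moreover have "?f (\<Union>K) = \<Union>(?f ` K)" by auto
    moreover have "openin ?T (\<Union>(?f ` K))"
      by (rule openin_Union) (use calculation(1) in blast)
    ultimately show "\<Union>K \<subseteq> Gr2" "openin ?T (?f (\<Union>K))"
      by (blast, simp only:)
  qed
  then show ?thesis unfolding Gr2_top_def by (simp only: topology_inverse')
qed


section \<open>Submanifolds and their dimension\<close>

primrec Ck_on :: "nat \<Rightarrow> 'a::euclidean_space set \<Rightarrow> ('a \<Rightarrow> 'b::euclidean_space) \<Rightarrow> bool" where
  "Ck_on 0 S f \<longleftrightarrow> continuous_on S f"
| "Ck_on (Suc k) S f \<longleftrightarrow> (\<forall>x\<in>S. f differentiable at x) \<and>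
     (\<forall>v. Ck_on k S (\<lambda>x. frechet_derivative f (at x) v))"

definition smooth_on :: "'a::euclidean_space set \<Rightarrow> ('a \<Rightarrow> 'b::euclidean_space) \<Rightarrow> bool" where
  "smooth_on S f \<longleftrightarrow> (\<forall>k. Ck_on k S f)"

definition submanifold_at :: "nat \<Rightarrow> 'a::euclidean_space set \<Rightarrow> 'a \<Rightarrow> bool" where
  "submanifold_at k S p \<longleftrightarrow> p \<in> S \<and> (\<exists>W W' \<phi> \<psi> (L :: 'a set).
     open W \<and> open W' \<and> p \<in> W \<and> homeomorphism W W' \<phi> \<psi> \<and> smooth_on W \<phi> \<and> smooth_on W' \<psi> \<and>
     subspace L \<and> dim L = k \<and> \<phi> ` (W \<inter> S) = W' \<inter> L)"

text \<open>The standard chart of \<open>Gr2\<close> centred at \<open>P = [e, e']\<close> identifies the oriented planes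
  projecting onto \<open>P\<close> isomorphically and with the right orientation with
  \<open>Hom(P, P\<^sup>\<bottom>) = P\<^sup>\<bottom> \<times> P\<^sup>\<bottom>\<close>: the pair \<open>(u, v)\<close> stands for the graph of the linear map
  \<open>e \<mapsto> u, e' \<mapsto> v\<close>. \<open>Gr2_chart_image e e' N\<close> is \<open>N\<close> read in this chart, as a subset
  of the \<open>12\<close>-dimensional linear subspace \<open>P\<^sup>\<bottom> \<times> P\<^sup>\<bottom>\<close> of \<open>\<real>\<^sup>8 \<times> \<real>\<^sup>8\<close>; being a submanifold
  of that subspace is the same as being a submanifold of \<open>\<real>\<^sup>8 \<times> \<real>\<^sup>8\<close>.\<close>

definition Gr2_chart_image :: "oct \<Rightarrow> oct \<Rightarrow> oplane set \<Rightarrow> (oct \<times> oct) set" where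
  "Gr2_chart_image e e' N = {(u, v). u \<bullet> e = 0 \<and> u \<bullet> e' = 0 \<and> v \<bullet> e = 0 \<and> v \<bullet> e' = 0 \<and>
     oplane (e + u) (e' + v) \<in> N}"

definition Gr2_submanifold :: "nat \<Rightarrow> oplane set \<Rightarrow> bool" where
  "Gr2_submanifold k N \<longleftrightarrow> N \<subseteq> Gr2 \<and>
     (\<forall>(e, e') \<in> stiefel. oplane e e' \<in> N \<longrightarrow> submanifold_at k (Gr2_chart_image e e' N) 0)"


section \<open>The manifold \<open>Q\<close> and the group \<open>G\<close>\<close>

definition formB :: "oct \<Rightarrow> oct \<Rightarrow> quat" where
  "formB q q' = fst q * qcnj (fst q') + snd q' * qcnj (snd q)"

definition V_set :: "(oct \<times> oct) set" where
  "V_set = {(q, q'). q \<in> sphere 0 1 \<and> q' \<in> sphere 0 1 \<and> formB q q' = 0}"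

definition Q_set :: "oplane set" where
  "Q_set = {oplane q q' |q q'. (q, q') \<in> V_set}"

definition oct_to_vec :: "oct \<Rightarrow> real ^ (4 + 4)" where
  "oct_to_vec p = (\<chi> k. case k of
      Inl m \<Rightarrow> vector [qRe (fst p), qI (fst p), qJ (fst p), qK (fst p)] $ m
    | Inr m \<Rightarrow> vector [qRe (snd p), qI (snd p), qJ (snd p), qK (snd p)] $ m)"

definition vec_to_oct :: "real ^ (4 + 4) \<Rightarrow> oct" where
  "vec_to_oct v = (Quat (v $ Inl 1) (v $ Inl 2) (v $ Inl 3) (v $ Inl 4),
                   Quat (v $ Inr 1) (v $ Inr 2) (v $ Inr 3) (v $ Inr 4))"

lemma vec_to_oct_to_vec [simp]: "vec_to_oct (oct_to_vec p) = p"
  by (simp add: vec_to_oct_def oct_to_vec_def vector_def)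

lemma oct_to_vec_to_oct [simp]: "oct_to_vec (vec_to_oct v) = v"
  by (auto simp: vec_to_oct_def oct_to_vec_def vec_eq_iff vector_def forall_4 split: sum.split)

definition SO8 :: "(oct \<Rightarrow> oct) set" where
  "SO8 = {g. linear g \<and> rotation_matrix (matrix (oct_to_vec \<circ> g \<circ> vec_to_oct))}"

definition G_set :: "(oct \<Rightarrow> oct) set" where
  "G_set = {g \<in> SO8. \<forall>q q'. formB q q' = 0 \<longleftrightarrow> formB (g q) (g q') = 0}"

text \<open>The identity component of \<open>G\<close>. The topology on \<open>oct \<Rightarrow> oct\<close> is that of pointwise
  convergence, which on linear maps is the usual one.\<close>

definition G0_set :: "(oct \<Rightarrow> oct) set" where
  "G0_set = connected_component_set G_set id"

definition act :: "(oct \<Rightarrow> oct) \<Rightarrow> oplane \<Rightarrow> oplane" where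
  "act g P = map_prod g g ` P"

definition orbit :: "(oct \<Rightarrow> oct) set \<Rightarrow> oplane \<Rightarrow> oplane set" where
  "orbit H P = (\<lambda>g. act g P) ` H"

definition degenerate :: "oplane set \<Rightarrow> bool" where
  "degenerate N \<longleftrightarrow> (\<exists>k<8. Gr2_submanifold k N)"

text \<open>The group is a parameter because of the following difference between \<open>G\<close> and its identity
  component: \<open>(x, y) \<mapsto> (- y, x)\<close> lies in \<open>G\<close>, fixes \<open>P1\<close> and rotates it by a right angle, and
  likewise fixes and rotates the planes \<open>[(r, s i), (- s i, r)]\<close> with \<open>r\<^sup>2 + s\<^sup>2 = 1\<close>.
  On these planes only the stabilizers in \<open>G0_set\<close> restrict to \<open>\<plusminus>Id\<close> (for \<open>r\<^sup>2 \<noteq> s\<^sup>2\<close>).\<close>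

definition Stab :: "(oct \<Rightarrow> oct) set \<Rightarrow> oplane \<Rightarrow> (oct \<Rightarrow> oct) set" where
  "Stab H P = {g \<in> H. act g P = P}"

definition restr_to_plane :: "(oct \<Rightarrow> oct) set \<Rightarrow> oplane \<Rightarrow> (oct \<Rightarrow> oct) set" where
  "restr_to_plane S P = (\<lambda>g. restrict g (plane P)) ` S"

definition pm_id :: "oplane \<Rightarrow> (oct \<Rightarrow> oct) set" where
  "pm_id P = {restrict id (plane P), restrict uminus (plane P)}"

text \<open>A linear map restricts to a rotation of the plane \<open>P\<close> iff it maps oriented orthonormal
  bases of \<open>P\<close> to oriented orthonormal bases of \<open>P\<close>.\<close>

definition SO_plane :: "oplane \<Rightarrow> (oct \<Rightarrow> oct) set" where
  "SO_plane P = restr_to_plane {f. linear f \<and> map_prod f f ` P \<subseteq> P} P"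

definition P1 :: oplane where
  "P1 = oplane (1, 0) (0, 1)"

definition P2 :: oplane where
  "P2 = oplane ((1 / sqrt 2) *\<^sub>R 1, (1 / sqrt 2) *\<^sub>R qi) ((1 / sqrt 2) *\<^sub>R (- qi), (1 / sqrt 2) *\<^sub>R 1)"

definition lin_dep_pair :: "'a::real_vector \<Rightarrow> 'a \<Rightarrow> bool" where
  "lin_dep_pair x x' \<longleftrightarrow> x = x' \<or> dependent {x, x'}"

definition U_set :: "oplane set" where
  "U_set = {oplane (x, y) (x', y') |x y x' y'. ((x, y), (x', y')) \<in> V_set \<and>
     \<not> lin_dep_pair x x' \<and> \<bar>x \<bullet> x'\<bar> + \<bar>norm x - norm x'\<bar> \<noteq> 0}"

end

theory Submission
  imports Defs
begin

text \<open>For a plane \<open>P = [q, q']\<close> in \<open>Q\<close> with \<open>q = (x, y)\<close>, \<open>q' = (x', y')\<close>, the equation \<open>B(q, q') = 0\<close>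
  gives \<open>|x|\<^sup>2 + |x'|\<^sup>2 = 1\<close> on taking norms. The Gram matrix of \<open>(x, x')\<close> therefore has
  trace \<open>1\<close>, and up to a rotation of the basis of \<open>P\<close> it is determined by its determinant
  \<open>d = |x|\<^sup>2 |x'|\<^sup>2 - \<langle>x, x'\<rangle>\<^sup>2 \<in> [0, 1/4]\<close>. The orbits are the level sets of \<open>d\<close>
  (\<open>orbit_eq_level\<close>): \<open>d = 0\<close> means linear dependence and is the orbit of \<open>P\<^sub>1\<close>, \<open>d = 1/4\<close> means that
  the matrix is scalar and is the orbit of \<open>P\<^sub>2\<close>, and \<open>U\<close> is the set where \<open>0 < d < 1/4\<close>.

  That \<open>d\<close> is invariant rests on one property of \<open>G\<close>: its elements preserve or swap the axes
  \<open>\<bbbH> \<times> 0\<close> and \<open>0 \<times> \<bbbH>\<close> (\<open>G_set_axes\<close>), because these can be recovered from the relation \<open>B = 0\<close>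
  (\<open>on_axis_iff\<close>). Elements of \<open>G\<^sup>0\<close> preserve them by continuity. Conversely the connected group \<open>K\<close> of
  the maps \<open>Diag(R\<^sub>a L\<^sub>c, R\<^sub>b L\<^sub>c)\<close> is contained in \<open>G\<^sup>0\<close> and is transitive on the level sets
  (\<open>K_set_transitive\<close>), because quaternions with equal real parts and equal norms are conjugate.

  An element of \<open>G\<^sup>0\<close> stabilizing \<open>P\<close> rotates \<open>(x, x')\<close> by the angle by which it rotates \<open>P\<close>, and it
  preserves the Gram matrix. If that matrix is not scalar, only \<open>\<plusminus>Id\<close> is possible
  (\<open>stabilizer_eq_pm_id\<close>); if it is scalar, transitivity of \<open>K\<close> on bases realizes every rotation
  (\<open>stabilizer_eq_SO_plane\<close>).

  The dimensions come from the regular value theorem (\<open>regular_level_set_submanifold\<close>), which is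
  derived from a smooth version of the inverse function theorem. By homogeneity one chart per orbit
  suffices, centred at \<open>e = (r, - s i)\<close>, \<open>e' = (s i, r)\<close>. In the \<open>16\<close> coordinates of the pairs
  \<open>(u, v)\<close> there are four linear equations for the chart, three for the imaginary part of \<open>B\<close> and one for
  \<open>d\<close>; they are independent for \<open>0 < s < r\<close>, which gives dimension \<open>8\<close>. The two degenerate orbits
  satisfy more equations and have dimensions \<open>6\<close> and \<open>7\<close>. Invariance of domain shows that the
  dimension is unique (\<open>submanifold_at_dim_le\<close>), so no other orbit is degenerate.\<close>


section \<open>Calculus of smooth maps\<close>

lemma Ck_on_cong:
  assumes "open S" "\<And>x. x \<in> S \<Longrightarrow> f x = g x" "Ck_on k S f"
  shows "Ck_on k S g"
  using assms(2,3)
proof (induction k arbitrary: f g)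
  case 0
  then show ?case by (auto cong: continuous_on_cong_simp)
next
  case (Suc k)
  have eq: "(\<lambda>D. (f has_derivative D) (at x)) = (\<lambda>D. (g has_derivative D) (at x))" if "x \<in> S" for x
  proof (intro ext iffI)
    show "(g has_derivative D) (at x)" if "(f has_derivative D) (at x)" for D
      by (rule has_derivative_transform_within_open[OF that \<open>open S\<close> \<open>x \<in> S\<close> Suc.prems(1)])
    show "(f has_derivative D) (at x)" if "(g has_derivative D) (at x)" for D
      by (rule has_derivative_transform_within_open[OF that \<open>open S\<close> \<open>x \<in> S\<close> Suc.prems(1)[symmetric]])
  qed
  then have "frechet_derivative f (at x) = frechet_derivative g (at x)" if "x \<in> S" for x
    unfolding frechet_derivative_def using that by (simp only:)
  then have "Ck_on k S (\<lambda>x. frechet_derivative g (at x) v)" for v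
    using Suc.prems(2) by - (rule Suc.IH[of "\<lambda>x. frechet_derivative f (at x) v"], auto)
  moreover have "g differentiable at x" if "x \<in> S" for x
    using Suc.prems(2) that fun_cong[OF eq[OF that]] unfolding Ck_on.simps differentiable_def by blast
  ultimately show ?case by simp
qed

lemma Ck_on_SucI:
  assumes "open S" "\<And>x. x \<in> S \<Longrightarrow> (f has_derivative f' x) (at x)"
    "\<And>v. Ck_on k S (\<lambda>x. f' x v)"
  shows "Ck_on (Suc k) S f"
proof -
  have "Ck_on k S (\<lambda>x. frechet_derivative f (at x) v)" for v
    by (rule Ck_on_cong[OF assms(1) _ assms(3)])
      (simp add: frechet_derivative_at[OF assms(2), symmetric])
  then show ?thesis using assms(2) by (auto simp: differentiable_def)
qed

lemma Ck_on_has_derivative: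
  assumes "Ck_on (Suc k) S f" "x \<in> S"
  shows "(f has_derivative frechet_derivative f (at x)) (at x)"
  using assms by (simp add: frechet_derivative_works)

lemma Ck_on_Suc_imp: "Ck_on (Suc k) S f \<Longrightarrow> Ck_on k S f"
proof (induction k arbitrary: f)
  case 0
  then show ?case
    by (simp add: differentiable_imp_continuous_on differentiable_on_def differentiable_at_withinI)
next
  case (Suc k)
  from Suc.prems have "\<forall>x\<in>S. f differentiable at x"
    "\<forall>v. Ck_on (Suc k) S (\<lambda>x. frechet_derivative f (at x) v)"
    unfolding Ck_on.simps(2)[of "Suc k"] by blast+
  with Suc.IH show ?case unfolding Ck_on.simps(2)[of k] by blast
qed

lemma Ck_on_continuous: "Ck_on k S f \<Longrightarrow> continuous_on S f"
proof (induction k)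
  case (Suc k)
  show ?case by (rule Suc.IH[OF Ck_on_Suc_imp[OF Suc.prems]])
qed simp

lemma Ck_on_subset: "Ck_on k S f \<Longrightarrow> T \<subseteq> S \<Longrightarrow> Ck_on k T f"
  by (induction k arbitrary: f) (auto intro: continuous_on_subset)

lemma Ck_on_const: "open S \<Longrightarrow> Ck_on k S (\<lambda>_. c)"
proof (induction k arbitrary: c)
  case (Suc k)
  show ?case
    by (rule Ck_on_SucI[OF Suc.prems, where f' = "\<lambda>_ _. 0"]) (auto intro: Suc)
qed simp

lemma Ck_on_linear_compose:
  assumes "linear L" "open S" "Ck_on k S f"
  shows "Ck_on k S (\<lambda>x. L (f x))"
  using assms(3)
proof (induction k arbitrary: f)
  case 0
  then show ?case
    using linear_continuous_on_compose[OF _ assms(1)] by simp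
next
  case (Suc k)
  show ?case
  proof (rule Ck_on_SucI[OF assms(2)])
    show "((\<lambda>x. L (f x)) has_derivative (\<lambda>v. L (frechet_derivative f (at x) v))) (at x)"
      if "x \<in> S" for x
      using bounded_linear.has_derivative[OF _ Ck_on_has_derivative[OF Suc.prems that]] assms(1)
        linear_conv_bounded_linear by blast
    show "Ck_on k S (\<lambda>x. L (frechet_derivative f (at x) v))" for v
      using Suc by simp
  qed
qed

lemma Ck_on_id: "open S \<Longrightarrow> Ck_on k S (\<lambda>x. x)"
proof (cases k)
  case (Suc n)
  assume "open S"
  then show ?thesis unfolding Suc
    by (rule Ck_on_SucI[where f' = "\<lambda>_ v. v"]) (auto intro: Ck_on_const \<open>open S\<close>)
qed simp

lemma Ck_on_linear: "linear L \<Longrightarrow> open S \<Longrightarrow> Ck_on k S L"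
  using Ck_on_linear_compose[OF _ _ Ck_on_id] by blast

lemma Ck_on_add:
  assumes "open S" "Ck_on k S f" "Ck_on k S g"
  shows "Ck_on k S (\<lambda>x. f x + g x)"
  using assms(2,3)
proof (induction k arbitrary: f g)
  case 0
  then show ?case by (auto intro: continuous_on_add)
next
  case (Suc k)
  show ?case
  proof (rule Ck_on_SucI[OF assms(1)])
    show "((\<lambda>x. f x + g x) has_derivative
        (\<lambda>v. frechet_derivative f (at x) v + frechet_derivative g (at x) v)) (at x)" if "x \<in> S" for x
      by (intro has_derivative_add Ck_on_has_derivative[OF Suc.prems(1) that]
          Ck_on_has_derivative[OF Suc.prems(2) that])
    show "Ck_on k S (\<lambda>x. frechet_derivative f (at x) v + frechet_derivative g (at x) v)" for v
      using Suc by simp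
  qed
qed

lemma Ck_on_sum:
  assumes "open S" "\<And>i. i \<in> I \<Longrightarrow> Ck_on k S (f i)"
  shows "Ck_on k S (\<lambda>x. \<Sum>i\<in>I. f i x)"
  using assms(2)
  by (induction I rule: infinite_finite_induct) (auto intro!: Ck_on_add Ck_on_const assms(1))

lemma Ck_on_bilinear:
  assumes "bounded_bilinear B" "open S" "Ck_on k S f" "Ck_on k S g"
  shows "Ck_on k S (\<lambda>x. B (f x) (g x))"
  using assms(3,4)
proof (induction k arbitrary: f g)
  case 0
  then show ?case using bounded_bilinear.continuous_on[OF assms(1)] by auto
next
  case (Suc k)
  show ?case
  proof (rule Ck_on_SucI[OF assms(2)])
    show "((\<lambda>x. B (f x) (g x)) has_derivative
        (\<lambda>v. B (f x) (frechet_derivative g (at x) v) + B (frechet_derivative f (at x) v) (g x)))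
        (at x)" if "x \<in> S" for x
      by (intro bounded_bilinear.FDERIV[OF assms(1)] Ck_on_has_derivative[OF Suc.prems(1) that]
          Ck_on_has_derivative[OF Suc.prems(2) that])
    show "Ck_on k S (\<lambda>x. B (f x) (frechet_derivative g (at x) v)
        + B (frechet_derivative f (at x) v) (g x))" for v
      using Suc Ck_on_Suc_imp[OF Suc.prems(1)] Ck_on_Suc_imp[OF Suc.prems(2)]
      by (intro Ck_on_add assms(2)) auto
  qed
qed

lemma Ck_on_euclidean_iff:
  assumes "open S"
  shows "Ck_on k S f \<longleftrightarrow> (\<forall>b\<in>Basis. Ck_on k S (\<lambda>x. f x \<bullet> b))"
proof
  assume "Ck_on k S f"
  then show "\<forall>b\<in>Basis. Ck_on k S (\<lambda>x. f x \<bullet> b)"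
    using assms
    by (auto intro!: Ck_on_linear_compose[where L = "\<lambda>y. y \<bullet> b" for b] bounded_linear.linear
        bounded_linear_inner_left)
next
  assume *: "\<forall>b\<in>Basis. Ck_on k S (\<lambda>x. f x \<bullet> b)"
  have "Ck_on k S (\<lambda>x. \<Sum>b\<in>Basis. (f x \<bullet> b) *\<^sub>R b)"
    using * assms
    by (auto intro!: Ck_on_sum Ck_on_linear_compose[where L = "\<lambda>t. t *\<^sub>R b" for b]
        bounded_linear.linear bounded_linear_scaleR_left)
  then show "Ck_on k S f" by (simp add: euclidean_representation)
qed

text \<open>\<open>Ck_on\<close> speaks of maps into Euclidean spaces, so the regularity of an operator-valued map
  \<open>A\<close> is expressed by that of all the maps \<open>x \<mapsto> A x v\<close>. Expanding the argument in an
  orthonormal basis shows that this is enough.\<close>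

lemma Ck_on_apply:
  assumes "open S" "\<And>x. x \<in> S \<Longrightarrow> linear (A x)" "\<And>v. Ck_on k S (\<lambda>x. A x v)" "Ck_on k S g"
  shows "Ck_on k S (\<lambda>x. A x (g x))"
proof (rule Ck_on_cong[OF assms(1)])
  show "(\<Sum>b\<in>Basis. (g x \<bullet> b) *\<^sub>R A x b) = A x (g x)" if "x \<in> S" for x
  proof -
    have "A x (g x) = A x (\<Sum>b\<in>Basis. (g x \<bullet> b) *\<^sub>R b)" by (simp add: euclidean_representation)
    also have "\<dots> = (\<Sum>b\<in>Basis. (g x \<bullet> b) *\<^sub>R A x b)"
      using assms(2)[OF that] by (simp add: linear_sum linear_cmul)
    finally show ?thesis by simp
  qed
  show "Ck_on k S (\<lambda>x. \<Sum>b\<in>Basis. (g x \<bullet> b) *\<^sub>R A x b)"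
    using assms(3,4) Ck_on_euclidean_iff[OF assms(1), of k g]
    by (intro Ck_on_sum[OF assms(1)] Ck_on_bilinear[OF bounded_bilinear_scaleR assms(1)]) blast+
qed

text \<open>By the chain rule the derivative of \<open>g \<circ> f\<close> is an operator depending on \<open>f x\<close> applied to a
  vector depending on \<open>x\<close>, so the induction hypothesis is needed for all \<open>g\<close> at once.\<close>

lemma Ck_on_compose:
  assumes "open S" "open T" "f ` S \<subseteq> T" "Ck_on k S f" "Ck_on k T g"
  shows "Ck_on k S (\<lambda>x. g (f x))"
  using assms(4,5)
proof (induction k arbitrary: g)
  case 0
  then show ?case using assms(3) continuous_on_compose2 by (metis Ck_on.simps(1))
next
  case (Suc k)
  have der: "(g has_derivative frechet_derivative g (at (f x))) (at (f x))" if "x \<in> S" for x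
    using Suc.prems(2) assms(3) that by (intro Ck_on_has_derivative) auto
  show ?case
  proof (rule Ck_on_SucI[OF assms(1)])
    show "((\<lambda>x. g (f x)) has_derivative
        (\<lambda>v. frechet_derivative g (at (f x)) (frechet_derivative f (at x) v))) (at x)"
      if "x \<in> S" for x
      by (rule has_derivative_compose[OF Ck_on_has_derivative[OF Suc.prems(1) that] der[OF that]])
    show "Ck_on k S (\<lambda>x. frechet_derivative g (at (f x)) (frechet_derivative f (at x) v))" for v
    proof (rule Ck_on_apply[OF assms(1), where A = "\<lambda>x. frechet_derivative g (at (f x))"])
      show "linear (frechet_derivative g (at (f x)))" if "x \<in> S" for x
        using der[OF that] by (rule has_derivative_linear)
      show "Ck_on k S (\<lambda>x. frechet_derivative g (at (f x)) w)" for w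
        using Suc.prems Ck_on_Suc_imp[OF Suc.prems(1)] by - (rule Suc.IH, auto)
      show "Ck_on k S (\<lambda>x. frechet_derivative f (at x) v)"
        using Suc.prems by simp
    qed
  qed
qed

text \<open>Where the first factor vanishes, the product rule holds for a second factor that is merely
  continuous. This is what makes an operator inverse differentiable before anything more than its
  continuity is known.\<close>

lemma has_derivative_scaleR_zero:
  fixes m :: "'a::euclidean_space \<Rightarrow> real" and c :: "'a \<Rightarrow> 'b::euclidean_space"
  assumes m: "(m has_derivative m') (at a)" "m a = 0" and c: "isCont c a"
  shows "((\<lambda>z. m z *\<^sub>R c z) has_derivative (\<lambda>h. m' h *\<^sub>R c a)) (at a)"
proof -
  have 1: "((\<lambda>z. (m z - m' (z - a)) /\<^sub>R norm (z - a)) \<longlongrightarrow> 0) (at a)"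
    using m unfolding has_derivative_at_within by (simp add: diff_diff_eq)
  have lin: "bounded_linear m'" using m(1) by (rule has_derivative_bounded_linear)
  then obtain K where K: "\<And>h. norm (m' h) \<le> norm h * K"
    using bounded_linear.bounded by blast
  have c0: "((\<lambda>z. c z - c a) \<longlongrightarrow> 0) (at a)"
    using c by (auto simp: isCont_def LIM_zero)
  have 2: "((\<lambda>z. (m' (z - a) / norm (z - a)) *\<^sub>R (c z - c a)) \<longlongrightarrow> 0) (at a)"
  proof (rule Lim_null_comparison)
    show "\<forall>\<^sub>F z in at a. norm ((m' (z - a) / norm (z - a)) *\<^sub>R (c z - c a)) \<le> K * norm (c z - c a)"
    proof (rule always_eventually, rule allI)
      fix z
      show "norm ((m' (z - a) / norm (z - a)) *\<^sub>R (c z - c a)) \<le> K * norm (c z - c a)"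
      proof (cases "z = a")
        case False
        then have "\<bar>m' (z - a)\<bar> / norm (z - a) \<le> K"
          using K[of "z - a"] by (simp add: divide_simps mult.commute)
        from mult_right_mono[OF this, of "norm (c z - c a)"] show ?thesis by simp
      qed simp
    qed
    show "((\<lambda>z. K * norm (c z - c a)) \<longlongrightarrow> 0) (at a)"
      using tendsto_mult_right_zero[OF tendsto_norm_zero[OF c0]] by simp
  qed
  have "((\<lambda>z. ((m z - m' (z - a)) /\<^sub>R norm (z - a)) *\<^sub>R c z
      + (m' (z - a) / norm (z - a)) *\<^sub>R (c z - c a)) \<longlongrightarrow> 0 *\<^sub>R c a + 0) (at a)"
    using c by (intro tendsto_add tendsto_scaleR 1 2) (simp add: isCont_def)
  then have "((\<lambda>z. (m z *\<^sub>R c z - m a *\<^sub>R c a - m' (z - a) *\<^sub>R c a) /\<^sub>R norm (z - a)) \<longlongrightarrow> 0) (at a)"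
    using m(2) by (simp add: algebra_simps divide_inverse scaleR_diff_right)
  moreover have "bounded_linear (\<lambda>h. m' h *\<^sub>R c a)"
    by (rule bounded_linear_scaleR_const[OF lin])
  ultimately show ?thesis
    unfolding has_derivative_at_within by (simp add: diff_diff_eq)
qed


text \<open>Differentiating \<open>A B = 1\<close> gives \<open>B' = - B A' B\<close>, an expression of the same
  kind, so that the regularity of the inverse bootstraps. The bound \<open>K\<close> makes the inverses
  locally uniformly bounded, whence their continuity.\<close>

lemma Ck_on_inverse_operator:
  fixes A B :: "'c::euclidean_space \<Rightarrow> 'a::euclidean_space \<Rightarrow> 'a"
  assumes S: "open S" and lin: "\<And>x. x \<in> S \<Longrightarrow> linear (A x)"
    and AB: "\<And>x v. x \<in> S \<Longrightarrow> A x (B x v) = v" and BA: "\<And>x v. x \<in> S \<Longrightarrow> B x (A x v) = v"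
    and bound: "\<And>x v. x \<in> S \<Longrightarrow> norm v \<le> K * norm (A x v)"
    and Ck: "\<And>v. Ck_on k S (\<lambda>x. A x v)"
  shows "Ck_on k S (\<lambda>x. B x v)"
proof -
  have linB: "linear (B x)" if "x \<in> S" for x
  proof (rule linearI)
    fix u v c
    show "B x (u + v) = B x u + B x v"
      using BA[OF that, of "B x u + B x v"] by (simp add: linear_add[OF lin[OF that]] AB[OF that])
    show "B x (c *\<^sub>R v) = c *\<^sub>R B x v"
      using BA[OF that, of "c *\<^sub>R B x v"] by (simp add: linear_cmul[OF lin[OF that]] AB[OF that])
  qed
  have diffB: "B z v - B x v = B z (v - A z (B x v))" if "x \<in> S" "z \<in> S" for x z v
    using linB[OF that(2)] BA[OF that(2)] by (simp add: linear_diff)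
  have contB: "continuous_on S (\<lambda>x. B x v)" if "\<And>v. continuous_on S (\<lambda>x. A x v)" for v
  proof -
    have "((\<lambda>z. B z v) \<longlongrightarrow> B x v) (at x)" if x: "x \<in> S" for x
    proof -
      have "((\<lambda>z. A z (B x v)) \<longlongrightarrow> A x (B x v)) (at x)"
        using \<open>\<And>v. continuous_on S (\<lambda>x. A x v)\<close> S x
        by (metis continuous_on_eq_continuous_at isCont_def)
      then have *: "((\<lambda>z. v - A z (B x v)) \<longlongrightarrow> 0) (at x)"
        using AB[OF x] tendsto_diff[OF tendsto_const, of _ "A x (B x v)" "at x" v] by fastforce
      have "((\<lambda>z. B z v - B x v) \<longlongrightarrow> 0) (at x)"
      proof (rule Lim_null_comparison)
        show "\<forall>\<^sub>F z in at x. norm (B z v - B x v) \<le> K * norm (v - A z (B x v))"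
          using eventually_at_in_open'[OF S x]
        proof eventually_elim
          case (elim z)
          then show ?case using bound[OF elim, of "B z (v - A z (B x v))"] diffB[OF x elim] AB by simp
        qed
        show "((\<lambda>z. K * norm (v - A z (B x v))) \<longlongrightarrow> 0) (at x)"
          using tendsto_mult_right_zero[OF tendsto_norm_zero[OF *]] by simp
      qed
      then show ?thesis by (simp add: LIM_zero_iff)
    qed
    then show ?thesis by (auto simp: continuous_on_def intro: tendsto_within_subset)
  qed
  show ?thesis using Ck
  proof (induction k arbitrary: v)
    case 0
    then show ?case using contB by simp
  next
    case (Suc k)
    \<comment> \<open>the derivative of \<open>A y w\<close> at \<open>x\<close>, expanded so that it also makes sense for \<open>w\<close> depending on \<open>x\<close>\<close>
    define dA where "dA x w h = (\<Sum>b\<in>Basis. (w \<bullet> b) *\<^sub>R frechet_derivative (\<lambda>y. A y b) (at x) h)"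
      for x w h
    have dA: "((\<lambda>y. A y w) has_derivative dA x w) (at x)" if "x \<in> S" for x w
    proof (rule has_derivative_transform_within_open[OF _ S that])
      show "((\<lambda>y. \<Sum>b\<in>Basis. (w \<bullet> b) *\<^sub>R A y b) has_derivative dA x w) (at x)"
        unfolding dA_def
        by (intro has_derivative_sum bounded_linear.has_derivative[OF bounded_linear_scaleR_right]
            Ck_on_has_derivative[OF Suc.prems that])
      show "(\<Sum>b\<in>Basis. (w \<bullet> b) *\<^sub>R A y b) = A y w" if "y \<in> S" for y
        using linear_sum[OF lin[OF that], of "\<lambda>b. (w \<bullet> b) *\<^sub>R b" Basis] linear_cmul[OF lin[OF that]]
        by (simp add: euclidean_representation)
    qed
    show ?case
    proof (rule Ck_on_SucI[OF S])
      fix x assume x: "x \<in> S"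
      let ?w = "B x v"
      have "((\<lambda>z. B x v + (\<Sum>b\<in>Basis. ((v - A z ?w) \<bullet> b) *\<^sub>R B z b)) has_derivative
          (\<lambda>h. 0 + (\<Sum>b\<in>Basis. ((0 - dA x ?w h) \<bullet> b) *\<^sub>R B x b))) (at x)"
      proof (intro has_derivative_add has_derivative_const has_derivative_sum
          has_derivative_scaleR_zero bounded_linear.has_derivative[OF bounded_linear_inner_left]
          has_derivative_diff dA x)
        show "(v - A x ?w) \<bullet> b = 0" for b by (simp add: AB x)
        show "isCont (\<lambda>z. B z b) x" for b
          using contB[of b] S x Ck_on_continuous[OF Suc.prems]
          by (simp add: continuous_on_eq_continuous_at)
      qed
      moreover have "B z (\<Sum>b\<in>Basis. (u \<bullet> b) *\<^sub>R b) = (\<Sum>b\<in>Basis. (u \<bullet> b) *\<^sub>R B z b)" if "z \<in> S" for u z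
        using linB[OF that] by (simp add: linear_sum linear_cmul)
      then have expand: "(\<Sum>b\<in>Basis. (u \<bullet> b) *\<^sub>R B z b) = B z u" if "z \<in> S" for u z
        using that by (simp add: euclidean_representation)
      ultimately have "((\<lambda>z. B x v + (\<Sum>b\<in>Basis. ((v - A z ?w) \<bullet> b) *\<^sub>R B z b)) has_derivative
          (\<lambda>h. B x (- dA x ?w h))) (at x)"
        unfolding expand[OF x] by simp
      then show "((\<lambda>z. B z v) has_derivative (\<lambda>h. B x (- dA x ?w h))) (at x)"
      proof (rule has_derivative_transform_within_open[OF _ S x])
        show "B x v + (\<Sum>b\<in>Basis. ((v - A z ?w) \<bullet> b) *\<^sub>R B z b) = B z v" if "z \<in> S" for z
          unfolding expand[OF that] diffB[OF x that, symmetric] by simp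
      qed
    next
      fix h
      have IH: "Ck_on k S (\<lambda>x. B x u)" for u
        by (rule Suc.IH[OF Ck_on_Suc_imp[OF Suc.prems]])
      show "Ck_on k S (\<lambda>x. B x (- dA x (B x v) h))"
      proof (rule Ck_on_apply[OF S linB IH])
        have "Ck_on k S (\<lambda>x. frechet_derivative (\<lambda>y. A y b) (at x) h)" for b
          using Suc.prems by simp
        then have "Ck_on k S (\<lambda>x. dA x (B x v) h)"
          unfolding dA_def using IH[of v] Ck_on_euclidean_iff[OF S, of k "\<lambda>x. B x v"]
          by (intro Ck_on_sum[OF S] Ck_on_bilinear[OF bounded_bilinear_scaleR S]) blast+
        then show "Ck_on k S (\<lambda>x. - dA x (B x v) h)"
          using Ck_on_linear_compose[OF module_hom_uminus S] by blast
      qed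
    qed
  qed
qed

text \<open>The derivative of the local inverse \<open>g\<close> at \<open>y\<close> is the inverse of the derivative of \<open>f\<close>
  at \<open>g y\<close>; hence \<open>g\<close> of class \<open>C\<^sup>k\<close> implies \<open>g\<close> of class \<open>C\<^sup>k\<^sup>+\<^sup>1\<close>. Shrinking the domain first,
  so that the derivative stays within \<open>1/2\<close> of the identity, bounds its inverses.\<close>

lemma smooth_inverse_function:
  fixes f :: "'a::euclidean_space \<Rightarrow> 'a"
  assumes f: "smooth_on UNIV f" and id: "(f has_derivative (\<lambda>v. v)) (at p)"
  obtains W V g where "open W" "open V" "p \<in> W" "homeomorphism W V f g" "smooth_on W f" "smooth_on V g"
proof -
  define f' where "f' x = Blinfun (frechet_derivative f (at x))" for x
  have Ck: "Ck_on k UNIV f" for k using f by (simp add: smooth_on_def)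
  have der: "(f has_derivative frechet_derivative f (at x)) (at x)" for x
    using Ck_on_has_derivative[OF Ck[of "Suc 0"]] by simp
  then have f': "blinfun_apply (f' x) = frechet_derivative f (at x)" for x
    unfolding f'_def by (intro bounded_linear_Blinfun_apply has_derivative_bounded_linear)
  have Ckf': "Ck_on k UNIV (\<lambda>x. blinfun_apply (f' x) v)" for k v
    using Ck[of "Suc k"] by (simp add: f')
  have cont: "continuous_on UNIV f'"
    by (intro continuous_on_blinfun_componentwise Ck_on_continuous[OF Ckf'])
  have f'p: "f' p = id_blinfun"
    using frechet_derivative_at[OF id] by (intro blinfun_eqI) (simp add: f')
  define U where "U = {x. dist (f' x) id_blinfun < 1/2}"
  have U: "open U"
    unfolding U_def by (intro open_Collect_less continuous_intros cont)
  have p: "p \<in> U" by (simp add: U_def f'p)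
  have inv_p: "id_blinfun o\<^sub>L f' p = id_blinfun" by (simp add: f'p blinfun_eqI)
  obtain W V g g' where W: "open W" "W \<subseteq> U" "p \<in> W" "open V" "homeomorphism W V f g"
    and g': "\<And>y. y \<in> V \<Longrightarrow> (g has_derivative (g' y)) (at y)"
      "\<And>y. y \<in> V \<Longrightarrow> g' y = inv (blinfun_apply (f' (g y)))"
      "\<And>y. y \<in> V \<Longrightarrow> bij (blinfun_apply (f' (g y)))"
  proof (rule inverse_function_theorem[where f' = f', OF U _ _ p inv_p])
    show "(f has_derivative blinfun_apply (f' x)) (at x)" for x
      unfolding f' by (rule der)
    show "continuous_on U f'"
      using cont by (rule continuous_on_subset) simp
  qed blast+
  have bound: "norm v \<le> 2 * norm (blinfun_apply (f' x) v)" if "x \<in> U" for x v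
  proof -
    have "norm (blinfun_apply (f' x - id_blinfun) v) \<le> norm (f' x - id_blinfun) * norm v"
      by (rule norm_blinfun)
    also have "\<dots> \<le> 1/2 * norm v"
      using that by (intro mult_right_mono) (auto simp: U_def dist_norm)
    finally have "norm (blinfun_apply (f' x) v - v) \<le> norm v / 2"
      by (simp add: blinfun.diff_left)
    then show ?thesis using norm_triangle_ineq2[of v "blinfun_apply (f' x) v"]
      by (simp add: norm_minus_commute)
  qed
  have "Ck_on k V g" for k
  proof (induction k)
    case 0
    then show ?case using W(5) by (simp add: homeomorphism_def)
  next
    case (Suc k)
    show ?case
    proof (rule Ck_on_SucI[OF W(4) g'(1)])
      show "Ck_on k V (\<lambda>y. g' y v)" for v
      proof (rule Ck_on_inverse_operator[OF W(4)])
        fix y v assume y: "y \<in> V"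
        show "linear (blinfun_apply (f' (g y)))"
          by (simp add: blinfun.bounded_linear_right bounded_linear.linear)
        show "blinfun_apply (f' (g y)) (g' y v) = v" "g' y (blinfun_apply (f' (g y)) v) = v"
          using g'(2,3)[OF y] by (simp_all add: bij_is_surj surj_f_inv_f bij_is_inj)
        have "g y \<in> U" using W(2,5) y by (auto simp: homeomorphism_def)
        then show "norm v \<le> 2 * norm (blinfun_apply (f' (g y)) v)" by (rule bound)
      next
        show "Ck_on k V (\<lambda>y. blinfun_apply (f' (g y)) v)" for v
          by (rule Ck_on_compose[OF W(4) open_UNIV _ Suc Ckf']) simp
      qed
    qed
  qed
  moreover have "smooth_on W f" using Ck by (auto simp: smooth_on_def intro: Ck_on_subset)
  ultimately show ?thesis using that W by (auto simp: smooth_on_def)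
qed


section \<open>Submanifolds\<close>

lemma smooth_on_linear_compose: "linear L \<Longrightarrow> open S \<Longrightarrow> smooth_on S f \<Longrightarrow> smooth_on S (\<lambda>x. L (f x))"
  unfolding smooth_on_def by (blast intro: Ck_on_linear_compose)

lemma smooth_on_linear: "linear L \<Longrightarrow> open S \<Longrightarrow> smooth_on S L"
  unfolding smooth_on_def by (blast intro: Ck_on_linear)

lemma smooth_on_compose:
  "open S \<Longrightarrow> open T \<Longrightarrow> f ` S \<subseteq> T \<Longrightarrow> smooth_on S f \<Longrightarrow> smooth_on T g \<Longrightarrow> smooth_on S (\<lambda>x. g (f x))"
  unfolding smooth_on_def by (blast intro: Ck_on_compose)

lemma smooth_on_add: "open S \<Longrightarrow> smooth_on S f \<Longrightarrow> smooth_on S g \<Longrightarrow> smooth_on S (\<lambda>x. f x + g x)"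
  unfolding smooth_on_def by (blast intro: Ck_on_add)

lemma smooth_on_const: "open S \<Longrightarrow> smooth_on S (\<lambda>_. c)"
  unfolding smooth_on_def by (blast intro: Ck_on_const)

lemma smooth_on_diff: "open S \<Longrightarrow> smooth_on S f \<Longrightarrow> smooth_on S g \<Longrightarrow> smooth_on S (\<lambda>x. f x - g x)"
  using smooth_on_add[of S f "\<lambda>x. - g x"] smooth_on_linear_compose[OF module_hom_uminus, of S g] by simp

lemma smooth_on_bilinear:
  "bounded_bilinear B \<Longrightarrow> open S \<Longrightarrow> smooth_on S f \<Longrightarrow> smooth_on S g \<Longrightarrow> smooth_on S (\<lambda>x. B (f x) (g x))"
  unfolding smooth_on_def by (blast intro: Ck_on_bilinear)

text \<open>With \<open>T\<close> a right inverse of \<open>F'\<close>, the map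
  \<open>\<phi> z = (z - p) - T (F' (z - p)) + T (F z)\<close> is tangent to the identity at \<open>p\<close> and satisfies
  \<open>F' (\<phi> z) = F z\<close>, so it straightens the level set to the kernel of \<open>F'\<close>. The hypothesis on
  \<open>F'\<close> says that its adjoint is injective, which is how surjectivity is checked in examples.\<close>

lemma regular_level_set_submanifold:
  fixes F :: "'a::euclidean_space \<Rightarrow> 'b::euclidean_space"
  assumes F: "smooth_on UNIV F" "(F has_derivative F') (at p)" "F p = 0"
    and inj: "\<And>w. (\<And>v. F' v \<bullet> w = 0) \<Longrightarrow> w = 0"
  shows "submanifold_at (DIM('a) - DIM('b)) {z. F z = 0} p"
proof -
  have lin: "linear F'" using F(2) by (rule has_derivative_linear)
  have "surj F'"
  proof (rule ccontr)
    assume "\<not> surj F'"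
    have "subspace (range F')" using lin by (rule linear_subspace_image) simp
    then have "span (range F') \<subset> span UNIV"
      using \<open>\<not> surj F'\<close> by (simp add: span_eq_iff[THEN iffD2] psubset_eq)
    then obtain w where "w \<noteq> 0" "\<And>y. y \<in> span (range F') \<Longrightarrow> orthogonal w y"
      by (rule orthogonal_to_subspace_exists_gen) auto
    then show False
      using inj[of w] span_base[of _ "range F'"] by (metis inner_commute orthogonal_def rangeI)
  qed
  then obtain T where T: "linear T" "F' \<circ> T = id"
    using linear_surj_right_inverse[OF lin, of UNIV UNIV] by (auto simp: fun_eq_iff)
  then have FT: "F' (T y) = y" for y by (metis comp_apply id_apply)
  define L where "L = {v. F' v = 0}"
  have L: "subspace L" unfolding L_def by (rule linear_subspace_kernel[OF lin])
  have "dim L = DIM('a) - DIM('b)"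
  proof -
    let ?A = "adjoint F'"
    have "inj ?A"
      by (rule linear_injective_0[OF adjoint_linear[OF lin], THEN iffD2])
        (metis inj adjoint_works lin inner_zero_right)
    then have "dim (range ?A) = DIM('b)"
      using dim_image_eq[OF adjoint_linear[OF lin], of UNIV] by simp
    moreover have "subspace (range ?A)"
      using adjoint_linear[OF lin] by (rule linear_subspace_image) simp
    then have "dim {y \<in> UNIV. \<forall>x\<in>range ?A. orthogonal x y} + dim (range ?A) = dim (UNIV :: 'a set)"
      by (rule dim_subspace_orthogonal_to_vectors) auto
    moreover have "{y \<in> UNIV. \<forall>x\<in>range ?A. orthogonal x y} = L"
    proof -
      have "orthogonal (?A w) y \<longleftrightarrow> w \<bullet> F' y = 0" for w y
        by (simp add: orthogonal_def inner_commute[of _ y] adjoint_works[OF lin])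
          (simp add: inner_commute)
      then show ?thesis unfolding L_def by auto (metis inner_eq_zero_iff)
    qed
    ultimately show ?thesis by simp
  qed
  \<comment> \<open>the component in the kernel of \<open>F'\<close> is kept, and the complementary one is replaced by \<open>F\<close>\<close>
  define \<phi> where "\<phi> z = (z - p) - T (F' (z - p)) + T (F z)" for z
  have F'\<phi>: "F' (\<phi> z) = F z" for z
    by (simp add: \<phi>_def linear_add[OF lin] linear_diff[OF lin] FT)
  have "smooth_on UNIV \<phi>"
    unfolding \<phi>_def
    by (intro smooth_on_add smooth_on_diff smooth_on_linear_compose[OF T(1)]
        smooth_on_linear_compose[OF lin] smooth_on_const F(1) open_UNIV
        smooth_on_linear module_hom_ident)
  moreover have "(\<phi> has_derivative (\<lambda>v. v)) (at p)"
  proof -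
    have "bounded_linear F'" "bounded_linear T"
      using lin T(1) by (simp_all add: linear_conv_bounded_linear)
    then have "(\<phi> has_derivative (\<lambda>v. (v - 0) - T (F' (v - 0)) + T (F' v))) (at p)"
      unfolding \<phi>_def
      by (intro has_derivative_add has_derivative_diff has_derivative_ident has_derivative_const
          bounded_linear.has_derivative[of T] bounded_linear.has_derivative[of F'] F(2))
    then show ?thesis by simp
  qed
  ultimately obtain W V \<psi> where W: "open W" "open V" "p \<in> W" "homeomorphism W V \<phi> \<psi>"
    "smooth_on W \<phi>" "smooth_on V \<psi>"
    by (rule smooth_inverse_function)
  moreover have "\<phi> ` (W \<inter> {z. F z = 0}) = V \<inter> L"
  proof -
    have "\<phi> ` W = V" using W(4) by (simp add: homeomorphism_def)
    then show ?thesis using F'\<phi> by (auto simp: L_def)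
  qed
  ultimately show ?thesis
    unfolding submanifold_at_def using F(3) L \<open>dim L = _\<close> by blast
qed

lemma submanifold_at_linear_vimage:
  fixes T T' :: "'a::euclidean_space \<Rightarrow> 'a"
  assumes T: "linear T" "linear T'" "\<And>x. T' (T x) = x" "\<And>x. T (T' x) = x"
    and sub: "submanifold_at k S (T p)"
  shows "submanifold_at k (T -` S) p"
proof -
  obtain W W' \<phi> \<psi> and L :: "'a set" where W: "T p \<in> S" "open W" "open W'" "T p \<in> W" "homeomorphism W W' \<phi> \<psi>"
      "smooth_on W \<phi>" "smooth_on W' \<psi>" "subspace L" "dim L = k" "\<phi> ` (W \<inter> S) = W' \<inter> L"
    using sub unfolding submanifold_at_def by blast
  have contT: "continuous_on X T" "continuous_on X T'" for X
    using T(1,2) by (simp_all add: linear_continuous_on linear_conv_bounded_linear)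
  have open_vim: "open (T -` W)"
    using open_vimage[OF W(2) contT(1)[of UNIV]] .
  have im: "T ` (T -` X) = X" for X
    by (auto simp: image_iff) (metis T(4))
  have "homeomorphism (T -` W) W T T'"
    using T(3,4) by (intro homeomorphismI contT) auto
  then have "homeomorphism (T -` W) W' (\<phi> \<circ> T) (T' \<circ> \<psi>)"
    using W(5) by (rule homeomorphism_compose)
  moreover have "smooth_on (T -` W) (\<phi> \<circ> T)"
    unfolding comp_def
    by (rule smooth_on_compose[OF open_vim W(2) _ smooth_on_linear[OF T(1) open_vim] W(6)]) auto
  moreover have "smooth_on W' (T' \<circ> \<psi>)"
    unfolding comp_def by (rule smooth_on_linear_compose[OF T(2) W(3,7)])
  moreover have "(\<phi> \<circ> T) ` (T -` W \<inter> T -` S) = W' \<inter> L"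
    unfolding image_comp[symmetric] vimage_Int[symmetric] im by (rule W(10))
  ultimately show ?thesis
    unfolding submanifold_at_def using W open_vim by blast
qed

text \<open>The transition between two straightenings embeds a nonempty open piece of one linear model
  into the other, so invariance of dimension applies.\<close>

lemma submanifold_at_dim_le:
  fixes S :: "'a::euclidean_space set"
  assumes "submanifold_at k S p" "submanifold_at l S p"
  shows "k \<le> l"
proof -
  obtain W W' \<phi> \<psi> and L :: "'a set" where W: "p \<in> S" "open W" "open W'" "p \<in> W" "homeomorphism W W' \<phi> \<psi>"
      "subspace L" "dim L = k" "\<phi> ` (W \<inter> S) = W' \<inter> L"
    using assms(1) unfolding submanifold_at_def by blast
  obtain X X' \<phi>' \<psi>' and L' :: "'a set" where X: "open X" "open X'" "p \<in> X" "homeomorphism X X' \<phi>' \<psi>'"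
      "subspace L'" "dim L' = l" "\<phi>' ` (X \<inter> S) = X' \<inter> L'"
    using assms(2) unfolding submanifold_at_def by blast
  have inj: "inj_on \<phi> W" "inj_on \<phi>' X"
    using W(5) X(4) by (auto simp: homeomorphism_def intro: inj_on_inverseI)
  define A where "A = \<phi> ` (W \<inter> X \<inter> S)"
  have \<psi>: "\<psi> (\<phi> z) = z" if "z \<in> W" for z using W(5) that by (simp add: homeomorphism_def)
  have "open (\<phi> ` (W \<inter> X))"
  proof (rule invariance_of_domain)
    show "continuous_on (W \<inter> X) \<phi>"
      using W(5) by (auto simp: homeomorphism_def intro: continuous_on_subset)
    show "inj_on \<phi> (W \<inter> X)" using inj(1) by (rule inj_on_subset) auto
  qed (use W X in auto)
  moreover have "A = L \<inter> \<phi> ` (W \<inter> X)"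
  proof
    show "A \<subseteq> L \<inter> \<phi> ` (W \<inter> X)" using W(8) by (auto simp: A_def)
    show "L \<inter> \<phi> ` (W \<inter> X) \<subseteq> A"
    proof
      fix y assume "y \<in> L \<inter> \<phi> ` (W \<inter> X)"
      then obtain z where z: "y \<in> L" "y = \<phi> z" "z \<in> W" "z \<in> X" by auto
      then have "y \<in> \<phi> ` (W \<inter> S)" using W(5,8) by (auto simp: homeomorphism_def)
      then have "z \<in> S" using z inj(1) by (auto dest: inj_onD)
      then show "y \<in> A" using z by (auto simp: A_def)
    qed
  qed
  ultimately have "openin (top_of_set L) A" by (simp add: openin_open_Int)
  then have "dim L \<le> dim L'"
  proof (rule invariance_of_dimension_subspaces)
    have "continuous_on A \<psi>"
      using W(5) by (auto simp: homeomorphism_def A_def intro: continuous_on_subset)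
    moreover have "continuous_on (\<psi> ` A) \<phi>'"
      using X(4) \<psi> by (auto simp: homeomorphism_def A_def intro: continuous_on_subset)
    ultimately show "continuous_on A (\<phi>' \<circ> \<psi>)" by (rule continuous_on_compose)
    show "\<phi>' \<circ> \<psi> \<in> A \<rightarrow> L'" using \<psi> X(7) by (auto simp: A_def)
    have "inj_on \<psi> A" using \<psi> by (auto simp: A_def intro!: inj_onI)
    moreover have "inj_on \<phi>' (\<psi> ` A)"
      using inj(2) by (rule inj_on_subset) (auto simp: A_def \<psi>)
    ultimately show "inj_on (\<phi>' \<circ> \<psi>) A" by (rule comp_inj_on)
    show "A \<noteq> {}" using W X by (auto simp: A_def)
  qed (use W X in auto)
  then show ?thesis using W X by simp
qed


section \<open>Quaternions\<close>

lemma qcnj_sel [simp]: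
  "qRe (qcnj p) = qRe p" "qI (qcnj p) = - qI p" "qJ (qcnj p) = - qJ p" "qK (qcnj p) = - qK p"
  by (simp_all add: qcnj_def)

lemma quat_units_sel [simp]:
  "qRe qi = 0" "qI qi = 1" "qJ qi = 0" "qK qi = 0"
  "qRe qj = 0" "qI qj = 0" "qJ qj = 1" "qK qj = 0"
  "qRe qk = 0" "qI qk = 0" "qJ qk = 0" "qK qk = 1"
  by (simp_all add: qi_def qj_def qk_def)

lemma qcnj_simps [simp]:
  "qcnj 0 = 0" "qcnj (qcnj p) = p" "qcnj (p + q) = qcnj p + qcnj q" "qcnj (- p) = - qcnj p"
  "qcnj (p * q) = qcnj q * qcnj p" "qcnj (r *\<^sub>R p) = r *\<^sub>R qcnj p"
  by (simp_all add: quat_eq_iff)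

lemma quat_of_real_sel [simp]:
  "qRe (of_real r) = r" "qI (of_real r) = 0" "qJ (of_real r) = 0" "qK (of_real r) = 0"
  by (simp_all add: of_real_def)

lemma norm_qcnj [simp]: "norm (qcnj p) = norm p"
  by (simp add: norm_quat_def)

lemma norm_quat_units [simp]: "norm qi = 1"
  by (simp add: norm_quat_def)

lemma qcnj_eq_0_iff [simp]: "qcnj p = 0 \<longleftrightarrow> p = 0"
  by (simp add: quat_eq_iff)

lemma mult_qcnj: "p * qcnj p = of_real (p \<bullet> p)" "qcnj p * p = of_real (p \<bullet> p)"
  by (simp_all add: quat_eq_iff inner_quat_def)

lemma inner_quat_mult: "(c * x * a) \<bullet> (c * y * a) = (c \<bullet> c) * (a \<bullet> a) * (x \<bullet> y)" for x y :: quat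
  by (simp add: inner_quat_def) algebra

text \<open>If \<open>v\<close>, \<open>v'\<close> are the imaginary parts then \<open>v\<^sup>2 = v'\<^sup>2\<close>, so \<open>(v' + v) v = v' (v' + v)\<close>;
  when \<open>v' = - v\<close> this is void, and an imaginary unit orthogonal to \<open>v\<close> does the job.\<close>

lemma quat_conjugate:
  assumes "qRe p = qRe p'" "norm p = norm p'"
  obtains c where "norm c = 1" "c * p = p' * c"
proof -
  obtain t b1 b2 b3 where p: "p = Quat t b1 b2 b3" by (cases p)
  obtain c1 c2 c3 where p': "p' = Quat t c1 c2 c3" using assms(1) by (cases p') (auto simp: p)
  have n: "b1\<^sup>2 + b2\<^sup>2 + b3\<^sup>2 = c1\<^sup>2 + c2\<^sup>2 + c3\<^sup>2"
    using assms(2) by (simp add: p p' norm_quat_def)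
  obtain c where c: "c \<noteq> 0" "c * p = p' * c"
  proof (cases "c1 = - b1 \<and> c2 = - b2 \<and> c3 = - b3")
    case False
    then have "Quat 0 (b1 + c1) (b2 + c2) (b3 + c3) \<noteq> 0" by (auto simp: zero_quat_def)
    moreover have "Quat 0 (b1 + c1) (b2 + c2) (b3 + c3) * p = p' * Quat 0 (b1 + c1) (b2 + c2) (b3 + c3)"
      using n by (simp add: quat_eq_iff p p' algebra_simps power2_eq_square)
    ultimately show ?thesis by (rule that)
  next
    case opposite: True
    show ?thesis
    proof (cases "b1 = 0 \<and> b2 = 0")
      case True
      then show ?thesis using opposite that[of qi] by (simp add: quat_eq_iff p p')
    next
      case False
      show ?thesis
      proof (rule that)
        show "Quat 0 (- b2) b1 0 \<noteq> 0" using False by (auto simp: quat_eq_iff)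
        show "Quat 0 (- b2) b1 0 * p = p' * Quat 0 (- b2) b1 0"
          using opposite by (simp add: quat_eq_iff p p')
      qed
    qed
  qed
  have "norm (c /\<^sub>R norm c) = 1" using c(1) by simp
  moreover have "(c /\<^sub>R norm c) * p = p' * (c /\<^sub>R norm c)" using c(2) by simp
  ultimately show ?thesis by (rule that)
qed


section \<open>Oriented planes and their bases\<close>

text \<open>The squared area of the parallelogram spanned by the two vectors.\<close>

definition gram :: "'a::real_inner \<Rightarrow> 'a \<Rightarrow> real" where
  "gram a b = (a \<bullet> a) * (b \<bullet> b) - (a \<bullet> b)\<^sup>2"

lemma gram_combination:
  "gram (\<alpha> *\<^sub>R a + \<beta> *\<^sub>R b) (\<gamma> *\<^sub>R a + \<delta> *\<^sub>R b) = (\<alpha> * \<delta> - \<beta> * \<gamma>)\<^sup>2 * gram a b"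
  by (simp add: gram_def inner_add inner_commute[of b a] power2_eq_square) algebra

lemma gram_nonneg: "0 \<le> gram a b"
  unfolding gram_def using Cauchy_Schwarz_ineq[of a b] by simp

lemma gram_zero_left [simp]: "gram 0 b = 0" "gram a 0 = 0"
  by (simp_all add: gram_def)

lemma gram_eq_0_iff: "gram a b = 0 \<longleftrightarrow> lin_dep_pair a b"
proof (cases "a = 0")
  case True
  then show ?thesis by (simp add: lin_dep_pair_def dependent_zero)
next
  case False
  define k where "k = (a \<bullet> b) / (a \<bullet> a)"
  have "gram a b = (a \<bullet> a) * (norm (b - k *\<^sub>R a))\<^sup>2"
  proof -
    have k: "k * (a \<bullet> a) = a \<bullet> b" using False by (simp add: k_def)
    have "(a \<bullet> a) * ((b - k *\<^sub>R a) \<bullet> (b - k *\<^sub>R a))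
        = (a \<bullet> a) * (b \<bullet> b) - 2 * (k * (a \<bullet> a)) * (a \<bullet> b) + (k * (a \<bullet> a))\<^sup>2"
      by (simp add: inner_diff inner_commute[of b a] algebra_simps power2_eq_square)
    then show ?thesis unfolding k gram_def power2_norm_eq_inner by (simp add: power2_eq_square)
  qed
  then have *: "gram a b = 0 \<longleftrightarrow> b = k *\<^sub>R a" using False by simp
  show ?thesis
  proof
    assume "gram a b = 0"
    then have "b \<in> span {a}" using * by (auto simp: span_singleton)
    moreover have "a = b \<or> {a, b} - {b} = {a}" by auto
    ultimately show "lin_dep_pair a b"
      unfolding lin_dep_pair_def dependent_def by (metis insertCI)
  next
    assume dep: "lin_dep_pair a b"
    show "gram a b = 0"
    proof (cases "a = b")
      case True
      then show ?thesis by (simp add: gram_def power2_eq_square)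
    next
      case False
      then have "dependent (insert b {a})" using dep by (simp add: lin_dep_pair_def insert_commute)
      then have "b \<in> span {a}"
        using \<open>a \<noteq> 0\<close> False independent_insertI[of b "{a}"] by auto
      then obtain m where "b = m *\<^sub>R a" by (auto simp: span_singleton)
      then show ?thesis by (simp add: gram_def power2_eq_square)
    qed
  qed
qed

lemma stiefel_iff: "(q, q') \<in> stiefel \<longleftrightarrow> q \<bullet> q = 1 \<and> q' \<bullet> q' = 1 \<and> q \<bullet> q' = 0"
  by (simp add: stiefel_def norm_eq_1)

lemma gram_stiefel: "(q, q') \<in> stiefel \<Longrightarrow> gram q q' = 1"
  by (simp add: stiefel_iff gram_def)

lemma in_oplaneI:
  "(p, p') \<in> stiefel \<Longrightarrow> p = \<alpha> *\<^sub>R a + \<beta> *\<^sub>R b \<Longrightarrow> p' = \<gamma> *\<^sub>R a + \<delta> *\<^sub>R b \<Longrightarrow> \<alpha> * \<delta> - \<beta> * \<gamma> > 0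
    \<Longrightarrow> (p, p') \<in> oplane a b"
  unfolding oplane_def by blast

lemma oplane_combination_subset:
  assumes "\<alpha> * \<delta> - \<beta> * \<gamma> > 0"
  shows "oplane (\<alpha> *\<^sub>R a + \<beta> *\<^sub>R b) (\<gamma> *\<^sub>R a + \<delta> *\<^sub>R b) \<subseteq> oplane a b"
proof clarify
  fix p p' assume "(p, p') \<in> oplane (\<alpha> *\<^sub>R a + \<beta> *\<^sub>R b) (\<gamma> *\<^sub>R a + \<delta> *\<^sub>R b)"
  then obtain \<alpha>' \<beta>' \<gamma>' \<delta>' where p: "(p, p') \<in> stiefel" "\<alpha>' * \<delta>' - \<beta>' * \<gamma>' > 0"
    "p = \<alpha>' *\<^sub>R (\<alpha> *\<^sub>R a + \<beta> *\<^sub>R b) + \<beta>' *\<^sub>R (\<gamma> *\<^sub>R a + \<delta> *\<^sub>R b)"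
    "p' = \<gamma>' *\<^sub>R (\<alpha> *\<^sub>R a + \<beta> *\<^sub>R b) + \<delta>' *\<^sub>R (\<gamma> *\<^sub>R a + \<delta> *\<^sub>R b)"
    by (auto simp: oplane_def)
  have e: "p = (\<alpha>' * \<alpha> + \<beta>' * \<gamma>) *\<^sub>R a + (\<alpha>' * \<beta> + \<beta>' * \<delta>) *\<^sub>R b"
    "p' = (\<gamma>' * \<alpha> + \<delta>' * \<gamma>) *\<^sub>R a + (\<gamma>' * \<beta> + \<delta>' * \<delta>) *\<^sub>R b"
    by (simp_all add: p algebra_simps)
  have d: "(\<alpha>' * \<alpha> + \<beta>' * \<gamma>) * (\<gamma>' * \<beta> + \<delta>' * \<delta>) - (\<alpha>' * \<beta> + \<beta>' * \<delta>) * (\<gamma>' * \<alpha> + \<delta>' * \<gamma>)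
    = (\<alpha>' * \<delta>' - \<beta>' * \<gamma>') * (\<alpha> * \<delta> - \<beta> * \<gamma>)"
    by algebra
  show "(p, p') \<in> oplane a b"
    using p(2) assms by (intro in_oplaneI[OF p(1) e]) (simp add: d)
qed

lemma oplane_combination:
  assumes "\<alpha> * \<delta> - \<beta> * \<gamma> > 0"
  shows "oplane (\<alpha> *\<^sub>R a + \<beta> *\<^sub>R b) (\<gamma> *\<^sub>R a + \<delta> *\<^sub>R b) = oplane a b"
proof
  let ?a = "\<alpha> *\<^sub>R a + \<beta> *\<^sub>R b" and ?b = "\<gamma> *\<^sub>R a + \<delta> *\<^sub>R b"
  define m where "m = \<alpha> * \<delta> - \<beta> * \<gamma>"
  have m: "m > 0" using assms by (simp add: m_def)
  have "(\<delta> / m) *\<^sub>R ?a + (- \<beta> / m) *\<^sub>R ?b = ((\<alpha> * \<delta> - \<beta> * \<gamma>) / m) *\<^sub>R a"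
    "(- \<gamma> / m) *\<^sub>R ?a + (\<alpha> / m) *\<^sub>R ?b = ((\<alpha> * \<delta> - \<beta> * \<gamma>) / m) *\<^sub>R b"
    by (simp_all add: algebra_simps diff_divide_distrib)
  then have "a = (\<delta> / m) *\<^sub>R ?a + (- \<beta> / m) *\<^sub>R ?b" "b = (- \<gamma> / m) *\<^sub>R ?a + (\<alpha> / m) *\<^sub>R ?b"
    using m by (simp_all add: m_def)
  moreover have "(\<delta> / m) * (\<alpha> / m) - (- \<beta> / m) * (- \<gamma> / m) = m / (m * m)"
    by (simp add: m_def diff_divide_distrib mult.commute)
  then have "(\<delta> / m) * (\<alpha> / m) - (- \<beta> / m) * (- \<gamma> / m) > 0" using m by simp
  ultimately show "oplane a b \<subseteq> oplane ?a ?b"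
    using oplane_combination_subset by metis
qed (rule oplane_combination_subset[OF assms])

lemma in_oplaneD:
  assumes "(p, p') \<in> oplane a b"
  obtains \<alpha> \<beta> \<gamma> \<delta> where "(p, p') \<in> stiefel" "p = \<alpha> *\<^sub>R a + \<beta> *\<^sub>R b" "p' = \<gamma> *\<^sub>R a + \<delta> *\<^sub>R b"
    "\<alpha> * \<delta> - \<beta> * \<gamma> > 0"
  using assms by (auto simp: oplane_def)

text \<open>A change of basis of positive determinant does not change the oriented plane; hence the
  oriented plane is known from any one of its bases.\<close>

lemma oplane_eqI: "(p, p') \<in> oplane a b \<Longrightarrow> oplane p p' = oplane a b"
  by (metis in_oplaneD oplane_combination)

lemma in_oplane_self: "(q, q') \<in> stiefel \<Longrightarrow> (q, q') \<in> oplane q q'"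
  by (rule in_oplaneI[of _ _ 1 _ 0 _ 0 1]) auto

lemma oplane_eq_iff: "(p, p') \<in> stiefel \<Longrightarrow> oplane p p' = oplane a b \<longleftrightarrow> (p, p') \<in> oplane a b"
  using in_oplane_self oplane_eqI by blast

lemma stiefel_rotate:
  assumes "(q, q') \<in> stiefel" "c\<^sup>2 + s\<^sup>2 = 1"
  shows "(c *\<^sub>R q + s *\<^sub>R q', - s *\<^sub>R q + c *\<^sub>R q') \<in> stiefel"
  using assms by (simp add: stiefel_iff inner_add inner_commute[of q' q] power2_eq_square algebra_simps)

lemma oplane_rotate:
  "c\<^sup>2 + s\<^sup>2 = 1 \<Longrightarrow> oplane (c *\<^sub>R a + s *\<^sub>R b) (- s *\<^sub>R a + c *\<^sub>R b) = oplane a b"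
  by (rule oplane_combination) (simp add: power2_eq_square)

lemma in_oplane_rotation:
  assumes "(q, q') \<in> stiefel" "(p, p') \<in> oplane q q'"
  obtains c s where "c\<^sup>2 + s\<^sup>2 = 1" "p = c *\<^sub>R q + s *\<^sub>R q'" "p' = - s *\<^sub>R q + c *\<^sub>R q'"
proof -
  from assms(2) obtain \<alpha> \<beta> \<gamma> \<delta> where p: "(p, p') \<in> stiefel" "p = \<alpha> *\<^sub>R q + \<beta> *\<^sub>R q'"
    "p' = \<gamma> *\<^sub>R q + \<delta> *\<^sub>R q'" "\<alpha> * \<delta> - \<beta> * \<gamma> > 0"
    by (rule in_oplaneD)
  then have eqs: "\<alpha>\<^sup>2 + \<beta>\<^sup>2 = 1" "\<gamma>\<^sup>2 + \<delta>\<^sup>2 = 1" "\<alpha> * \<gamma> + \<beta> * \<delta> = 0"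
    using assms(1)
    by (simp_all add: stiefel_iff inner_add inner_commute[of q' q] power2_eq_square mult.commute)
  have "(\<alpha> * \<delta> - \<beta> * \<gamma>)\<^sup>2 = (\<alpha>\<^sup>2 + \<beta>\<^sup>2) * (\<gamma>\<^sup>2 + \<delta>\<^sup>2) - (\<alpha> * \<gamma> + \<beta> * \<delta>)\<^sup>2"
    by algebra
  then have "\<alpha> * \<delta> - \<beta> * \<gamma> = 1" using p(4) by (simp add: eqs power2_eq_1_iff)
  moreover have "(\<alpha> - \<delta>)\<^sup>2 + (\<beta> + \<gamma>)\<^sup>2 = (\<alpha>\<^sup>2 + \<beta>\<^sup>2) + (\<gamma>\<^sup>2 + \<delta>\<^sup>2) - 2 * (\<alpha> * \<delta> - \<beta> * \<gamma>)"
    by algebra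
  ultimately have "(\<alpha> - \<delta>)\<^sup>2 + (\<beta> + \<gamma>)\<^sup>2 = 0" by (simp add: eqs)
  then have "\<delta> = \<alpha>" "\<gamma> = - \<beta>" by (auto simp: sum_power2_eq_zero_iff)
  then show ?thesis using that[of \<alpha> \<beta>] p eqs by simp
qed

lemma exists_stiefel_basis:
  assumes "gram a b > 0"
  obtains \<alpha> \<gamma> \<delta> where "\<alpha> > 0" "\<delta> > 0" "(\<alpha> *\<^sub>R a, \<gamma> *\<^sub>R a + \<delta> *\<^sub>R b) \<in> stiefel"
proof -
  have a: "a \<bullet> a > 0" using assms by (cases "a = 0") (auto simp: gram_def)
  define h where "h = b - ((a \<bullet> b) / (a \<bullet> a)) *\<^sub>R a"
  have ah: "a \<bullet> h = 0" using a by (simp add: h_def inner_diff)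
  have "(a \<bullet> a) * (h \<bullet> h) = gram a b"
    using a by (simp add: h_def gram_def inner_diff inner_commute[of b a] field_simps power2_eq_square)
  then have h: "h \<bullet> h > 0" using assms a by (metis zero_less_mult_pos)
  have "(a /\<^sub>R norm a, h /\<^sub>R norm h) \<in> stiefel"
    using a h ah by (simp add: stiefel_def)
  moreover have "h /\<^sub>R norm h = (- (a \<bullet> b) / (a \<bullet> a) / norm h) *\<^sub>R a + (1 / norm h) *\<^sub>R b"
    by (simp add: h_def algebra_simps divide_inverse)
  moreover have "inverse (norm a) > 0" "1 / norm h > 0" using a h by auto
  ultimately show ?thesis using that by metis
qed


section \<open>The form \<open>B\<close> and the level sets of the Gram determinant\<close>

lemma bounded_bilinear_formB: "bounded_bilinear formB"
  unfolding bilinear_conv_bounded_bilinear[symmetric] bilinear_def formB_def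
  by (auto intro!: linearI simp: algebra_simps)

lemmas formB_linear_simps =
  bounded_bilinear.add_left[OF bounded_bilinear_formB] bounded_bilinear.add_right[OF bounded_bilinear_formB]
  bounded_bilinear.scaleR_left[OF bounded_bilinear_formB]
  bounded_bilinear.scaleR_right[OF bounded_bilinear_formB]

lemma formB_swap: "formB b a = qcnj (formB a b)"
  by (simp add: formB_def)

lemma formB_self: "formB a a = of_real (a \<bullet> a)"
  by (simp add: formB_def mult_qcnj inner_prod_def of_real_add[symmetric] del: of_real_add)

lemma qRe_formB: "qRe (formB a b) = a \<bullet> b"
  by (simp add: formB_def inner_prod_def inner_quat_def)

text \<open>The imaginary part of \<open>B\<close> is alternating, hence its vanishing is a property of the plane.\<close>

lemma formB_real_combination:
  assumes "\<alpha> * \<delta> - \<beta> * \<gamma> \<noteq> 0" "p = \<alpha> *\<^sub>R a + \<beta> *\<^sub>R b" "p' = \<gamma> *\<^sub>R a + \<delta> *\<^sub>R b"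
  shows "formB p p' = of_real (p \<bullet> p') \<longleftrightarrow> formB a b = of_real (a \<bullet> b)"
proof -
  have re: "formB u v = of_real (u \<bullet> v) \<longleftrightarrow> qI (formB u v) = 0 \<and> qJ (formB u v) = 0 \<and> qK (formB u v) = 0"
    for u v
    by (simp add: quat_eq_iff qRe_formB)
  have "formB p p' = (\<alpha> * \<gamma>) *\<^sub>R of_real (a \<bullet> a) + (\<beta> * \<delta>) *\<^sub>R of_real (b \<bullet> b)
      + (\<alpha> * \<delta>) *\<^sub>R formB a b + (\<beta> * \<gamma>) *\<^sub>R qcnj (formB a b)"
    by (simp add: assms formB_linear_simps formB_swap[of b a] formB_self algebra_simps)
  then have "qI (formB p p') = (\<alpha> * \<delta> - \<beta> * \<gamma>) * qI (formB a b)"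
    "qJ (formB p p') = (\<alpha> * \<delta> - \<beta> * \<gamma>) * qJ (formB a b)"
    "qK (formB p p') = (\<alpha> * \<delta> - \<beta> * \<gamma>) * qK (formB a b)"
    by (simp_all add: algebra_simps)
  then show ?thesis using assms(1) by (simp add: re)
qed

lemma V_set_iff: "(q, q') \<in> V_set \<longleftrightarrow> (q, q') \<in> stiefel \<and> formB q q' = 0"
  using qRe_formB[of q q'] by (auto simp: V_set_def stiefel_def)

lemma V_set_iff_real: "(q, q') \<in> V_set \<longleftrightarrow> (q, q') \<in> stiefel \<and> formB q q' = of_real (q \<bullet> q')"
  by (auto simp: V_set_iff stiefel_def)

text \<open>The squared area \<open>d\<close> of \<open>(x, x')\<close> is the same for all oriented orthonormal bases of a plane.
  Its level sets in \<open>Q\<close> turn out to be the orbits.\<close>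

definition level :: "real \<Rightarrow> oplane set" where
  "level d = {oplane q q' |q q'. (q, q') \<in> V_set \<and> gram (fst q) (fst q') = d}"

text \<open>The chart of the Grassmannian produces bases that are not orthonormal. On these the equations
  of a level set become homogeneous, since both Gram determinants get multiplied by the squared
  determinant of a change of basis.\<close>

lemma oplane_in_level_iff:
  assumes "gram a b > 0"
  shows "oplane a b \<in> level d \<longleftrightarrow> formB a b = of_real (a \<bullet> b) \<and> gram (fst a) (fst b) = d * gram a b"
proof -
  have key: "(p, p') \<in> V_set \<and> gram (fst p) (fst p') = d
      \<longleftrightarrow> formB a b = of_real (a \<bullet> b) \<and> gram (fst a) (fst b) = d * gram a b"
    if p: "(p, p') \<in> stiefel" "p = \<alpha> *\<^sub>R a + \<beta> *\<^sub>R b" "p' = \<gamma> *\<^sub>R a + \<delta> *\<^sub>R b"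
      "\<alpha> * \<delta> - \<beta> * \<gamma> > 0" for p p' \<alpha> \<beta> \<gamma> \<delta>
  proof -
    let ?m = "\<alpha> * \<delta> - \<beta> * \<gamma>"
    have "?m\<^sup>2 * gram a b = 1"
      using gram_stiefel[OF p(1)] gram_combination[of \<alpha> a \<beta> b \<gamma> \<delta>] p(2,3) by simp
    moreover have "gram (fst p) (fst p') = ?m\<^sup>2 * gram (fst a) (fst b)"
      using gram_combination[of \<alpha> "fst a" \<beta> "fst b" \<gamma> \<delta>] p(2,3) by simp
    moreover have "?m\<^sup>2 > 0" using p(4) by simp
    ultimately have "gram (fst p) (fst p') = d \<longleftrightarrow> gram (fst a) (fst b) = d * gram a b"
      by (metis mult.left_commute mult_cancel_left mult.right_neutral less_irrefl)
    then show ?thesis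
      using formB_real_combination[of \<alpha> \<delta> \<beta> \<gamma> p a b p'] p by (simp add: V_set_iff_real)
  qed
  obtain \<alpha> \<gamma> \<delta> where ex: "\<alpha> > 0" "\<delta> > 0" "(\<alpha> *\<^sub>R a, \<gamma> *\<^sub>R a + \<delta> *\<^sub>R b) \<in> stiefel"
    using exists_stiefel_basis[OF assms] by metis
  show ?thesis
  proof
    assume "oplane a b \<in> level d"
    then obtain p p' where p: "oplane p p' = oplane a b" "(p, p') \<in> V_set" "gram (fst p) (fst p') = d"
      unfolding level_def by auto
    then have "(p, p') \<in> oplane a b" using oplane_eq_iff V_set_iff by blast
    then show "formB a b = of_real (a \<bullet> b) \<and> gram (fst a) (fst b) = d * gram a b"
      using key p by (metis in_oplaneD)
  next
    assume R: "formB a b = of_real (a \<bullet> b) \<and> gram (fst a) (fst b) = d * gram a b"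
    have pos: "\<alpha> * \<delta> - 0 * \<gamma> > 0" using ex by simp
    have "(\<alpha> *\<^sub>R a, \<gamma> *\<^sub>R a + \<delta> *\<^sub>R b) \<in> V_set \<and> gram (fst (\<alpha> *\<^sub>R a)) (fst (\<gamma> *\<^sub>R a + \<delta> *\<^sub>R b)) = d"
      using R by (subst key[OF ex(3) _ _ pos]) auto
    moreover have "oplane (\<alpha> *\<^sub>R a) (\<gamma> *\<^sub>R a + \<delta> *\<^sub>R b) = oplane a b"
      using oplane_combination[OF pos, of a b] by simp
    ultimately show "oplane a b \<in> level d"
      unfolding level_def by (metis (mono_tags, lifting) mem_Collect_eq)
  qed
qed

lemma stiefel_in_level_iff:
  "(q, q') \<in> stiefel \<Longrightarrow> oplane q q' \<in> level d \<longleftrightarrow> (q, q') \<in> V_set \<and> gram (fst q) (fst q') = d"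
  using oplane_in_level_iff[of q q' d] by (auto simp: gram_stiefel V_set_iff_real)

lemma level_unique: "P \<in> level d \<Longrightarrow> P \<in> level d' \<Longrightarrow> d = d'"
  unfolding level_def[of d] using stiefel_in_level_iff V_set_iff by auto

lemma Q_set_eq_Union_level: "Q_set = (\<Union>d. level d)"
  unfolding Q_set_def level_def by blast

text \<open>Taking norms in \<open>x x'\<^sup>* = - y' y\<^sup>*\<close> (conjugates starred) gives
  \<open>|x|\<^sup>2 |x'|\<^sup>2 = (1 - |x|\<^sup>2) (1 - |x'|\<^sup>2)\<close>, from which everything follows.\<close>

lemma V_set_norms:
  assumes "((x, y), (x', y')) \<in> V_set"
  shows "x \<bullet> x + x' \<bullet> x' = 1" "y \<bullet> y = x' \<bullet> x'" "y' \<bullet> y' = x \<bullet> x" "y \<bullet> y' = - (x \<bullet> x')"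
proof -
  from assms have st: "x \<bullet> x + y \<bullet> y = 1" "x' \<bullet> x' + y' \<bullet> y' = 1" "x \<bullet> x' + y \<bullet> y' = 0"
    and B: "x * qcnj x' = - (y' * qcnj y)"
    by (auto simp: V_set_iff stiefel_iff formB_def add_eq_0_iff2)
  have "norm x * norm x' = norm y' * norm y"
    using arg_cong[OF B, of norm] by (simp add: norm_mult)
  then have "(x \<bullet> x) * (x' \<bullet> x') = (y' \<bullet> y') * (y \<bullet> y)"
    by (metis power2_norm_eq_inner power_mult_distrib)
  also have "\<dots> = (1 - x' \<bullet> x') * (1 - x \<bullet> x)"
    using st by (intro arg_cong2[where f = "(*)"]) linarith+
  finally show "x \<bullet> x + x' \<bullet> x' = 1" by (simp add: algebra_simps)
  with st show "y \<bullet> y = x' \<bullet> x'" "y' \<bullet> y' = x \<bullet> x" "y \<bullet> y' = - (x \<bullet> x')" by auto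
qed

text \<open>By \<open>|x|\<^sup>2 + |x'|\<^sup>2 = 1\<close>, the Gram matrix of \<open>(x, x')\<close> is determined up to rotation by its
  determinant, with the two extreme values belonging to a singular and to a scalar matrix.\<close>

lemma V_set_gram:
  assumes "((x, y), (x', y')) \<in> V_set"
  shows "1 - 4 * gram x x' = (x \<bullet> x - x' \<bullet> x')\<^sup>2 + 4 * (x \<bullet> x')\<^sup>2"
proof -
  have "1 = (x \<bullet> x + x' \<bullet> x')\<^sup>2" using V_set_norms(1)[OF assms] by simp
  then show ?thesis unfolding gram_def by (simp add: power2_eq_square algebra_simps)
qed

lemma V_set_gram_eq_quarter_iff:
  assumes "((x, y), (x', y')) \<in> V_set"
  shows "gram x x' = 1/4 \<longleftrightarrow> x \<bullet> x' = 0 \<and> norm x = norm x'"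
proof -
  have "gram x x' = 1/4 \<longleftrightarrow> (x \<bullet> x - x' \<bullet> x')\<^sup>2 + (2 * (x \<bullet> x'))\<^sup>2 = 0"
    using V_set_gram[OF assms] by (auto simp: power_mult_distrib)
  also have "\<dots> \<longleftrightarrow> x \<bullet> x' = 0 \<and> norm x = norm x'"
    unfolding sum_power2_eq_zero_iff by (auto simp: norm_eq)
  finally show ?thesis .
qed

text \<open>With \<open>(A, B) = ((|x|\<^sup>2 - |x'|\<^sup>2) / 2, \<langle>x, x'\<rangle>)\<close>, rotating the basis by an angle rotates
  \<open>(A, B)\<close> by minus the double angle; half the argument of \<open>A + i B\<close> brings it to the positive
  half-axis.\<close>

lemma exists_diagonalizing_rotation:
  fixes x x' :: "'a::real_inner"
  obtains c s where "c\<^sup>2 + s\<^sup>2 = 1" "(c *\<^sub>R x + s *\<^sub>R x') \<bullet> (- s *\<^sub>R x + c *\<^sub>R x') = 0"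
    "norm (- s *\<^sub>R x + c *\<^sub>R x') \<le> norm (c *\<^sub>R x + s *\<^sub>R x')"
proof -
  define A where "A = (x \<bullet> x - x' \<bullet> x') / 2"
  define B where "B = x \<bullet> x'"
  obtain r t where "Complex A B = rcis r t" "r \<ge> 0"
    using rcis_cmod_Arg[of "Complex A B"] norm_ge_zero by metis
  then have AB: "A = r * cos t" "B = r * sin t"
    by (simp_all add: complex_eq_iff)
  define c s where "c = cos (t/2)" and "s = sin (t/2)"
  have cs: "c\<^sup>2 + s\<^sup>2 = 1" by (simp add: c_def s_def)
  have t: "cos t = c\<^sup>2 - s\<^sup>2" "sin t = 2 * s * c"
    using cos_double[of "t/2"] sin_double[of "t/2"] by (simp_all add: c_def s_def)
  have "(c *\<^sub>R x + s *\<^sub>R x') \<bullet> (- s *\<^sub>R x + c *\<^sub>R x') = B * (c\<^sup>2 - s\<^sup>2) - A * (2 * s * c)"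
    by (simp add: A_def B_def inner_add inner_diff inner_commute[of x' x] field_simps power2_eq_square)
  then have orth: "(c *\<^sub>R x + s *\<^sub>R x') \<bullet> (- s *\<^sub>R x + c *\<^sub>R x') = 0"
    by (simp add: AB t)
  have "(c *\<^sub>R x + s *\<^sub>R x') \<bullet> (c *\<^sub>R x + s *\<^sub>R x')
      - (- s *\<^sub>R x + c *\<^sub>R x') \<bullet> (- s *\<^sub>R x + c *\<^sub>R x') = 2 * (A * (c\<^sup>2 - s\<^sup>2) + B * (2 * s * c))"
    by (simp add: A_def B_def inner_add inner_diff inner_commute[of x' x] field_simps power2_eq_square)
  moreover have "A * cos t + B * sin t = r * ((sin t)\<^sup>2 + (cos t)\<^sup>2)"
    unfolding AB by algebra
  ultimately have "(c *\<^sub>R x + s *\<^sub>R x') \<bullet> (c *\<^sub>R x + s *\<^sub>R x')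
      - (- s *\<^sub>R x + c *\<^sub>R x') \<bullet> (- s *\<^sub>R x + c *\<^sub>R x') = 2 * r"
    by (simp flip: t)
  then have "norm (- s *\<^sub>R x + c *\<^sub>R x') \<le> norm (c *\<^sub>R x + s *\<^sub>R x')"
    using \<open>r \<ge> 0\<close> by (simp add: norm_le)
  then show ?thesis using that cs orth by blast
qed

lemma V_set_rotate:
  assumes "(q, q') \<in> V_set" "c\<^sup>2 + s\<^sup>2 = 1"
  shows "(c *\<^sub>R q + s *\<^sub>R q', - s *\<^sub>R q + c *\<^sub>R q') \<in> V_set"
  using assms stiefel_rotate formB_real_combination[of c c s "- s" _ q q']
  by (auto simp: V_set_iff_real power2_eq_square)

text \<open>A principal basis of \<open>P\<close> diagonalizes the quadratic form \<open>|x|\<^sup>2\<close> on \<open>P\<close>.\<close>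

definition principal :: "oct \<Rightarrow> oct \<Rightarrow> bool" where
  "principal q q' \<longleftrightarrow> (q, q') \<in> V_set \<and> fst q \<bullet> fst q' = 0 \<and> norm (fst q') \<le> norm (fst q)"

lemma exists_principal_basis:
  assumes "(q, q') \<in> V_set"
  obtains c s where "c\<^sup>2 + s\<^sup>2 = 1" "principal (c *\<^sub>R q + s *\<^sub>R q') (- s *\<^sub>R q + c *\<^sub>R q')"
proof -
  obtain c s where "c\<^sup>2 + s\<^sup>2 = 1" "(c *\<^sub>R fst q + s *\<^sub>R fst q') \<bullet> (- s *\<^sub>R fst q + c *\<^sub>R fst q') = 0"
    "norm (- s *\<^sub>R fst q + c *\<^sub>R fst q') \<le> norm (c *\<^sub>R fst q + s *\<^sub>R fst q')"
    by (rule exists_diagonalizing_rotation)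
  then show ?thesis using that V_set_rotate[OF assms, of c s] by (simp add: principal_def)
qed

lemma level_principal_basis:
  assumes "P \<in> level d"
  obtains q q' where "P = oplane q q'" "principal q q'" "gram (fst q) (fst q') = d"
proof -
  obtain q q' where q: "P = oplane q q'" "(q, q') \<in> V_set" "gram (fst q) (fst q') = d"
    using assms unfolding level_def by auto
  obtain c s where cs: "c\<^sup>2 + s\<^sup>2 = 1" "principal (c *\<^sub>R q + s *\<^sub>R q') (- s *\<^sub>R q + c *\<^sub>R q')"
    using exists_principal_basis[OF q(2)] .
  have "gram (fst (c *\<^sub>R q + s *\<^sub>R q')) (fst (- s *\<^sub>R q + c *\<^sub>R q')) = d"
    using gram_combination[of c "fst q" s "fst q'" "- s" c] cs(1) q(3) by (simp add: power2_eq_square)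
  then show ?thesis using that cs q(1) oplane_rotate[OF cs(1), of q q'] by metis
qed

text \<open>The two eigenvalues \<open>|x|\<^sup>2 \<ge> |x'|\<^sup>2\<close> have sum \<open>1\<close> and product \<open>d\<close>.\<close>

lemma principal_norms:
  assumes "principal q q'" "gram (fst q) (fst q') = d"
  shows "d \<le> 1/4" "(norm (fst q))\<^sup>2 = (1 + sqrt (1 - 4 * d)) / 2"
    "(norm (fst q'))\<^sup>2 = (1 - sqrt (1 - 4 * d)) / 2"
proof -
  obtain x y x' y' where q: "q = (x, y)" "q' = (x', y')" by (cases q; cases q')
  have V: "((x, y), (x', y')) \<in> V_set" and "x \<bullet> x' = 0" "norm x' \<le> norm x"
    using assms by (auto simp: principal_def q)
  have *: "1 - 4 * d = (x \<bullet> x - x' \<bullet> x')\<^sup>2"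
    using V_set_gram[OF V] \<open>x \<bullet> x' = 0\<close> assms(2) by (simp add: q)
  then show "d \<le> 1/4" using zero_le_power2[of "x \<bullet> x - x' \<bullet> x'"] by linarith
  have "sqrt (1 - 4 * d) = x \<bullet> x - x' \<bullet> x'"
    unfolding * using \<open>norm x' \<le> norm x\<close> by (simp add: norm_le)
  then show "(norm (fst q))\<^sup>2 = (1 + sqrt (1 - 4 * d)) / 2"
    "(norm (fst q'))\<^sup>2 = (1 - sqrt (1 - 4 * d)) / 2"
    using V_set_norms(1)[OF V] by (simp_all add: q power2_norm_eq_inner field_simps)
qed


section \<open>The group of the maps \<open>Diag(R\<^sub>a L\<^sub>c, R\<^sub>b L\<^sub>c)\<close>\<close>

definition diagm :: "quat \<Rightarrow> quat \<Rightarrow> quat \<Rightarrow> oct \<Rightarrow> oct" where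
  "diagm a b c q = (c * fst q * a, c * snd q * b)"

definition K_set :: "(oct \<Rightarrow> oct) set" where
  "K_set = {diagm a b c |a b c. norm a = 1 \<and> norm b = 1 \<and> norm c = 1}"

lemma linear_diagm: "linear (diagm a b c)"
  by (rule linearI) (simp_all add: diagm_def algebra_simps)

lemma diagm_inner:
  assumes "norm a = 1" "norm b = 1" "norm c = 1"
  shows "diagm a b c p \<bullet> diagm a b c q = p \<bullet> q"
  using assms by (simp add: diagm_def inner_prod_def inner_quat_mult norm_eq_1)

lemma diagm_formB:
  assumes "norm a = 1" "norm b = 1"
  shows "formB (diagm a b c p) (diagm a b c q) = c * formB p q * qcnj c"
proof -
  have "a * qcnj a = 1" "b * qcnj b = 1"
    using assms by (simp_all add: mult_qcnj norm_eq_1)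
  then have "c * u * a * (qcnj a * (qcnj v * qcnj c)) = c * (u * qcnj v) * qcnj c"
    "c * u * b * (qcnj b * (qcnj v * qcnj c)) = c * (u * qcnj v) * qcnj c" for u v
    by (metis mult.assoc mult_1)+
  then show ?thesis by (simp add: formB_def diagm_def distrib_left distrib_right)
qed

text \<open>Once \<open>x\<close> is sent to \<open>z\<close> by choosing \<open>a\<close>, the vector \<open>x' = (x' x\<^sup>-\<^sup>1) x\<close> goes to \<open>z'\<close> iff \<open>c\<close>
  conjugates \<open>x' x\<^sup>-\<^sup>1\<close> into \<open>z' z\<^sup>-\<^sup>1\<close>; the Gram matrix fixes the real part and the norm of these
  quotients. Then \<open>b\<close> is determined by \<open>y'\<close>, and \<open>y\<close> follows from \<open>B = 0\<close>.\<close>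

lemma K_set_transitive:
  assumes V: "(q, q') \<in> V_set" "(p, p') \<in> V_set"
    and eq: "fst q \<bullet> fst q' = fst p \<bullet> fst p'" "norm (fst q) = norm (fst p)"
      "norm (fst q') = norm (fst p')" and nz: "fst q \<noteq> 0"
  obtains g where "g \<in> K_set" "g q = p" "g q' = p'"
proof -
  obtain x y x' y' z w z' w' where q: "q = (x, y)" "q' = (x', y')" "p = (z, w)" "p' = (z', w')"
    by (cases q; cases q'; cases p; cases p')
  have e: "x \<bullet> x' = z \<bullet> z'" "norm x = norm z" "norm x' = norm z'" "x \<noteq> 0" "z \<noteq> 0"
    using eq nz by (auto simp: q)
  have re: "qRe (u' * inverse u) = (u \<bullet> u') / (norm u)\<^sup>2" for u u' :: quat
    by (simp add: inverse_quat_def inner_quat_def norm_quat_def divide_inverse algebra_simps)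
  obtain c where c: "norm c = 1" "c * (x' * inverse x) = (z' * inverse z) * c"
    by (rule quat_conjugate[of "x' * inverse x" "z' * inverse z"])
      (auto simp: re e norm_mult norm_inverse simp del: quat_sel_times)
  then have "c \<noteq> 0" by auto
  have "y' \<bullet> y' = x \<bullet> x" "w' \<bullet> w' = z \<bullet> z"
    using V_set_norms(3) V unfolding q by blast+
  then have n: "norm y' = norm w'" "norm w' \<noteq> 0"
    using e by (auto simp: norm_eq_sqrt_inner)
  define a b where "a = inverse (c * x) * z" and "b = inverse (c * y') * w'"
  have ab: "norm a = 1" "norm b = 1"
    using c(1) e n by (simp_all add: a_def b_def norm_mult norm_inverse)
  have cxa: "c * x * a = z"
    using e \<open>c \<noteq> 0\<close> by (simp add: a_def mult.assoc[symmetric])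
  have "c * x' * a = c * (x' * inverse x) * (x * a)"
    using e by (simp add: mult.assoc[of _ "inverse x"] mult.assoc[symmetric] flip: mult.assoc[of "inverse x" x a])
  also have "\<dots> = z' * inverse z * (c * x * a)" by (simp only: c(2) mult.assoc)
  also have "\<dots> = z'" unfolding cxa using e by (simp add: mult.assoc)
  finally have cxa': "c * x' * a = z'" .
  have "y' \<noteq> 0" using n by auto
  then have cyb': "c * y' * b = w'"
    using \<open>c \<noteq> 0\<close> by (simp add: b_def mult.assoc[symmetric])
  have "formB (diagm a b c q) (diagm a b c q') = 0"
    using V(1) by (simp add: diagm_formB ab V_set_iff)
  then have "w' * qcnj (c * y * b) = w' * qcnj w"
    using V(2) by (auto simp add: q diagm_def formB_def cxa cxa' cyb' V_set_iff add_eq_0_iff2 del: qcnj_simps)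
  then have "qcnj (c * y * b) = qcnj w" using n by auto
  then have "c * y * b = w" by (metis qcnj_simps(2))
  then have "diagm a b c q = p" "diagm a b c q' = p'"
    by (simp_all add: q diagm_def cxa cxa' cyb')
  then show ?thesis using that ab c(1) unfolding K_set_def by blast
qed

lemma principal_fst_nonzero: "principal q q' \<Longrightarrow> fst q \<noteq> 0"
  using V_set_norms(1)[of "fst q" "snd q" "fst q'" "snd q'"] by (auto simp: principal_def)

lemma K_set_transitive_principal:
  assumes "principal q q'" "principal p p'" "gram (fst q) (fst q') = gram (fst p) (fst p')"
  obtains g where "g \<in> K_set" "g q = p" "g q' = p'"
proof (rule K_set_transitive)
  show "norm (fst q) = norm (fst p)" "norm (fst q') = norm (fst p')"
    using principal_norms[OF assms(1) assms(3)] principal_norms[OF assms(2) refl]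
    by (metis norm_ge_zero power2_eq_imp_eq)+
qed (use assms principal_fst_nonzero in \<open>auto simp: principal_def\<close>)

lemma act_oplane:
  assumes "linear g" "\<And>p q. g p \<bullet> g q = p \<bullet> q"
  shows "act g (oplane a b) = oplane (g a) (g b)"
proof
  have comb: "g (\<alpha> *\<^sub>R a + \<beta> *\<^sub>R b) = \<alpha> *\<^sub>R g a + \<beta> *\<^sub>R g b" for \<alpha> \<beta>
    using assms(1) by (simp add: linear_add linear_cmul)
  have st: "(g p, g p') \<in> stiefel \<longleftrightarrow> (p, p') \<in> stiefel" for p p'
    by (simp add: stiefel_iff assms(2))
  show "act g (oplane a b) \<subseteq> oplane (g a) (g b)"
  proof (clarsimp simp: act_def)
    fix p p' assume "(p, p') \<in> oplane a b"
    then show "(g p, g p') \<in> oplane (g a) (g b)"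
    proof (rule in_oplaneD)
      fix \<alpha> \<beta> \<gamma> \<delta>
      assume "(p, p') \<in> stiefel" "p = \<alpha> *\<^sub>R a + \<beta> *\<^sub>R b" "p' = \<gamma> *\<^sub>R a + \<delta> *\<^sub>R b" "\<alpha> * \<delta> - \<beta> * \<gamma> > 0"
      then show ?thesis
        using st[of p p'] comb by (intro in_oplaneI[of "g p" "g p'" \<alpha> _ \<beta> _ \<gamma> \<delta>]) simp_all
    qed
  qed
  show "oplane (g a) (g b) \<subseteq> act g (oplane a b)"
  proof clarify
    fix r r' assume "(r, r') \<in> oplane (g a) (g b)"
    then obtain \<alpha> \<beta> \<gamma> \<delta> where r: "(r, r') \<in> stiefel" "r = g (\<alpha> *\<^sub>R a + \<beta> *\<^sub>R b)"
      "r' = g (\<gamma> *\<^sub>R a + \<delta> *\<^sub>R b)" "\<alpha> * \<delta> - \<beta> * \<gamma> > 0"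
      by (rule in_oplaneD) (simp add: comb)
    then have "(\<alpha> *\<^sub>R a + \<beta> *\<^sub>R b, \<gamma> *\<^sub>R a + \<delta> *\<^sub>R b) \<in> oplane a b"
      using st by (intro in_oplaneI) auto
    then show "(r, r') \<in> act g (oplane a b)"
      unfolding act_def using r(2,3) by (metis image_eqI map_prod_simp)
  qed
qed


section \<open>The groups \<open>G\<close> and \<open>G\<^sup>0\<close>\<close>

lemma DIM_quat: "DIM(quat) = 4"
proof -
  have "1 \<noteq> qi" "1 \<noteq> qj" "1 \<noteq> qk" "qi \<noteq> qj" "qi \<noteq> qk" "qj \<noteq> qk"
    by (simp_all add: quat_eq_iff)
  then show ?thesis by (simp add: Basis_quat_def)
qed

lemma inner_oct_to_vec: "oct_to_vec p \<bullet> oct_to_vec q = p \<bullet> q"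
proof -
  have "(\<Sum>k\<in>UNIV. f k) = (\<Sum>m\<in>UNIV. f (Inl m)) + (\<Sum>m\<in>UNIV. f (Inr m))"
    for f :: "4 + 4 \<Rightarrow> real"
    by (simp add: UNIV_Plus_UNIV[symmetric] sum.Plus del: UNIV_Plus_UNIV)
  then show ?thesis
    by (simp add: inner_vec_def oct_to_vec_def sum_4 vector_def inner_prod_def inner_quat_def)
qed

lemma linear_oct_to_vec: "linear oct_to_vec"
  by (rule linearI)
    (auto simp: oct_to_vec_def vec_eq_iff vector_def forall_4 split: sum.split)

lemma linear_vec_to_oct: "linear vec_to_oct"
  by (rule linearI) (simp_all add: vec_to_oct_def quat_eq_iff)

abbreviation oct_matrix :: "(oct \<Rightarrow> oct) \<Rightarrow> real ^ (4 + 4) ^ (4 + 4)" where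
  "oct_matrix g \<equiv> matrix (oct_to_vec \<circ> g \<circ> vec_to_oct)"

lemma orthogonal_oct_matrix_iff:
  assumes "linear g"
  shows "orthogonal_matrix (oct_matrix g) \<longleftrightarrow> (\<forall>p q. g p \<bullet> g q = p \<bullet> q)"
proof -
  let ?f = "oct_to_vec \<circ> g \<circ> vec_to_oct"
  have "linear ?f"
    by (intro linear_compose assms linear_oct_to_vec linear_vec_to_oct)
  then have "orthogonal_matrix (oct_matrix g) \<longleftrightarrow> (\<forall>v w. ?f v \<bullet> ?f w = v \<bullet> w)"
    using orthogonal_transformation_matrix[of ?f] unfolding orthogonal_transformation_def by blast
  also have "\<dots> \<longleftrightarrow> (\<forall>p q. g p \<bullet> g q = p \<bullet> q)"
  proof (intro iffI allI)
    show "g p \<bullet> g q = p \<bullet> q" if "\<forall>v w. ?f v \<bullet> ?f w = v \<bullet> w" for p q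
      using that[rule_format, of "oct_to_vec p" "oct_to_vec q"] by (simp add: inner_oct_to_vec)
    show "?f v \<bullet> ?f w = v \<bullet> w" if "\<forall>p q. g p \<bullet> g q = p \<bullet> q" for v w
      using that[rule_format, of "vec_to_oct v" "vec_to_oct w"]
        inner_oct_to_vec[of "vec_to_oct v" "vec_to_oct w"] by (simp add: inner_oct_to_vec)
  qed
  finally show ?thesis .
qed

lemma SO8_iff: "g \<in> SO8 \<longleftrightarrow> linear g \<and> (\<forall>p q. g p \<bullet> g q = p \<bullet> q) \<and> det (oct_matrix g) = 1"
  unfolding SO8_def rotation_matrix_def using orthogonal_oct_matrix_iff by auto

lemma G_set_D:
  assumes "g \<in> G_set"
  shows "linear g" "g p \<bullet> g q = p \<bullet> q" "formB (g p) (g q) = 0 \<longleftrightarrow> formB p q = 0" "surj g"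
proof -
  show g: "linear g" "g p \<bullet> g q = p \<bullet> q" "formB (g p) (g q) = 0 \<longleftrightarrow> formB p q = 0" for p q
    using assms unfolding G_set_def SO8_iff by blast+
  have "inj g"
    by (rule linear_injective_0[OF g(1), THEN iffD2]) (metis g(2) inner_eq_zero_iff inner_zero_left)
  then show "surj g" using linear_injective_imp_surjective[OF g(1)] by simp
qed

text \<open>Write \<open>q\<^sup>\<top>\<close> for \<open>{p. B(q, p) = 0}\<close>, a notion that only involves the relation \<open>B = 0\<close>. The right-hand
  side says that every \<open>q'\<close> orthogonal to \<open>q\<^sup>\<top>\<close> satisfies \<open>q\<^sup>\<top> \<subseteq> q'\<^sup>\<top>\<close>. For \<open>q = (x, 0)\<close> this holds
  because \<open>q\<^sup>\<top>\<close> is the other axis. For \<open>q = (x, y)\<close> with \<open>x\<close> and \<open>y\<close> nonzero it fails: with \<open>e\<^sup>*\<close>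
  the conjugate of \<open>e\<close>, the vectors orthogonal to \<open>q\<^sup>\<top>\<close> are the \<open>q' = (e x, e\<^sup>* y)\<close>, and on \<open>q\<^sup>\<top>\<close> the
  value \<open>B(q', p) = e h - h e\<close> with \<open>h = x p\<^sub>1\<^sup>*\<close> is a commutator. So \<open>B = 0\<close> determines the two axes.\<close>

lemma on_axis_iff:
  "fst q = 0 \<or> snd q = 0 \<longleftrightarrow>
    (\<forall>q'. (\<forall>p. formB q p = 0 \<longrightarrow> q' \<bullet> p = 0) \<longrightarrow> (\<forall>p. formB q p = 0 \<longrightarrow> formB q' p = 0))"
    (is "?axis \<longleftrightarrow> ?closed")
proof
  show ?closed if axis: ?axis
  proof (intro allI impI)
    fix q' p
    assume orth: "\<forall>p. formB q p = 0 \<longrightarrow> q' \<bullet> p = 0" and p: "formB q p = 0"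
    consider "q = 0" | "fst q \<noteq> 0" "snd q = 0" | "fst q = 0" "snd q \<noteq> 0"
      using axis by (metis prod.collapse zero_prod_def)
    then show "formB q' p = 0"
    proof cases
      case 1
      then have "q' \<bullet> q' = 0" using orth[rule_format, of q'] by (simp add: formB_def)
      then show ?thesis by (simp add: formB_def)
    next
      case 2
      have "snd q' = 0" using orth[rule_format, of "(0, snd q')"] 2
        by (simp add: formB_def inner_prod_def)
      then show ?thesis using 2 p by (simp add: formB_def)
    next
      case 3
      have "fst q' = 0" using orth[rule_format, of "(fst q', 0)"] 3
        by (simp add: formB_def inner_prod_def)
      then show ?thesis using 3 p by (simp add: formB_def)
    qed
  qed
  show ?axis if closed: ?closed
  proof (rule ccontr)
    assume "\<not> ?axis"
    then have nz: "fst q \<noteq> 0" "snd q \<noteq> 0" by auto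
    define q' where "q' = (qi * fst q, - (qi * snd q))"
    have B': "formB q' p = qi * (fst q * qcnj (fst p)) + (snd p * qcnj (snd q)) * qi" for p
    proof -
      have "qcnj qi = - qi" by (simp add: quat_eq_iff)
      then show ?thesis by (simp add: q'_def formB_def mult.assoc)
    qed
    have "q' \<bullet> p = 0" if "formB q p = 0" for p
    proof -
      have "snd p * qcnj (snd q) = - (fst q * qcnj (fst p))"
        using that by (simp add: formB_def add_eq_0_iff)
      then have "formB q' p = qi * (fst q * qcnj (fst p)) - (fst q * qcnj (fst p)) * qi"
        unfolding B' by simp
      then have "qRe (formB q' p) = 0" by simp
      then show ?thesis by (simp add: qRe_formB)
    qed
    \<comment> \<open>chosen in such a way that \<open>h = j\<close>, which does not commute with \<open>i\<close>\<close>
    moreover define p where "p = (qcnj (inverse (fst q) * qj), - qj * inverse (qcnj (snd q)))"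
    moreover have p: "fst q * qcnj (fst p) = qj" "snd p * qcnj (snd q) = - qj"
      using nz by (simp_all add: p_def mult.assoc del: qcnj_simps(5))
        (simp_all flip: mult.assoc)
    then have "formB q p = 0" by (simp add: formB_def)
    ultimately have "formB q' p = 0" using closed by blast
    then show False unfolding B' p by (simp add: quat_eq_iff)
  qed
qed

lemma G_set_on_axis:
  assumes g: "g \<in> G_set" and "fst q = 0 \<or> snd q = 0"
  shows "fst (g q) = 0 \<or> snd (g q) = 0"
  unfolding on_axis_iff
proof (intro allI impI)
  fix q' p
  assume orth: "\<forall>p. formB (g q) p = 0 \<longrightarrow> q' \<bullet> p = 0" and p: "formB (g q) p = 0"
  obtain r' r where r: "q' = g r'" "p = g r" using G_set_D(4)[OF g] by (metis surjD)
  have "\<forall>p. formB q p = 0 \<longrightarrow> r' \<bullet> p = 0" "formB q r = 0"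
    using orth p G_set_D(2,3)[OF g] unfolding r by metis+
  then have "formB r' r = 0" using assms(2) unfolding on_axis_iff by blast
  then show "formB q' p = 0" unfolding r using G_set_D(3)[OF g] by blast
qed

definition preserves_axes :: "(oct \<Rightarrow> oct) \<Rightarrow> bool" where
  "preserves_axes g \<longleftrightarrow> (\<forall>x. snd (g (x, 0)) = 0) \<and> (\<forall>y. fst (g (0, y)) = 0)"

definition swaps_axes :: "(oct \<Rightarrow> oct) \<Rightarrow> bool" where
  "swaps_axes g \<longleftrightarrow> (\<forall>x. fst (g (x, 0)) = 0) \<and> (\<forall>y. snd (g (0, y)) = 0)"

lemma linear_split: "linear g \<Longrightarrow> g (x, y) = g (x, 0) + g (0, y)" for g :: "oct \<Rightarrow> oct"
  using linear_add[of g "(x, 0)" "(0, y)"] by simp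

text \<open>Each axis is mapped into the union of the two, hence into one of them, being a linear space;
  the images of the two axes differ because \<open>g\<close> is onto.\<close>

lemma G_set_axes:
  assumes g: "g \<in> G_set"
  shows "preserves_axes g \<or> swaps_axes g"
proof -
  note lin = G_set_D(1)[OF g]
  have one: "(\<forall>x. fst (g (h x)) = 0) \<or> (\<forall>x. snd (g (h x)) = 0)"
    if h: "\<And>x. fst (h x) = 0 \<or> snd (h x) = 0" "\<And>x y. h (x + y) = h x + h y" for h :: "quat \<Rightarrow> oct"
  proof (rule ccontr)
    assume "\<not> ?thesis"
    then obtain x y where xy: "fst (g (h x)) \<noteq> 0" "snd (g (h y)) \<noteq> 0" by auto
    then have "snd (g (h x)) = 0" "fst (g (h y)) = 0"
      using G_set_on_axis[OF g h(1)] by blast+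
    then have "fst (g (h (x + y))) \<noteq> 0" "snd (g (h (x + y))) \<noteq> 0"
      using xy by (simp_all add: h(2) linear_add[OF lin])
    then show False using G_set_on_axis[OF g h(1)] by blast
  qed
  have split: "fst (g p) = fst (g (fst p, 0)) + fst (g (0, snd p))"
    "snd (g p) = snd (g (fst p, 0)) + snd (g (0, snd p))" for p
    using linear_split[OF lin, of "fst p" "snd p"] by simp_all
  have "\<not> (\<forall>p. fst (g p) = 0)" "\<not> (\<forall>p. snd (g p) = 0)"
    using surjD[OF G_set_D(4)[OF g], of "(1, 1)"] by (metis fst_conv snd_conv zero_neq_one)+
  then have "\<not> ((\<forall>x. fst (g (x, 0)) = 0) \<and> (\<forall>y. fst (g (0, y)) = 0))"
    "\<not> ((\<forall>x. snd (g (x, 0)) = 0) \<and> (\<forall>y. snd (g (0, y)) = 0))"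
    using split by (metis add.right_neutral)+
  then show ?thesis
    using one[of "\<lambda>x. (x, 0)"] one[of "\<lambda>y. (0, y)"]
    unfolding preserves_axes_def swaps_axes_def by auto
qed

lemma preserves_axes_inner:
  assumes "g \<in> G_set" "preserves_axes g"
  shows "fst (g p) \<bullet> fst (g q) = fst p \<bullet> fst q"
proof -
  have "fst (g r) = fst (g (fst r, 0))" "snd (g (fst r, 0)) = 0" for r
    using linear_split[OF G_set_D(1)[OF assms(1)], of "fst r" "snd r"] assms(2)
    by (simp_all add: preserves_axes_def)
  then have "fst (g p) \<bullet> fst (g q) = g (fst p, 0) \<bullet> g (fst q, 0)"
    by (simp add: inner_prod_def)
  then show ?thesis by (simp add: G_set_D(2)[OF assms(1)])
qed

lemma swaps_axes_inner:
  assumes "g \<in> G_set" "swaps_axes g"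
  shows "fst (g p) \<bullet> fst (g q) = snd p \<bullet> snd q"
proof -
  have "fst (g r) = fst (g (0, snd r))" "snd (g (0, snd r)) = 0" for r
    using linear_split[OF G_set_D(1)[OF assms(1)], of "fst r" "snd r"] assms(2)
    by (simp_all add: swaps_axes_def)
  then have "fst (g p) \<bullet> fst (g q) = g (0, snd p) \<bullet> g (0, snd q)"
    by (simp add: inner_prod_def)
  then show ?thesis by (simp add: G_set_D(2)[OF assms(1)])
qed

lemma G_set_V_set:
  assumes "g \<in> G_set" "(q, q') \<in> V_set"
  shows "(g q, g q') \<in> V_set"
  using assms G_set_D[OF assms(1)] by (auto simp: V_set_iff stiefel_iff)

text \<open>On \<open>V\<close> the Gram matrices of \<open>(x, x')\<close> and \<open>(y, y')\<close> have the same determinant.\<close>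

lemma G_set_gram:
  assumes g: "g \<in> G_set" and V: "(q, q') \<in> V_set"
  shows "gram (fst (g q)) (fst (g q')) = gram (fst q) (fst q')"
  using G_set_axes[OF g]
proof
  assume "preserves_axes g"
  then show ?thesis by (simp add: gram_def preserves_axes_inner[OF g])
next
  assume "swaps_axes g"
  then have "gram (fst (g q)) (fst (g q')) = gram (snd q) (snd q')"
    by (simp add: gram_def swaps_axes_inner[OF g])
  also have "\<dots> = gram (fst q) (fst q')"
    using V_set_norms[of "fst q" "snd q" "fst q'" "snd q'"] V by (simp add: gram_def mult.commute)
  finally show ?thesis .
qed

lemma act_G_set: "g \<in> G_set \<Longrightarrow> act g (oplane a b) = oplane (g a) (g b)"
  using act_oplane G_set_D(1,2) by blast

lemma act_G_set_level:
  assumes "g \<in> G_set" "P \<in> level d"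
  shows "act g P \<in> level d"
proof -
  obtain q q' where q: "P = oplane q q'" "(q, q') \<in> V_set" "gram (fst q) (fst q') = d"
    using assms(2) unfolding level_def by auto
  then have "(g q, g q') \<in> V_set \<and> gram (fst (g q)) (fst (g q')) = d"
    using G_set_V_set[OF assms(1)] G_set_gram[OF assms(1)] by simp
  then show ?thesis
    unfolding q(1) act_G_set[OF assms(1)] level_def by blast
qed

lemma diagm_one: "diagm 1 1 1 = id"
  by (auto simp: diagm_def fun_eq_iff)

lemma id_in_K_set: "id \<in> K_set"
  unfolding K_set_def diagm_one[symmetric] by (force simp del: id_apply)

text \<open>Both \<open>K \<subseteq> SO(8)\<close> and \<open>K \<subseteq> G\<^sup>0\<close> come from the connectedness of the three-sphere: the
  determinant is \<open>\<plusminus>1\<close> and varies continuously.\<close>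

lemma connected_K_parameters:
  "connected (sphere (0::quat) 1 \<times> sphere (0::quat) 1 \<times> sphere (0::quat) 1)"
  by (intro connected_Times connected_sphere) (simp_all add: DIM_quat)

lemma K_set_subset_G_set: "K_set \<subseteq> G_set"
proof -
  define S where "S = sphere (0::quat) 1 \<times> sphere (0::quat) 1 \<times> sphere (0::quat) 1"
  define h where "h = (\<lambda>(a, b, c). det (oct_matrix (diagm a b c)))"
  have orth: "diagm a b c p \<bullet> diagm a b c q = p \<bullet> q" if "(a, b, c) \<in> S" for a b c p q
    using that diagm_inner by (auto simp: S_def)
  have "continuous_on S h"
  proof -
    have "continuous_on S (\<lambda>t. diagm (fst t) (fst (snd t)) (snd (snd t)) v)" for v
      unfolding diagm_def by (intro continuous_intros)
    then have "continuous_on S (\<lambda>t. oct_to_vec (diagm (fst t) (fst (snd t)) (snd (snd t)) v) $ i)" for v i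
      using linear_continuous_on_compose[OF _ linear_oct_to_vec] continuous_on_component by blast
    then have "continuous_on S (\<lambda>t. oct_matrix (diagm (fst t) (fst (snd t)) (snd (snd t))) $ i $ j)" for i j
      by (simp only: matrix_def vec_lambda_beta comp_def)
    then show ?thesis
      unfolding h_def det_def case_prod_beta
      by (intro continuous_on_sum continuous_on_mult continuous_on_prod continuous_on_const)
  qed
  moreover have "h ` S \<subseteq> {1, -1}"
  proof (rule image_subsetI)
    fix t assume "t \<in> S"
    then have "orthogonal_matrix (oct_matrix (diagm (fst t) (fst (snd t)) (snd (snd t))))"
      using orth orthogonal_oct_matrix_iff[OF linear_diagm] by (metis prod.collapse)
    then show "h t \<in> {1, -1}"
      unfolding h_def case_prod_beta using det_orthogonal_matrix by blast
  qed
  then have "finite (h ` S)" by (rule finite_subset) simp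
  ultimately have "h constant_on S"
    using connected_K_parameters continuous_finite_range_constant unfolding S_def by blast
  moreover have "(1, 1, 1) \<in> S" by (simp add: S_def)
  moreover have "h (1, 1, 1) = 1"
  proof -
    have "oct_to_vec \<circ> id \<circ> vec_to_oct = id" by auto
    then show ?thesis by (simp add: h_def diagm_one matrix_id)
  qed
  ultimately have h1: "h t = 1" if "t \<in> S" for t
    using that unfolding constant_on_def by metis
  have "diagm a b c \<in> G_set" if "norm a = 1" "norm b = 1" "norm c = 1" for a b c
  proof -
    have t: "(a, b, c) \<in> S" using that by (simp add: S_def)
    have "c \<noteq> 0" using that by auto
    then have "formB p q = 0 \<longleftrightarrow> formB (diagm a b c p) (diagm a b c q) = 0" for p q
      by (simp add: diagm_formB that)
    moreover have "diagm a b c \<in> SO8"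
      using h1[OF t] orth[OF t] linear_diagm by (simp add: SO8_iff h_def)
    ultimately show ?thesis by (simp add: G_set_def)
  qed
  then show ?thesis by (auto simp: K_set_def)
qed

lemma K_set_subset_G0_set: "K_set \<subseteq> G0_set"
  unfolding G0_set_def
proof (rule connected_component_maximal[OF _ _ K_set_subset_G_set])
  show "id \<in> K_set" by (rule id_in_K_set)
  let ?S = "sphere (0::quat) 1 \<times> sphere (0::quat) 1 \<times> sphere (0::quat) 1"
  let ?f = "\<lambda>t. diagm (fst t) (fst (snd t)) (snd (snd t))"
  have "continuous_on ?S ?f"
    unfolding diagm_def by (intro continuous_on_coordinatewise_then_product continuous_intros)
  then have "connected (?f ` ?S)"
    using connected_K_parameters by (rule connected_continuous_image)
  moreover have "?f ` ?S = K_set" by (force simp: K_set_def image_iff)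
  ultimately show "connected K_set" by simp
qed

lemma G0_set_subset_G_set: "G0_set \<subseteq> G_set"
  unfolding G0_set_def by (rule connected_component_subset)

text \<open>The number \<open>|snd (g (1, 0))|\<close> depends continuously on \<open>g \<in> G\<close> and is \<open>0\<close> or \<open>1\<close> according to
  whether \<open>g\<close> preserves or swaps the axes, so it stays \<open>0\<close> on the component of the identity.\<close>

lemma G0_set_preserves_axes:
  assumes "g \<in> G0_set"
  shows "preserves_axes g"
proof -
  define h where "h g = norm (snd (g (1, 0)))" for g :: "oct \<Rightarrow> oct"
  have "continuous_on G0_set h"
    unfolding h_def
    by (intro continuous_intros continuous_on_subset[OF continuous_on_product_coordinates]) simp
  moreover have swap: "h g = 1" if "g \<in> G_set" "swaps_axes g" for g
  proof -
    have "g (1, 0) \<bullet> g (1, 0) = 1" "fst (g (1, 0)) = 0"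
      using that G_set_D(2)[OF that(1)] by (auto simp: swaps_axes_def inner_quat_def)
    then show ?thesis by (simp add: h_def inner_prod_def norm_eq_1)
  qed
  have "h ` G0_set \<subseteq> {0, 1}"
  proof (rule image_subsetI)
    fix g assume "g \<in> G0_set"
    then have "preserves_axes g \<or> h g = 1" using G_set_axes swap G0_set_subset_G_set by blast
    then show "h g \<in> {0, 1}" by (auto simp: h_def preserves_axes_def)
  qed
  then have "finite (h ` G0_set)" by (rule finite_subset) simp
  ultimately have "h constant_on G0_set"
    unfolding G0_set_def
    by (intro continuous_finite_range_constant connected_connected_component) auto
  moreover have "id \<in> G0_set"
    using id_in_K_set K_set_subset_G0_set by blast
  moreover have "h id = 0" by (simp add: h_def)
  ultimately have "h g = 0" using assms unfolding constant_on_def by metis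
  then show ?thesis using swap G_set_axes assms G0_set_subset_G_set by fastforce
qed


section \<open>Orbits and stabilizers\<close>

text \<open>The Gram determinant is invariant under \<open>G\<close>, and the principal bases of two planes with equal
  determinant are related by an element of \<open>K\<close>.\<close>

lemma orbit_eq_level:
  assumes "K_set \<subseteq> H" "H \<subseteq> G_set" "P \<in> level d"
  shows "orbit H P = level d"
proof
  show "orbit H P \<subseteq> level d"
    using assms act_G_set_level by (auto simp: orbit_def)
  show "level d \<subseteq> orbit H P"
  proof
    fix R assume "R \<in> level d"
    then obtain r r' where r: "R = oplane r r'" "principal r r'" "gram (fst r) (fst r') = d"
      by (rule level_principal_basis)
    obtain q q' where q: "P = oplane q q'" "principal q q'" "gram (fst q) (fst q') = d"
      using assms(3) by (rule level_principal_basis)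
    obtain g where g: "g \<in> K_set" "g q = r" "g q' = r'"
      using K_set_transitive_principal[OF q(2) r(2)] q(3) r(3) by metis
    then have "g \<in> G_set" using K_set_subset_G_set by blast
    then have "act g P = R" using g by (simp add: q(1) r(1) act_G_set)
    then show "R \<in> orbit H P" using g(1) assms(1) by (auto simp: orbit_def)
  qed
qed

lemma plane_oplane:
  assumes "(q, q') \<in> stiefel"
  shows "plane (oplane q q') = span {q, q'}"
proof -
  have "fst ` oplane q q' \<subseteq> span {q, q'}"
    by (force elim!: in_oplaneD intro: span_add span_scale span_base)
  moreover have "(q', - q) \<in> oplane q q'"
    using stiefel_rotate[OF assms, of 0 1] by (intro in_oplaneI[of _ _ 0 _ 1 _ "-1" 0]) auto
  then have "{q, q'} \<subseteq> fst ` oplane q q'"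
    using in_oplane_self[OF assms] by force
  ultimately show ?thesis
    unfolding plane_def by (metis span_mono span_span subset_antisym)
qed

lemma restrict_plane_eqI:
  assumes "(q, q') \<in> stiefel" "linear f" "linear g" "f q = g q" "f q' = g q'"
  shows "restrict f (plane (oplane q q')) = restrict g (plane (oplane q q'))"
  using linear_eq_on[OF assms(2,3), of _ "{q, q'}"] assms(4,5)
  by (auto simp: plane_oplane[OF assms(1)] restrict_def fun_eq_iff)

lemma pm_id_subset_stabilizer:
  assumes "K_set \<subseteq> H"
  shows "pm_id (oplane q q') \<subseteq> restr_to_plane (Stab H (oplane q q')) (oplane q q')"
proof -
  have 1: "diagm 1 1 1 \<in> K_set" "diagm 1 1 (- 1) \<in> K_set" by (force simp: K_set_def)+
  have m: "diagm 1 1 (- 1) = uminus" by (auto simp: diagm_def fun_eq_iff)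
  have "act id (oplane q q') = oplane q q'" by (simp add: act_def prod.map_id0)
  moreover have "act uminus (oplane q q') = oplane q q'"
    using act_G_set[of uminus q q'] oplane_rotate[of "-1" 0 q q'] 1 m K_set_subset_G_set by force
  ultimately have "id \<in> Stab H (oplane q q')" "uminus \<in> Stab H (oplane q q')"
    using 1 m assms diagm_one by (auto simp: Stab_def)
  then show ?thesis by (auto simp: pm_id_def restr_to_plane_def)
qed

text \<open>An element of \<open>G\<^sup>0\<close> preserving \<open>P\<close> rotates the basis \<open>(q, q')\<close>, hence \<open>(x, x')\<close> by the
  same angle, and it preserves the Gram matrix of \<open>(x, x')\<close>. Unless that matrix is scalar,
  the angle is a multiple of \<open>\<pi>\<close>.\<close>

lemma stabilizer_eq_pm_id:
  assumes "P \<in> level d" "d \<noteq> 1/4"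
  shows "restr_to_plane (Stab G0_set P) P = pm_id P"
proof
  obtain q q' where q: "P = oplane q q'" "principal q q'" "gram (fst q) (fst q') = d"
    using assms(1) by (rule level_principal_basis)
  then have V: "(q, q') \<in> V_set" and st: "(q, q') \<in> stiefel" and orth: "fst q \<bullet> fst q' = 0"
    by (auto simp: principal_def V_set_iff)
  have ne: "norm (fst q) \<noteq> norm (fst q')"
    using V_set_gram_eq_quarter_iff[of "fst q" "snd q" "fst q'" "snd q'"] V q(3) assms(2) orth by simp
  show "restr_to_plane (Stab G0_set P) P \<subseteq> pm_id P"
  proof
    fix f assume "f \<in> restr_to_plane (Stab G0_set P) P"
    then obtain g where g: "g \<in> G0_set" "act g P = P" "f = restrict g (plane P)"
      by (auto simp: restr_to_plane_def Stab_def)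
    then have G: "g \<in> G_set" using G0_set_subset_G_set by blast
    have "(g q, g q') \<in> V_set" by (rule G_set_V_set[OF G V])
    then have "(g q, g q') \<in> oplane q q'"
      using g(2) by (simp add: q(1) act_G_set[OF G] V_set_iff oplane_eq_iff)
    then obtain c s where cs: "c\<^sup>2 + s\<^sup>2 = 1" "g q = c *\<^sub>R q + s *\<^sub>R q'" "g q' = - s *\<^sub>R q + c *\<^sub>R q'"
      using in_oplane_rotation[OF st] by metis
    have "fst q \<bullet> fst q = c\<^sup>2 * (fst q \<bullet> fst q) + s\<^sup>2 * (fst q' \<bullet> fst q')"
      using preserves_axes_inner[OF G G0_set_preserves_axes[OF g(1)], of q q] orth
      by (simp add: cs inner_add inner_commute[of "fst q'" "fst q"] power2_eq_square)
    then have "s\<^sup>2 * (fst q \<bullet> fst q - fst q' \<bullet> fst q') = 0" using cs(1) by algebra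
    then have s: "s = 0" using ne by (auto simp: norm_eq)
    then have "c = 1 \<or> c = - 1" using cs(1) by (simp add: power2_eq_1_iff)
    then have "(g q = id q \<and> g q' = id q') \<or> (g q = - q \<and> g q' = - q')" using cs s by auto
    then show "f \<in> pm_id P"
      unfolding g(3) pm_id_def q(1)
      using restrict_plane_eqI[OF st G_set_D(1)[OF G] linear_id]
        restrict_plane_eqI[OF st G_set_D(1)[OF G] linear_uminus] by blast
  qed
  show "pm_id P \<subseteq> restr_to_plane (Stab G0_set P) P"
    unfolding q(1) by (rule pm_id_subset_stabilizer[OF K_set_subset_G0_set])
qed

text \<open>When the Gram matrix of \<open>(x, x')\<close> is scalar, every rotated basis of \<open>P\<close> is again
  principal, and \<open>K\<close> acts transitively on principal bases.\<close>

lemma stabilizer_eq_SO_plane: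
  assumes H: "K_set \<subseteq> H" "H \<subseteq> G_set" and P: "P \<in> level (1/4)"
  shows "restr_to_plane (Stab H P) P = SO_plane P"
proof
  show "restr_to_plane (Stab H P) P \<subseteq> SO_plane P"
    using H(2) G_set_D(1) unfolding restr_to_plane_def SO_plane_def Stab_def act_def by blast
  obtain q q' where q: "P = oplane q q'" "(q, q') \<in> V_set" "gram (fst q) (fst q') = 1/4"
    using P unfolding level_def by auto
  then have st: "(q, q') \<in> stiefel" by (simp add: V_set_iff)
  have princ: "principal p p'" if "(p, p') \<in> V_set" "gram (fst p) (fst p') = 1/4" for p p'
    using V_set_gram_eq_quarter_iff[of "fst p" "snd p" "fst p'" "snd p'"] that
    by (simp add: principal_def)
  show "SO_plane P \<subseteq> restr_to_plane (Stab H P) P"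
  proof
    fix h assume "h \<in> SO_plane P"
    then obtain f where f: "linear f" "map_prod f f ` P \<subseteq> P" "h = restrict f (plane P)"
      by (auto simp: SO_plane_def restr_to_plane_def)
    then have fq: "(f q, f q') \<in> oplane q q'" using in_oplane_self[OF st] by (auto simp: q(1))
    then have eq: "oplane (f q) (f q') = P" and "(f q, f q') \<in> stiefel"
      using oplane_eqI q(1) by (auto elim: in_oplaneD)
    then have "(f q, f q') \<in> V_set \<and> gram (fst (f q)) (fst (f q')) = 1/4"
      using stiefel_in_level_iff P by metis
    then obtain g where g: "g \<in> K_set" "g q = f q" "g q' = f q'"
      using K_set_transitive_principal[of q q' "f q" "f q'"] princ q by metis
    then have G: "g \<in> G_set" using K_set_subset_G_set by blast
    have "act g P = P" using eq g by (simp add: q(1) act_G_set[OF G])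
    then have "g \<in> Stab H P" using g H by (auto simp: Stab_def)
    moreover have "h = restrict g (plane P)"
      unfolding f(3) q(1) by (rule restrict_plane_eqI[OF st f(1) G_set_D(1)[OF G]]) (simp_all add: g)
    ultimately show "h \<in> restr_to_plane (Stab H P) P" by (auto simp: restr_to_plane_def)
  qed
qed


section \<open>Topology of the level sets\<close>

lemma continuous_on_gram:
  "continuous_on S f \<Longrightarrow> continuous_on S g \<Longrightarrow> continuous_on S (\<lambda>x. gram (f x) (g x))"
  unfolding gram_def by (intro continuous_intros)

lemma continuous_map_oplane:
  "continuous_map (top_of_set stiefel) Gr2_top (\<lambda>b. oplane (fst b) (snd b))"
proof -
  have "{b \<in> stiefel. oplane (fst b) (snd b) \<in> Gr2} = stiefel"
    by (force simp: Gr2_def)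
  then have "openin Gr2_top Gr2" by (simp add: openin_Gr2_top)
  then have "topspace Gr2_top = Gr2"
    using openin_subset[of Gr2_top] openin_topspace[of Gr2_top] openin_Gr2_top by blast
  then show ?thesis
    by (force simp: continuous_map_def openin_Gr2_top Gr2_def)
qed

lemma level_subset_Gr2: "level d \<subseteq> Gr2"
  unfolding level_def Gr2_def V_set_iff by blast

lemma compactin_level: "compactin Gr2_top (level d)"
proof -
  let ?S = "{b. b \<in> V_set \<and> gram (fst (fst b)) (fst (snd b)) = d}"
  have eq: "?S = (sphere 0 1 \<times> sphere 0 1) \<inter> {b. formB (fst b) (snd b) = 0}
      \<inter> {b. gram (fst (fst b)) (fst (snd b)) = d}"
    by (auto simp: V_set_def)
  have "compact ?S"
    unfolding eq
    by (intro compact_Int_closed compact_Times compact_sphere closed_Collect_eq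
        bounded_bilinear.continuous_on[OF bounded_bilinear_formB] continuous_on_gram continuous_intros)
  then have "compactin (top_of_set stiefel) ?S"
    by (auto simp: compactin_subtopology V_set_iff)
  then have "compactin Gr2_top ((\<lambda>b. oplane (fst b) (snd b)) ` ?S)"
    using continuous_map_oplane by (rule image_compactin)
  moreover have "(\<lambda>b. oplane (fst b) (snd b)) ` ?S = level d"
    by (force simp: level_def)
  ultimately show ?thesis by simp
qed

lemma gram_oplane_eq:
  assumes "(q, q') \<in> stiefel" "(p, p') \<in> stiefel" "oplane q q' = oplane p p'"
  shows "gram (fst q) (fst q') = gram (fst p) (fst p')"
proof -
  have "(q, q') \<in> oplane p p'" using assms oplane_eq_iff by blast
  then obtain c s where "c\<^sup>2 + s\<^sup>2 = 1" "q = c *\<^sub>R p + s *\<^sub>R p'" "q' = - s *\<^sub>R p + c *\<^sub>R p'"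
    using in_oplane_rotation[OF assms(2)] by metis
  then show ?thesis
    using gram_combination[of c "fst p" s "fst p'" "- s" c] by (simp add: power2_eq_square)
qed

lemma openin_Union_level:
  assumes "open D"
  shows "openin (subtopology Gr2_top Q_set) (\<Union>d\<in>D. level d)"
proof -
  define W where "W = {oplane q q' |q q'. (q, q') \<in> stiefel \<and> gram (fst q) (fst q') \<in> D}"
  have W: "oplane q q' \<in> W \<longleftrightarrow> gram (fst q) (fst q') \<in> D" if "(q, q') \<in> stiefel" for q q'
    unfolding W_def mem_Collect_eq using gram_oplane_eq[OF that] that by metis
  have "{b \<in> stiefel. oplane (fst b) (snd b) \<in> W}
      = stiefel \<inter> (\<lambda>b. gram (fst (fst b)) (fst (snd b))) -` D"
    using W by auto
  moreover have "open ((\<lambda>b::oct \<times> oct. gram (fst (fst b)) (fst (snd b))) -` D)"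
    by (intro open_vimage assms continuous_on_gram continuous_intros)
  ultimately have "openin Gr2_top W"
    unfolding openin_Gr2_top W_def Gr2_def by (auto intro: openin_open_Int)
  moreover have "(\<Union>d\<in>D. level d) = W \<inter> Q_set"
  proof
    show "(\<Union>d\<in>D. level d) \<subseteq> W \<inter> Q_set"
      unfolding W_def Q_set_def level_def V_set_iff by blast
    show "W \<inter> Q_set \<subseteq> (\<Union>d\<in>D. level d)"
    proof
      fix P assume "P \<in> W \<inter> Q_set"
      then obtain q q' where q: "P = oplane q q'" "(q, q') \<in> V_set" "P \<in> W"
        unfolding Q_set_def by blast
      then have "gram (fst q) (fst q') \<in> D" using W V_set_iff by blast
      then show "P \<in> (\<Union>d\<in>D. level d)" using q unfolding level_def by blast
    qed
  qed
  ultimately show ?thesis by (auto simp: openin_subtopology)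
qed


section \<open>Level sets as submanifolds\<close>

lemma gram_chart:
  assumes "(e, e') \<in> stiefel" "u \<bullet> e = 0" "u \<bullet> e' = 0" "v \<bullet> e = 0" "v \<bullet> e' = 0"
  shows "gram (e + u) (e' + v) > 0"
proof -
  have "gram (e + u) (e' + v) = 1 + u \<bullet> u + v \<bullet> v + gram u v"
    using assms
    by (simp add: gram_def stiefel_iff inner_add inner_commute[of e u] inner_commute[of e' u]
        inner_commute[of e v] inner_commute[of e' v] algebra_simps)
  then show ?thesis
    using gram_nonneg[of u v] inner_ge_zero[of u] inner_ge_zero[of v] by linarith
qed

lemma K_set_inverse:
  assumes "g \<in> K_set"
  obtains h where "h \<in> K_set" "\<forall>q. h (g q) = q" "\<forall>q. g (h q) = q"
proof -
  obtain a b c where g: "g = diagm a b c" and n: "norm a = 1" "norm b = 1" "norm c = 1"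
    using assms by (auto simp: K_set_def)
  have u: "qcnj d * (d * t) = t" "d * (qcnj d * t) = t" "d * qcnj d = 1" "qcnj d * d = 1"
    if "norm d = 1" for d t
    using that mult_qcnj[of d] by (simp_all add: norm_eq_1 flip: mult.assoc)
  show ?thesis
  proof
    show "diagm (qcnj a) (qcnj b) (qcnj c) \<in> K_set" using n unfolding K_set_def by force
    show "\<forall>q. diagm (qcnj a) (qcnj b) (qcnj c) (g q) = q" "\<forall>q. g (diagm (qcnj a) (qcnj b) (qcnj c) q) = q"
      using n u by (simp_all add: g diagm_def mult.assoc)
  qed
qed

lemma K_set_level_iff:
  assumes "g \<in> K_set"
  shows "oplane (g a) (g b) \<in> level d \<longleftrightarrow> oplane a b \<in> level d"
proof -
  obtain h where h: "h \<in> K_set" "\<forall>q. h (g q) = q" "\<forall>q. g (h q) = q"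
    using K_set_inverse[OF assms] .
  have "g \<in> G_set" "h \<in> G_set" using assms h K_set_subset_G_set by blast+
  then show ?thesis
    using act_G_set_level[of g "oplane a b" d] act_G_set_level[of h "oplane (g a) (g b)" d]
    by (auto simp: act_G_set h(2)[rule_format])
qed

text \<open>Charts centred at different bases of planes in one orbit differ by a linear isometry.\<close>

lemma submanifold_at_chart_transport:
  assumes cs: "c\<^sup>2 + s\<^sup>2 = 1" and g: "g \<in> K_set"
    and f: "f = c *\<^sub>R e + s *\<^sub>R e'" "f' = - s *\<^sub>R e + c *\<^sub>R e'"
    and sub: "submanifold_at k (Gr2_chart_image (g f) (g f') (level d)) 0"
  shows "submanifold_at k (Gr2_chart_image e e' (level d)) 0"
proof -
  obtain h where h: "h \<in> K_set" "\<forall>q. h (g q) = q" "\<forall>q. g (h q) = q"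
    using K_set_inverse[OF g] .
  note inv = h(2)[rule_format] h(3)[rule_format]
  have G: "g \<in> G_set" "h \<in> G_set" using g h K_set_subset_G_set by blast+
  note lin = G_set_D(1)[OF G(1)] G_set_D(1)[OF G(2)]
  define T where "T z = (g (c *\<^sub>R fst z + s *\<^sub>R snd z), g (- s *\<^sub>R fst z + c *\<^sub>R snd z))" for z
  define T' where "T' z = (c *\<^sub>R h (fst z) - s *\<^sub>R h (snd z), s *\<^sub>R h (fst z) + c *\<^sub>R h (snd z))" for z
  have comb: "c *\<^sub>R (c *\<^sub>R u + s *\<^sub>R v) - s *\<^sub>R (- s *\<^sub>R u + c *\<^sub>R v) = u"
    "s *\<^sub>R (c *\<^sub>R u + s *\<^sub>R v) + c *\<^sub>R (- s *\<^sub>R u + c *\<^sub>R v) = v"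
    "c *\<^sub>R (c *\<^sub>R u - s *\<^sub>R v) + s *\<^sub>R (s *\<^sub>R u + c *\<^sub>R v) = u"
    "- s *\<^sub>R (c *\<^sub>R u - s *\<^sub>R v) + c *\<^sub>R (s *\<^sub>R u + c *\<^sub>R v) = v" for u v :: oct
  proof -
    have "(c * c) *\<^sub>R w + (s * s) *\<^sub>R w = w" for w :: oct
      using cs by (metis power2_eq_square scaleR_add_left scaleR_one)
    moreover from this have "(s * s) *\<^sub>R w + (c * c) *\<^sub>R w = w" for w :: oct
      by (simp only: add.commute)
    ultimately show "c *\<^sub>R (c *\<^sub>R u + s *\<^sub>R v) - s *\<^sub>R (- s *\<^sub>R u + c *\<^sub>R v) = u"
      "s *\<^sub>R (c *\<^sub>R u + s *\<^sub>R v) + c *\<^sub>R (- s *\<^sub>R u + c *\<^sub>R v) = v"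
      "c *\<^sub>R (c *\<^sub>R u - s *\<^sub>R v) + s *\<^sub>R (s *\<^sub>R u + c *\<^sub>R v) = u"
      "- s *\<^sub>R (c *\<^sub>R u - s *\<^sub>R v) + c *\<^sub>R (s *\<^sub>R u + c *\<^sub>R v) = v"
      by (simp_all add: scaleR_add_right scaleR_diff_right mult.commute[of s c])
  qed
  have "submanifold_at k (T -` Gr2_chart_image (g f) (g f') (level d)) 0"
  proof (rule submanifold_at_linear_vimage)
    show "linear T"
      unfolding T_def by (rule linearI) (simp_all add: linear_add[OF lin(1)] linear_cmul[OF lin(1)] linear_diff[OF lin(1)] algebra_simps)
    show "linear T'"
      unfolding T'_def by (rule linearI) (simp_all add: linear_add[OF lin(2)] linear_cmul[OF lin(2)] algebra_simps)
    show "T' (T z) = z" for z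
      unfolding T_def T'_def fst_conv snd_conv inv comb by simp
    show "T (T' z) = z" for z
      unfolding T_def T'_def fst_conv snd_conv comb inv by simp
    show "submanifold_at k (Gr2_chart_image (g f) (g f') (level d)) (T 0)"
      using sub linear_0[OF lin(1)] by (simp add: T_def zero_prod_def)
  qed
  moreover have "T -` Gr2_chart_image (g f) (g f') (level d) = Gr2_chart_image e e' (level d)"
  proof -
    have rot0: "c * X + s * Y = 0 \<and> - s * X + c * Y = 0 \<longleftrightarrow> X = 0 \<and> Y = 0" for X Y :: real
    proof
      assume "c * X + s * Y = 0 \<and> - s * X + c * Y = 0"
      then have "(c\<^sup>2 + s\<^sup>2) * X = 0" "(c\<^sup>2 + s\<^sup>2) * Y = 0" by algebra+
      then show "X = 0 \<and> Y = 0" using cs by simp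
    qed simp
    have "(u, v) \<in> T -` Gr2_chart_image (g f) (g f') (level d)
        \<longleftrightarrow> (u, v) \<in> Gr2_chart_image e e' (level d)" for u v
    proof -
      let ?u = "c *\<^sub>R u + s *\<^sub>R v" and ?v = "- s *\<^sub>R u + c *\<^sub>R v"
      have perp: "w \<bullet> f = 0 \<and> w \<bullet> f' = 0 \<longleftrightarrow> w \<bullet> e = 0 \<and> w \<bullet> e' = 0" for w
        using rot0[of "w \<bullet> e" "w \<bullet> e'"] unfolding f inner_add_right inner_scaleR_right .
      have perp': "?u \<bullet> w = 0 \<and> ?v \<bullet> w = 0 \<longleftrightarrow> u \<bullet> w = 0 \<and> v \<bullet> w = 0" for w
        using rot0[of "u \<bullet> w" "v \<bullet> w"] unfolding inner_add_left inner_scaleR_left .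
      have "f + ?u = c *\<^sub>R (e + u) + s *\<^sub>R (e' + v)" "f' + ?v = - s *\<^sub>R (e + u) + c *\<^sub>R (e' + v)"
        by (simp_all add: f algebra_simps)
      then have "oplane (f + ?u) (f' + ?v) = oplane (e + u) (e' + v)"
        by (simp only: oplane_rotate[OF cs])
      then have "oplane (g f + g ?u) (g f' + g ?v) \<in> level d \<longleftrightarrow> oplane (e + u) (e' + v) \<in> level d"
        by (metis K_set_level_iff[OF g] linear_add[OF lin(1)])
      moreover have "g ?u \<bullet> g f = 0 \<and> g ?u \<bullet> g f' = 0 \<and> g ?v \<bullet> g f = 0 \<and> g ?v \<bullet> g f' = 0
          \<longleftrightarrow> u \<bullet> e = 0 \<and> u \<bullet> e' = 0 \<and> v \<bullet> e = 0 \<and> v \<bullet> e' = 0"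
        unfolding G_set_D(2)[OF G(1)] using perp[of ?u] perp[of ?v] perp'[of e] perp'[of e'] by blast
      ultimately show ?thesis
        unfolding vimage_def mem_Collect_eq T_def fst_conv snd_conv Gr2_chart_image_def case_prod_conv
        by blast
    qed
    then show ?thesis by (metis subset_antisym subrelI)
  qed
  ultimately show ?thesis by simp
qed

text \<open>The representatives at which the equations of the orbits are linearized. With
  \<open>r\<^sup>2 + s\<^sup>2 = 1\<close> and \<open>0 \<le> s \<le> r\<close> they are principal bases and reach every level
  \<open>d = r\<^sup>2 s\<^sup>2\<close>.\<close>

definition std_e :: "real \<Rightarrow> real \<Rightarrow> oct" where
  "std_e r s = (Quat r 0 0 0, Quat 0 (- s) 0 0)"

definition std_e' :: "real \<Rightarrow> real \<Rightarrow> oct" where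
  "std_e' r s = (Quat 0 s 0 0, Quat r 0 0 0)"

lemma std_sel [simp]:
  "fst (std_e r s) = Quat r 0 0 0" "snd (std_e r s) = Quat 0 (- s) 0 0"
  "fst (std_e' r s) = Quat 0 s 0 0" "snd (std_e' r s) = Quat r 0 0 0"
  by (simp_all add: std_e_def std_e'_def)

lemma std_principal:
  assumes "r\<^sup>2 + s\<^sup>2 = 1" "0 \<le> s" "s \<le> r"
  shows "principal (std_e r s) (std_e' r s)"
    "gram (fst (std_e r s)) (fst (std_e' r s)) = r\<^sup>2 * s\<^sup>2"
proof -
  show "principal (std_e r s) (std_e' r s)"
    using assms
    by (simp add: principal_def V_set_iff stiefel_iff inner_prod_def inner_quat_def formB_def
        quat_eq_iff norm_quat_def power2_eq_square mult.commute add.commute)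
  show "gram (fst (std_e r s)) (fst (std_e' r s)) = r\<^sup>2 * s\<^sup>2"
    by (simp add: gram_def inner_quat_def power2_eq_square)
qed

lemma std_stiefel:
  "r\<^sup>2 + s\<^sup>2 = 1 \<Longrightarrow> (std_e r s, std_e' r s) \<in> stiefel"
  by (simp add: stiefel_iff inner_prod_def inner_quat_def power2_eq_square add.commute)

text \<open>By homogeneity a single chart decides.\<close>

lemma Gr2_submanifold_level:
  assumes rs: "r\<^sup>2 + s\<^sup>2 = 1" "0 \<le> s" "s \<le> r" and d: "d = r\<^sup>2 * s\<^sup>2"
    and sub: "submanifold_at k (Gr2_chart_image (std_e r s) (std_e' r s) (level d)) 0"
  shows "Gr2_submanifold k (level d)"
proof -
  have "submanifold_at k (Gr2_chart_image e e' (level d)) 0"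
    if e: "(e, e') \<in> stiefel" "oplane e e' \<in> level d" for e e'
  proof -
    have V: "(e, e') \<in> V_set" "gram (fst e) (fst e') = d"
      using e stiefel_in_level_iff by auto
    obtain c t where ct: "c\<^sup>2 + t\<^sup>2 = 1" "principal (c *\<^sub>R e + t *\<^sub>R e') (- t *\<^sub>R e + c *\<^sub>R e')"
      using exists_principal_basis[OF V(1)] .
    have "gram (fst (c *\<^sub>R e + t *\<^sub>R e')) (fst (- t *\<^sub>R e + c *\<^sub>R e')) = d"
      using gram_combination[of c "fst e" t "fst e'" "- t" c] ct(1) V(2) by (simp add: power2_eq_square)
    then obtain g where g: "g \<in> K_set" "g (c *\<^sub>R e + t *\<^sub>R e') = std_e r s"
      "g (- t *\<^sub>R e + c *\<^sub>R e') = std_e' r s"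
      using K_set_transitive_principal[OF ct(2) std_principal(1)[OF rs]] std_principal(2)[OF rs] d
      by metis
    show ?thesis
      by (rule submanifold_at_chart_transport[OF ct(1) g(1) refl refl]) (simp only: g sub)
  qed
  then show ?thesis using level_subset_Gr2 by (auto simp: Gr2_submanifold_def)
qed


lemma Quat_expand: "Quat a b c d = a *\<^sub>R 1 + b *\<^sub>R qi + c *\<^sub>R qj + d *\<^sub>R qk"
  by (simp add: quat_eq_iff)

lemma smooth_on_Quat:
  assumes "open S" "smooth_on S f" "smooth_on S g" "smooth_on S h" "smooth_on S k"
  shows "smooth_on S (\<lambda>z. Quat (f z) (g z) (h z) (k z))"
  unfolding Quat_expand
  by (intro smooth_on_add smooth_on_bilinear[OF bounded_bilinear_scaleR] smooth_on_const assms)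

lemma has_derivative_Quat:
  assumes "(f has_derivative f') F" "(g has_derivative g') F" "(h has_derivative h') F"
    "(k has_derivative k') F"
  shows "((\<lambda>z. Quat (f z) (g z) (h z) (k z)) has_derivative (\<lambda>v. Quat (f' v) (g' v) (h' v) (k' v))) F"
  unfolding Quat_expand
  by (intro has_derivative_add has_derivative_scaleR_left assms)

lemma smooth_on_Pair:
  assumes "open S" "smooth_on S f" "smooth_on S g"
  shows "smooth_on S (\<lambda>z. (f z, g z))"
proof -
  have "linear (\<lambda>y. (y, 0))" "linear (\<lambda>y. (0, y))" by (auto intro!: linearI)
  then have "smooth_on S (\<lambda>z. (f z, 0) + (0, g z))"
    by (intro smooth_on_add smooth_on_linear_compose[of "\<lambda>y. (y, 0)"]
        smooth_on_linear_compose[of "\<lambda>y. (0, y)"] assms)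
  then show ?thesis by simp
qed

lemma linear_quat_sel: "linear qI" "linear qJ" "linear qK"
  by (auto intro!: linearI)

lemma bounded_linear_quat_sel: "bounded_linear qI" "bounded_linear qJ" "bounded_linear qK"
  using linear_quat_sel by (simp_all add: linear_conv_bounded_linear)

lemma smooth_on_fst: "open S \<Longrightarrow> smooth_on S f \<Longrightarrow> smooth_on S (\<lambda>z. fst (f z))"
  by (rule smooth_on_linear_compose[OF module_hom_fst])

lemma smooth_on_snd: "open S \<Longrightarrow> smooth_on S f \<Longrightarrow> smooth_on S (\<lambda>z. snd (f z))"
  by (rule smooth_on_linear_compose[OF module_hom_snd])

lemma smooth_on_id: "open S \<Longrightarrow> smooth_on S (\<lambda>z. z)"
  by (simp add: smooth_on_def Ck_on_id)

lemma smooth_on_gram: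
  assumes "open S" "smooth_on S f" "smooth_on S g"
  shows "smooth_on S (\<lambda>z. gram (f z) (g z))"
  unfolding gram_def power2_eq_square
  by (intro smooth_on_diff smooth_on_bilinear[OF bounded_bilinear_mult]
      smooth_on_bilinear[OF bounded_bilinear_inner] assms)

lemmas smooth_intros = open_UNIV smooth_on_Pair smooth_on_Quat smooth_on_add smooth_on_diff
  smooth_on_const smooth_on_gram smooth_on_bilinear[OF bounded_bilinear_mult]
  smooth_on_bilinear[OF bounded_bilinear_inner] smooth_on_bilinear[OF bounded_bilinear_formB]
  smooth_on_linear_compose[OF linear_quat_sel(1)] smooth_on_linear_compose[OF linear_quat_sel(2)]
  smooth_on_linear_compose[OF linear_quat_sel(3)] smooth_on_fst smooth_on_snd smooth_on_id

lemma has_derivative_bilinear_at_0: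
  assumes "bounded_bilinear B" "bounded_linear L" "bounded_linear M"
  shows "((\<lambda>z. B (p + L z) (q + M z)) has_derivative (\<lambda>z. B p (M z) + B (L z) q)) (at 0)"
proof -
  have "((\<lambda>z. B (p + L z) (q + M z)) has_derivative
      (\<lambda>z. B (p + L 0) (0 + M z) + B (0 + L z) (q + M 0))) (at 0)"
    by (intro bounded_bilinear.FDERIV[OF assms(1)] has_derivative_add has_derivative_const
        bounded_linear_imp_has_derivative assms)
  then show ?thesis using assms(2,3) by (simp add: linear_simps)
qed

lemma has_derivative_gram_at_0:
  assumes "bounded_linear L" "bounded_linear M"
  shows "((\<lambda>z. gram (p + L z) (q + M z)) has_derivative
    (\<lambda>z. 2 * (p \<bullet> L z) * (q \<bullet> q) + 2 * (p \<bullet> p) * (q \<bullet> M z) - 2 * (p \<bullet> q) * (p \<bullet> M z + L z \<bullet> q))) (at 0)"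
proof -
  have L0: "L 0 = 0" "M 0 = 0" using assms by (simp_all add: linear_simps)
  have "((\<lambda>z. gram (p + L z) (q + M z)) has_derivative
    (\<lambda>z. ((p + L 0) \<bullet> (p + L 0) * (q \<bullet> M z + M z \<bullet> q) + (p \<bullet> L z + L z \<bullet> p) * ((q + M 0) \<bullet> (q + M 0)))
      - ((p + L 0) \<bullet> (q + M 0) * (p \<bullet> M z + L z \<bullet> q) + (p \<bullet> M z + L z \<bullet> q) * ((p + L 0) \<bullet> (q + M 0))))) (at 0)"
    unfolding gram_def power2_eq_square
    by (intro has_derivative_diff has_derivative_mult
        has_derivative_bilinear_at_0[OF bounded_bilinear_inner] assms)
  then show ?thesis by (simp add: L0 inner_commute algebra_simps)
qed

lemma formB_real_iff:
  "formB a b = of_real (a \<bullet> b) \<longleftrightarrow> qI (formB a b) = 0 \<and> qJ (formB a b) = 0 \<and> qK (formB a b) = 0"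
  by (auto simp: quat_eq_iff qRe_formB simp del: quat_sel_times)

lemma Gr2_chart_image_level:
  assumes "(e, e') \<in> stiefel"
  shows "(u, v) \<in> Gr2_chart_image e e' (level d) \<longleftrightarrow>
    (u \<bullet> e = 0 \<and> u \<bullet> e' = 0 \<and> v \<bullet> e = 0 \<and> v \<bullet> e' = 0) \<and>
    formB (e + u) (e' + v) = of_real ((e + u) \<bullet> (e' + v)) \<and>
    gram (fst (e + u)) (fst (e' + v)) = d * gram (e + u) (e' + v)"
  using gram_chart[OF assms, of u v] oplane_in_level_iff[of "e + u" "e' + v" d]
  by (auto simp: Gr2_chart_image_def)

subsection \<open>The six-dimensional orbit\<close>

text \<open>Around \<open>[(1,0), (0,1)]\<close> the vectors \<open>x = 1 + u\<^sub>1\<close> and \<open>x' = v\<^sub>1\<close>, with \<open>u\<^sub>1\<close>, \<open>v\<^sub>1\<close> imaginary,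
  are dependent only for \<open>v\<^sub>1 = 0\<close>, and then \<open>B = 0\<close> forces \<open>u\<^sub>2 = 0\<close>: the orbit is linear in
  this chart.\<close>

lemma Gr2_submanifold_level_0: "Gr2_submanifold 6 (level 0)"
proof -
  define F :: "oct \<times> oct \<Rightarrow> oct \<times> real \<times> real"
    where "F z = ((snd (fst z), fst (snd z)), (qRe (fst (fst z)), qRe (snd (snd z))))" for z
  have lin: "linear F"
    unfolding F_def by (rule linearI) simp_all
  have "submanifold_at (DIM(oct \<times> oct) - DIM(oct \<times> real \<times> real)) {z. F z = 0} 0"
  proof (rule regular_level_set_submanifold)
    show "smooth_on UNIV F" using smooth_on_linear[OF lin] by simp
    show "(F has_derivative F) (at 0)"
      using lin by (simp add: bounded_linear_imp_has_derivative linear_conv_bounded_linear)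
    show "F 0 = 0" by (rule linear_0[OF lin])
    fix w assume w: "\<And>z. F z \<bullet> w = 0"
    obtain w1 w2 t1 t2 where weq: "w = ((w1, w2), (t1, t2))" by (metis prod.collapse)
    have "F ((Quat t1 0 0 0, w1), (w2, Quat t2 0 0 0)) = w" by (simp add: F_def weq)
    then show "w = 0" using w[of "((Quat t1 0 0 0, w1), (w2, Quat t2 0 0 0))"] by simp
  qed
  moreover have "Gr2_chart_image (std_e 1 0) (std_e' 1 0) (level 0) = {z. F z = 0}"
  proof -
    have "((u1, u2), (v1, v2)) \<in> Gr2_chart_image (std_e 1 0) (std_e' 1 0) (level 0)
        \<longleftrightarrow> F ((u1, u2), (v1, v2)) = 0" for u1 u2 v1 v2
    proof -
      have st: "(std_e 1 0, std_e' 1 0) \<in> stiefel" by (rule std_stiefel) simp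
      have one: "Quat 1 0 0 0 = 1" "Quat 0 0 0 0 = 0" by (simp_all add: quat_eq_iff)
      let ?a = "(1 + u1, u2)" and ?b = "(v1, 1 + v2)"
      have "((u1, u2), (v1, v2)) \<in> Gr2_chart_image (std_e 1 0) (std_e' 1 0) (level 0)
        \<longleftrightarrow> (qRe u1 = 0 \<and> qRe u2 = 0 \<and> qRe v1 = 0 \<and> qRe v2 = 0) \<and>
          formB ?a ?b = of_real (?a \<bullet> ?b) \<and> gram (1 + u1) v1 = 0"
        unfolding Gr2_chart_image_level[OF st]
        by (simp add: std_e_def std_e'_def one inner_prod_def) (simp add: inner_quat_def)
      also have "\<dots> \<longleftrightarrow> u2 = 0 \<and> v1 = 0 \<and> qRe u1 = 0 \<and> qRe v2 = 0"
      proof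
        assume L: "(qRe u1 = 0 \<and> qRe u2 = 0 \<and> qRe v1 = 0 \<and> qRe v2 = 0) \<and>
          formB ?a ?b = of_real (?a \<bullet> ?b) \<and> gram (1 + u1) v1 = 0"
        have "gram (1 + u1) v1 = v1 \<bullet> v1 + gram u1 v1"
          using L by (simp add: gram_def inner_quat_def algebra_simps power2_eq_square)
        then have "v1 \<bullet> v1 = 0" using L gram_nonneg[of u1 v1] inner_ge_zero[of v1] by linarith
        then have v1: "v1 = 0" by simp
        have "qI u2 * qI (formB ?a ?b) + qJ u2 * qJ (formB ?a ?b) + qK u2 * qK (formB ?a ?b) = 0"
          using L unfolding formB_real_iff by simp
        then have "u2 \<bullet> u2 = 0"
          using L by (simp add: v1 formB_def inner_quat_def algebra_simps)
        then show "u2 = 0 \<and> v1 = 0 \<and> qRe u1 = 0 \<and> qRe v2 = 0" using v1 L by simp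
      qed (auto simp: formB_def inner_prod_def)
      also have "\<dots> \<longleftrightarrow> F ((u1, u2), (v1, v2)) = 0"
        by (auto simp: F_def zero_prod_def)
      finally show ?thesis .
    qed
    then show ?thesis by auto
  qed
  ultimately have "submanifold_at 6 (Gr2_chart_image (std_e 1 0) (std_e' 1 0) (level 0)) 0"
    by (simp add: DIM_quat)
  then show ?thesis
    by (intro Gr2_submanifold_level[where r = 1 and s = 0]) simp_all
qed

subsection \<open>The seven-dimensional orbit\<close>

text \<open>On \<open>Q\<close> the quadratic form \<open>|x|\<^sup>2 - |y|\<^sup>2\<close> is traceless, so that two equations express its
  vanishing on a plane. They are used instead of the equation for the Gram determinant, which
  has a critical point there.\<close>

lemma oplane_in_level_quarter_iff:
  assumes "gram a b > 0"
  shows "oplane a b \<in> level (1/4) \<longleftrightarrow> formB a b = of_real (a \<bullet> b) \<and>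
    fst a \<bullet> fst a = snd a \<bullet> snd a \<and> fst a \<bullet> fst b = snd a \<bullet> snd b"
proof -
  obtain \<alpha> \<gamma> \<delta> where pos: "\<alpha> > 0" "\<delta> > 0" and st: "(\<alpha> *\<^sub>R a, \<gamma> *\<^sub>R a + \<delta> *\<^sub>R b) \<in> stiefel"
    using exists_stiefel_basis[OF assms] by metis
  define q q' where q: "q = \<alpha> *\<^sub>R a" "q' = \<gamma> *\<^sub>R a + \<delta> *\<^sub>R b"
  have m: "\<alpha> * \<delta> - 0 * \<gamma> > 0" using pos by simp
  have "oplane a b \<in> level (1/4) \<longleftrightarrow> oplane q q' \<in> level (1/4)"
    using oplane_combination[OF m, of a b] by (simp add: q)
  also have "\<dots> \<longleftrightarrow> (q, q') \<in> V_set \<and> gram (fst q) (fst q') = 1/4"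
    using stiefel_in_level_iff st by (simp add: q)
  also have "\<dots> \<longleftrightarrow> (q, q') \<in> V_set \<and> fst q \<bullet> fst q = snd q \<bullet> snd q \<and> fst q \<bullet> fst q' = snd q \<bullet> snd q'"
  proof (rule conj_cong[OF refl])
    assume "(q, q') \<in> V_set"
    then have V: "((fst q, snd q), (fst q', snd q')) \<in> V_set" by simp
    have "gram (fst q) (fst q') = 1/4 \<longleftrightarrow> fst q \<bullet> fst q' = 0 \<and> fst q \<bullet> fst q = fst q' \<bullet> fst q'"
      unfolding V_set_gram_eq_quarter_iff[OF V] norm_eq ..
    then show "gram (fst q) (fst q') = 1/4 \<longleftrightarrow>
        fst q \<bullet> fst q = snd q \<bullet> snd q \<and> fst q \<bullet> fst q' = snd q \<bullet> snd q'"
      using V_set_norms(2,4)[OF V] by auto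
  qed
  also have "(q, q') \<in> V_set \<longleftrightarrow> formB a b = of_real (a \<bullet> b)"
  proof -
    have "q = \<alpha> *\<^sub>R a + 0 *\<^sub>R b" "(q, q') \<in> stiefel" using st by (simp_all add: q)
    then show ?thesis
      using formB_real_combination[of \<alpha> \<delta> 0 \<gamma> q a b q'] m pos q(2) V_set_iff_real[of q q'] by auto
  qed
  also have "fst q \<bullet> fst q = snd q \<bullet> snd q \<and> fst q \<bullet> fst q' = snd q \<bullet> snd q' \<longleftrightarrow>
      fst a \<bullet> fst a = snd a \<bullet> snd a \<and> fst a \<bullet> fst b = snd a \<bullet> snd b"
    using pos by (auto simp: q inner_add_right)
  finally show ?thesis .
qed

text \<open>In the \<open>16\<close>-dimensional space of pairs \<open>(u, v)\<close> the orbit is cut out by \<open>9\<close> equations with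
  independent differentials: four for the chart, three for the imaginary part of \<open>B\<close>, and two for
  the quadratic form.\<close>

lemma Gr2_submanifold_level_quarter: "Gr2_submanifold 7 (level (1/4))"
proof -
  define r :: real where "r = sqrt (1/2)"
  have r: "r > 0" "r\<^sup>2 = 1/2" by (simp_all add: r_def)
  define e e' where "e = std_e r r" and "e' = std_e' r r"
  have rs: "r\<^sup>2 + r\<^sup>2 = 1" using r by simp
  have st: "(e, e') \<in> stiefel" unfolding e_def e'_def by (rule std_stiefel[OF rs])
  define F :: "oct \<times> oct \<Rightarrow> oct \<times> real" where
    "F z = ((Quat (fst z \<bullet> e) (fst z \<bullet> e') (snd z \<bullet> e) (snd z \<bullet> e'),
        Quat (fst (e + fst z) \<bullet> fst (e + fst z) - snd (e + fst z) \<bullet> snd (e + fst z))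
          (qI (formB (e + fst z) (e' + snd z))) (qJ (formB (e + fst z) (e' + snd z)))
          (qK (formB (e + fst z) (e' + snd z)))),
        fst (e + fst z) \<bullet> fst (e' + snd z) - snd (e + fst z) \<bullet> snd (e' + snd z))" for z
  define dB where "dB z = formB e (snd z) + formB (fst z) e'" for z
  define F' :: "oct \<times> oct \<Rightarrow> oct \<times> real" where
    "F' z = ((Quat (fst z \<bullet> e) (fst z \<bullet> e') (snd z \<bullet> e) (snd z \<bullet> e'),
        Quat ((fst e \<bullet> fst (fst z) + fst (fst z) \<bullet> fst e) - (snd e \<bullet> snd (fst z) + snd (fst z) \<bullet> snd e))
          (qI (dB z)) (qJ (dB z)) (qK (dB z))),
        (fst e \<bullet> fst (snd z) + fst (fst z) \<bullet> fst e') - (snd e \<bullet> snd (snd z) + snd (fst z) \<bullet> snd e'))" for z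
  have "submanifold_at (DIM(oct \<times> oct) - DIM(oct \<times> real)) {z. F z = 0} 0"
  proof (rule regular_level_set_submanifold)
    show "smooth_on UNIV F" unfolding F_def by (intro smooth_intros)
    show "(F has_derivative F') (at 0)"
      unfolding F_def F'_def dB_def fst_add snd_add
      by (intro has_derivative_Pair has_derivative_Quat has_derivative_diff
          bounded_linear.has_derivative[OF bounded_linear_quat_sel(1)]
          bounded_linear.has_derivative[OF bounded_linear_quat_sel(2)]
          bounded_linear.has_derivative[OF bounded_linear_quat_sel(3)]
          has_derivative_bilinear_at_0[OF bounded_bilinear_inner]
          has_derivative_bilinear_at_0[OF bounded_bilinear_formB]
          bounded_linear_imp_has_derivative bounded_linear_inner_left_comp
          bounded_linear_fst_comp bounded_linear_snd_comp bounded_linear_ident)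
    show "F 0 = 0"
      by (simp add: F_def e_def e'_def std_e_def std_e'_def formB_def quat_eq_iff inner_quat_def
          zero_prod_def)
    fix w assume w: "\<And>z. F' z \<bullet> w = 0"
    obtain w1 w2 w3 w4 w5 w6 w7 w8 w9
      where weq: "w = ((Quat w1 w2 w3 w4, Quat w5 w6 w7 w8), w9)"
      by (metis prod.collapse quat.exhaust)
    note eqs = w[unfolded F'_def dB_def weq e_def e'_def std_e_def std_e'_def]
    have "w8 = 0" "w7 = 0"
      using eqs[of "((qj, 0), (0, 0))"] eqs[of "((qk, 0), (0, 0))"] r(1)
      by (simp_all add: inner_prod_def inner_quat_def formB_def)
    moreover have "w2 = 0" "w9 = 0"
      using eqs[of "((qi, 0), (0, 0))"] eqs[of "((0, 1), (0, 0))"] r(1)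
      by (simp_all add: inner_prod_def inner_quat_def formB_def flip: distrib_left)
    moreover have "w3 = 0"
      using eqs[of "((0, 0), (1, 0))"] r(1) \<open>w9 = 0\<close>
      by (simp_all add: inner_prod_def inner_quat_def formB_def)
    moreover have "w4 = 0" "w6 = 0"
      using eqs[of "((0, 0), (qi, 0))"] eqs[of "((0, 0), (0, 1))"] r(1) \<open>w9 = 0\<close>
      by (simp_all add: inner_prod_def inner_quat_def formB_def flip: distrib_left)
    moreover have w1: "w1 = 2 * w5"
      using eqs[of "((0, qi), (0, 0))"] r(1) \<open>w6 = 0\<close>
      by (simp add: inner_prod_def inner_quat_def formB_def flip: distrib_left)
    moreover have "w5 = 0"
      using eqs[of "((1, 0), (0, 0))"] r(1) \<open>w6 = 0\<close>
      by (simp add: w1 inner_prod_def inner_quat_def formB_def)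
    ultimately show "w = 0" by (simp add: weq zero_prod_def quat_eq_iff)
  qed
  moreover have "Gr2_chart_image e e' (level (1/4)) = {z. F z = 0}"
  proof -
    have "(u, v) \<in> Gr2_chart_image e e' (level (1/4)) \<longleftrightarrow> F (u, v) = 0" for u v
    proof -
      have "(u, v) \<in> Gr2_chart_image e e' (level (1/4)) \<longleftrightarrow>
        (u \<bullet> e = 0 \<and> u \<bullet> e' = 0 \<and> v \<bullet> e = 0 \<and> v \<bullet> e' = 0) \<and>
        formB (e + u) (e' + v) = of_real ((e + u) \<bullet> (e' + v)) \<and>
        fst (e + u) \<bullet> fst (e + u) = snd (e + u) \<bullet> snd (e + u) \<and>
        fst (e + u) \<bullet> fst (e' + v) = snd (e + u) \<bullet> snd (e' + v)"
        using gram_chart[OF st, of u v] oplane_in_level_quarter_iff[of "e + u" "e' + v"]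
        unfolding Gr2_chart_image_def by blast
      also have "\<dots> \<longleftrightarrow> F (u, v) = 0"
        unfolding formB_real_iff F_def zero_prod_def zero_quat_def by auto
      finally show ?thesis .
    qed
    then show ?thesis by auto
  qed
  ultimately have "submanifold_at 7 (Gr2_chart_image e e' (level (1/4))) 0"
    by (simp add: DIM_quat)
  then have sub: "submanifold_at 7 (Gr2_chart_image (std_e r r) (std_e' r r) (level (1/4))) 0"
    by (simp only: e_def e'_def)
  have "1/4 = r\<^sup>2 * r\<^sup>2" unfolding r(2) by simp
  then show ?thesis using r(1) by (intro Gr2_submanifold_level[OF rs _ _ _ sub]) simp_all
qed

subsection \<open>The eight-dimensional orbits\<close>

text \<open>Here the Gram determinant supplies a single equation, making \<open>8\<close> in all. Evaluating a vanishing
  linear combination \<open>w\<close> of the differentials on coordinate vectors leaves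
  \<open>r s (r\<^sup>2 - s\<^sup>2) w\<^sub>5 = 0\<close> for the coefficient \<open>w\<^sub>5\<close> of that equation, so the differentials are
  independent exactly away from the two degenerate orbits \<open>s = 0\<close> and \<open>r = s\<close>.\<close>

lemma Gr2_submanifold_level_generic:
  assumes rs: "r\<^sup>2 + s\<^sup>2 = 1" "0 < s" "s < r"
  shows "Gr2_submanifold 8 (level (r\<^sup>2 * s\<^sup>2))"
proof -
  define d where "d = r\<^sup>2 * s\<^sup>2"
  define e e' where "e = std_e r s" and "e' = std_e' r s"
  have st: "(e, e') \<in> stiefel" unfolding e_def e'_def by (rule std_stiefel[OF rs(1)])
  define F :: "oct \<times> oct \<Rightarrow> oct" where
    "F z = (Quat (fst z \<bullet> e) (fst z \<bullet> e') (snd z \<bullet> e) (snd z \<bullet> e'),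
        Quat (gram (fst e + fst (fst z)) (fst e' + fst (snd z)) - d * gram (e + fst z) (e' + snd z))
          (qI (formB (e + fst z) (e' + snd z))) (qJ (formB (e + fst z) (e' + snd z)))
          (qK (formB (e + fst z) (e' + snd z))))" for z
  define dB where "dB z = formB e (snd z) + formB (fst z) e'" for z
  define dg where "dg z = 2 * (fst e \<bullet> fst (fst z)) * (fst e' \<bullet> fst e')
      + 2 * (fst e \<bullet> fst e) * (fst e' \<bullet> fst (snd z))
      - 2 * (fst e \<bullet> fst e') * (fst e \<bullet> fst (snd z) + fst (fst z) \<bullet> fst e')" for z :: "oct \<times> oct"
  define dG where "dG z = 2 * (e \<bullet> fst z) * (e' \<bullet> e') + 2 * (e \<bullet> e) * (e' \<bullet> snd z)
      - 2 * (e \<bullet> e') * (e \<bullet> snd z + fst z \<bullet> e')" for z :: "oct \<times> oct"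
  define F' :: "oct \<times> oct \<Rightarrow> oct" where
    "F' z = (Quat (fst z \<bullet> e) (fst z \<bullet> e') (snd z \<bullet> e) (snd z \<bullet> e'),
        Quat (dg z - d * dG z) (qI (dB z)) (qJ (dB z)) (qK (dB z)))" for z
  have "submanifold_at (DIM(oct \<times> oct) - DIM(oct)) {z. F z = 0} 0"
  proof (rule regular_level_set_submanifold)
    show "smooth_on UNIV F" unfolding F_def by (intro smooth_intros)
    show "(F has_derivative F') (at 0)"
      unfolding F_def F'_def dB_def dg_def dG_def
      by (intro has_derivative_Pair has_derivative_Quat has_derivative_diff
          has_derivative_mult_right has_derivative_gram_at_0
          bounded_linear.has_derivative[OF bounded_linear_quat_sel(1)]
          bounded_linear.has_derivative[OF bounded_linear_quat_sel(2)]
          bounded_linear.has_derivative[OF bounded_linear_quat_sel(3)]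
          has_derivative_bilinear_at_0[OF bounded_bilinear_formB]
          bounded_linear_imp_has_derivative bounded_linear_inner_left_comp
          bounded_linear_fst_comp bounded_linear_snd_comp bounded_linear_ident)
    have "gram e e' = 1" by (rule gram_stiefel[OF st])
    then show "F 0 = 0"
      using std_principal(2)[of r s] rs
      by (simp add: F_def d_def e_def e'_def formB_def quat_eq_iff inner_quat_def prod_eq_iff)
    fix w assume w: "\<And>z. F' z \<bullet> w = 0"
    obtain w1 w2 w3 w4 w5 w6 w7 w8
      where weq: "w = (Quat w1 w2 w3 w4, Quat w5 w6 w7 w8)"
      by (metis prod.collapse quat.exhaust)
    have e1: "e \<bullet> e = 1" "e' \<bullet> e' = 1" "e \<bullet> e' = 0" using st by (simp_all add: stiefel_iff)
    note eqs = w[unfolded F'_def dB_def dg_def dG_def weq e1]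
    note std = e_def e'_def std_e_def std_e'_def inner_prod_def inner_quat_def formB_def
    have r: "r > 0" using rs by simp
    have w78: "w8 = 0" "w7 = 0"
      using eqs[of "((qj, 0), (0, 0))"] eqs[of "((qk, 0), (0, 0))"] rs(2)
      by (simp_all add: std)
    have w2: "w2 = 0" using eqs[of "((0, 1), (0, 0))"] r by (simp add: std)
    have w3: "w3 = 0" using eqs[of "((0, 0), (1, 0))"] r by (simp add: std)
    \<comment> \<open>at the base point the differential of the Gram determinant of \<open>(q, q')\<close> is \<open>2 \<langle>u, e\<rangle> + 2 \<langle>v, e'\<rangle>\<close>,
      so it is absorbed into the chart equations\<close>
    define t1 t4 where "t1 = w1 - 2 * d * w5" and "t4 = w4 - 2 * d * w5"
    have u1: "t1 * r + 2 * r * s\<^sup>2 * w5 - s * w6 = 0"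
      using eqs[of "((1, 0), (0, 0))"] by (simp add: std t1_def algebra_simps power2_eq_square)
    have u2: "- t1 * s - r * w6 = 0"
      using eqs[of "((0, qi), (0, 0))"] by (simp add: std t1_def algebra_simps power2_eq_square)
    have v1: "t4 * s + 2 * r\<^sup>2 * s * w5 - r * w6 = 0"
      using eqs[of "((0, 0), (qi, 0))"] by (simp add: std t4_def algebra_simps power2_eq_square)
    have v2: "t4 * r + s * w6 = 0"
      using eqs[of "((0, 0), (0, 1))"] by (simp add: std t4_def algebra_simps power2_eq_square)
    have "w6 = 2 * r * s ^ 3 * w5" using u1 u2 rs(1) by algebra
    moreover have w6: "w6 = 2 * r ^ 3 * s * w5" using v1 v2 rs(1) by algebra
    ultimately have "r * s * (r\<^sup>2 - s\<^sup>2) * w5 = 0" by algebra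
    moreover have "r\<^sup>2 - s\<^sup>2 > 0" using rs by (simp add: power_strict_mono)
    ultimately have w5: "w5 = 0" using r rs(2,3) by auto
    then have "w6 = 0" using w6 by simp
    then have "t1 = 0" "t4 = 0" using u1 v2 w5 r by simp_all
    then show "w = 0"
      using w78 w2 w3 w5 \<open>w6 = 0\<close> by (simp add: weq t1_def t4_def zero_prod_def quat_eq_iff)
  qed
  moreover have "Gr2_chart_image e e' (level d) = {z. F z = 0}"
  proof -
    have "(u, v) \<in> Gr2_chart_image e e' (level d) \<longleftrightarrow> F (u, v) = 0" for u v
      unfolding Gr2_chart_image_level[OF st] formB_real_iff F_def zero_prod_def zero_quat_def
      by auto
    then show ?thesis by auto
  qed
  ultimately have "submanifold_at 8 (Gr2_chart_image e e' (level d)) 0"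
    by (simp add: DIM_quat)
  then show ?thesis
    using rs unfolding e_def e'_def d_def
    by (intro Gr2_submanifold_level[OF rs(1)]) simp_all
qed


section \<open>The partition of \<open>Q\<close>\<close>

lemma Gr2_submanifold_dim_unique:
  assumes "Gr2_submanifold k N" "Gr2_submanifold l N" "N \<noteq> {}"
  shows "k = l"
proof -
  obtain e e' where e: "(e, e') \<in> stiefel" "oplane e e' \<in> N"
    using assms(1,3) unfolding Gr2_submanifold_def Gr2_def by blast
  then have "submanifold_at k (Gr2_chart_image e e' N) 0" "submanifold_at l (Gr2_chart_image e e' N) 0"
    using assms(1,2) unfolding Gr2_submanifold_def by blast+
  then show ?thesis by (intro antisym submanifold_at_dim_le)
qed

lemma level_bounds:
  assumes "P \<in> level d"
  shows "0 \<le> d" "d \<le> 1/4"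
proof -
  obtain q q' where "principal q q'" "gram (fst q) (fst q') = d"
    using assms by (rule level_principal_basis)
  then show "0 \<le> d" "d \<le> 1/4" using principal_norms(1) gram_nonneg by blast+
qed

lemma Gr2_submanifold_8_level:
  assumes "P \<in> level d" "0 < d" "d < 1/4"
  shows "Gr2_submanifold 8 (level d)"
proof -
  obtain q q' where q: "principal q q'" "gram (fst q) (fst q') = d"
    using assms(1) by (rule level_principal_basis)
  define r s where "r = norm (fst q)" and "s = norm (fst q')"
  have sq: "r\<^sup>2 = (1 + sqrt (1 - 4 * d)) / 2" "s\<^sup>2 = (1 - sqrt (1 - 4 * d)) / 2"
    using principal_norms[OF q] by (simp_all add: r_def s_def)
  have rs: "r\<^sup>2 + s\<^sup>2 = 1" by (simp add: sq field_simps)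
  have d: "d = r\<^sup>2 * s\<^sup>2"
    using q by (simp add: gram_def principal_def r_def s_def power2_norm_eq_inner)
  have "s \<noteq> 0" using d assms(2) by auto
  then have "0 < s" by (simp add: s_def)
  moreover have "s\<^sup>2 < r\<^sup>2" unfolding sq using assms(3) by simp
  then have "s < r" by (rule power2_less_imp_less) (simp add: r_def)
  ultimately show ?thesis using Gr2_submanifold_level_generic[OF rs] d by simp
qed

lemma in_level_iff:
  "P \<in> level d \<longleftrightarrow>
    (\<exists>x y x' y'. P = oplane (x, y) (x', y') \<and> ((x, y), (x', y')) \<in> V_set \<and> gram x x' = d)"
  by (simp add: level_def)

lemma lin_dep_iff_level_0:
  "{oplane (x, y) (x', y') |x y x' y'. ((x, y), (x', y')) \<in> V_set \<and> lin_dep_pair x x'} = level 0"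
  unfolding set_eq_iff in_level_iff gram_eq_0_iff by blast

lemma conformal_iff_level_quarter:
  "{oplane (x, y) (x', y') |x y x' y'. ((x, y), (x', y')) \<in> V_set \<and> x \<bullet> x' = 0 \<and> norm x = norm x'}
    = level (1/4)"
proof -
  have "((x, y), (x', y')) \<in> V_set \<and> x \<bullet> x' = 0 \<and> norm x = norm x'
      \<longleftrightarrow> ((x, y), (x', y')) \<in> V_set \<and> gram x x' = 1/4" for x y x' y'
    using V_set_gram_eq_quarter_iff by blast
  then show ?thesis unfolding set_eq_iff in_level_iff by blast
qed

lemma U_set_eq: "U_set = (\<Union>d\<in>{0<..<1/4}. level d)"
proof -
  have *: "((x, y), (x', y')) \<in> V_set \<and> \<not> lin_dep_pair x x' \<and> \<bar>x \<bullet> x'\<bar> + \<bar>norm x - norm x'\<bar> \<noteq> 0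
      \<longleftrightarrow> ((x, y), (x', y')) \<in> V_set \<and> gram x x' \<in> {0<..<1/4}" for x y x' y'
  proof (rule conj_cong[OF refl])
    assume V: "((x, y), (x', y')) \<in> V_set"
    then have "oplane (x, y) (x', y') \<in> level (gram x x')" unfolding in_level_iff by blast
    then have "gram x x' \<in> {0<..<1/4} \<longleftrightarrow> gram x x' \<noteq> 0 \<and> gram x x' \<noteq> 1/4"
      using level_bounds by fastforce
    moreover have "\<bar>x \<bullet> x'\<bar> + \<bar>norm x - norm x'\<bar> \<noteq> 0 \<longleftrightarrow> gram x x' \<noteq> 1/4"
      unfolding V_set_gram_eq_quarter_iff[OF V] by linarith
    ultimately show "\<not> lin_dep_pair x x' \<and> \<bar>x \<bullet> x'\<bar> + \<bar>norm x - norm x'\<bar> \<noteq> 0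
        \<longleftrightarrow> gram x x' \<in> {0<..<1/4}"
      using gram_eq_0_iff[of x x'] by blast
  qed
  show ?thesis unfolding U_set_def * set_eq_iff UN_iff Bex_def in_level_iff by blast
qed

lemma P1_in_level: "P1 \<in> level 0"
proof -
  have "((1, 0), (0, 1)) \<in> V_set"
    by (simp add: V_set_iff stiefel_iff formB_def inner_quat_def)
  moreover have "gram 1 (0::quat) = 0" by simp
  ultimately show ?thesis unfolding P1_def in_level_iff by blast
qed

lemma P2_in_level: "P2 \<in> level (1/4)"
proof -
  define t :: real where "t = 1 / sqrt 2"
  have t: "t * t = 1/2" by (simp add: t_def)
  have "((t *\<^sub>R 1, t *\<^sub>R qi), (t *\<^sub>R (- qi), t *\<^sub>R 1)) \<in> V_set"
    using t by (simp add: V_set_iff stiefel_iff formB_def inner_quat_def quat_eq_iff)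
  moreover have "gram (t *\<^sub>R 1) (t *\<^sub>R (- qi)) = (t * t) * (t * t)"
    by (simp add: gram_def inner_quat_def)
  then have "gram (t *\<^sub>R 1) (t *\<^sub>R (- qi)) = 1/4" unfolding t by simp
  ultimately show ?thesis
    unfolding P2_def t_def[symmetric] in_level_iff by blast
qed

text \<open>The numbers come from the Pythagorean triple \<open>3, 4, 5\<close>.\<close>

lemma U_set_nonempty: "U_set \<noteq> {}"
proof -
  have rs: "(4/5::real)\<^sup>2 + (3/5)\<^sup>2 = 1" by (simp add: power2_eq_square)
  then have "oplane (std_e (4/5) (3/5)) (std_e' (4/5) (3/5)) \<in> level ((4/5)\<^sup>2 * (3/5)\<^sup>2)"
    using std_principal[of "4/5" "3/5"] unfolding level_def principal_def by fastforce
  moreover have "((4/5::real)\<^sup>2 * (3/5)\<^sup>2) \<in> {0<..<1/4}" by (simp add: power2_eq_square)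
  ultimately show ?thesis unfolding U_set_eq by blast
qed

theorem mainTheorem3:
  shows "partition_on Q_set {orbit G_set P1, orbit G_set P2, U_set} \<and> distinct [orbit G_set P1, orbit G_set P2, U_set]
   \<and> openin (subtopology Gr2_top Q_set) U_set
   \<and> orbit G_set P1 = {oplane (x, y) (x', y') |x y x' y'.
        ((x, y), (x', y')) \<in> V_set \<and> lin_dep_pair x x'}
   \<and> orbit G_set P2 = {oplane (x, y) (x', y') |x y x' y'.
        ((x, y), (x', y')) \<in> V_set \<and> x \<bullet> x' = 0 \<and> norm x = norm x'}
   \<and> (\<forall>P\<in>U_set. compactin Gr2_top (orbit G_set P) \<and> Gr2_submanifold 8 (orbit G_set P))
   \<and> {N \<in> orbit G_set ` Q_set. degenerate N} = {orbit G_set P1, orbit G_set P2}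
   \<and> (\<forall>N \<in> orbit G_set ` Q_set - {orbit G_set P1, orbit G_set P2}. Gr2_submanifold 8 N)
   \<and> (\<forall>P\<in>Q_set. orbit G0_set P = orbit G_set P)
   \<and> (\<forall>P\<in>orbit G_set P1. restr_to_plane (Stab G0_set P) P = pm_id P)
   \<and> (\<forall>P\<in>orbit G_set P2. restr_to_plane (Stab G_set P) P = SO_plane P
                    \<and> restr_to_plane (Stab G0_set P) P = SO_plane P)
   \<and> (\<forall>P\<in>U_set. restr_to_plane (Stab G0_set P) P = pm_id P)"
proof -
  note orbG = orbit_eq_level[OF K_set_subset_G_set subset_refl]
  note orbG0 = orbit_eq_level[OF K_set_subset_G0_set G0_set_subset_G_set]
  have O1: "orbit G_set P1 = level 0" and O2: "orbit G_set P2 = level (1/4)"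
    by (rule orbG[OF P1_in_level], rule orbG[OF P2_in_level])
  have ne: "level 0 \<noteq> {}" "level (1/4) \<noteq> {}" using P1_in_level P2_in_level by blast+
  have disj: "level 0 \<inter> level (1/4) = {}" "level 0 \<inter> U_set = {}" "level (1/4) \<inter> U_set = {}"
    unfolding U_set_eq using level_unique by fastforce+
  have cases: "P \<in> level 0 \<or> P \<in> level (1/4) \<or> P \<in> U_set" if P: "P \<in> level d" for P d
  proof -
    have "d = 0 \<or> d = 1/4 \<or> d \<in> {0<..<1/4}" using level_bounds[OF P] by auto
    then show ?thesis using P unfolding U_set_eq by blast
  qed
  have Q: "Q_set = level 0 \<union> level (1/4) \<union> U_set"
  proof
    show "Q_set \<subseteq> level 0 \<union> level (1/4) \<union> U_set"
      unfolding Q_set_eq_Union_level using cases by blast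
    show "level 0 \<union> level (1/4) \<union> U_set \<subseteq> Q_set"
      unfolding Q_set_eq_Union_level U_set_eq by blast
  qed
  have part: "partition_on Q_set {level 0, level (1/4), U_set}"
    unfolding partition_on_def disjoint_def
  proof (intro conjI ballI impI)
    show "\<Union> {level 0, level (1/4), U_set} = Q_set" unfolding Q by blast
    show "{} \<notin> {level 0, level (1/4), U_set}" using ne U_set_nonempty by blast
    show "A \<inter> B = {}"
      if "A \<in> {level 0, level (1/4), U_set}" "B \<in> {level 0, level (1/4), U_set}" "A \<noteq> B" for A B
      using that disj by blast
  qed
  have dist: "distinct [level 0, level (1/4), U_set]"
    unfolding distinct.simps list.set using disj ne U_set_nonempty by blast
  have U8: "compactin Gr2_top (orbit G_set P) \<and> Gr2_submanifold 8 (orbit G_set P)"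
    if P: "P \<in> U_set" for P
  proof -
    obtain d where d: "P \<in> level d" "0 < d" "d < 1/4" using P by (auto simp: U_set_eq)
    then show ?thesis using orbG compactin_level Gr2_submanifold_8_level by simp
  qed
  have deg: "degenerate (level 0)" "degenerate (level (1/4))"
    unfolding degenerate_def
    by (rule exI[of _ 6], simp add: Gr2_submanifold_level_0)
      (rule exI[of _ 7], simp add: Gr2_submanifold_level_quarter)
  have nondeg: "\<not> degenerate (orbit G_set P)" if "P \<in> U_set" for P
  proof
    assume "degenerate (orbit G_set P)"
    then obtain k where "k < 8" "Gr2_submanifold k (orbit G_set P)" by (auto simp: degenerate_def)
    moreover have "orbit G_set P \<noteq> {}"
      using id_in_K_set K_set_subset_G_set by (auto simp: orbit_def)
    ultimately show False using U8[OF that] Gr2_submanifold_dim_unique by blast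
  qed
  have orb: "orbit G_set P = level 0 \<or> orbit G_set P = level (1/4) \<or> P \<in> U_set" if "P \<in> Q_set" for P
    using that orbG unfolding Q by blast
  have deg_orbits: "{N \<in> orbit G_set ` Q_set. degenerate N} = {level 0, level (1/4)}"
  proof
    show "{N \<in> orbit G_set ` Q_set. degenerate N} \<subseteq> {level 0, level (1/4)}"
      using orb nondeg by blast
    have "P1 \<in> Q_set" "P2 \<in> Q_set" using P1_in_level P2_in_level Q by blast+
    then show "{level 0, level (1/4)} \<subseteq> {N \<in> orbit G_set ` Q_set. degenerate N}"
      using deg O1 O2 by blast
  qed
  have other_orbits: "\<forall>N \<in> orbit G_set ` Q_set - {level 0, level (1/4)}. Gr2_submanifold 8 N"
    using orb U8 by blast
  have G0_orbits: "\<forall>P\<in>Q_set. orbit G0_set P = orbit G_set P"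
    unfolding Q_set_eq_Union_level using orbG orbG0 by blast
  have open_U: "openin (subtopology Gr2_top Q_set) U_set"
    unfolding U_set_eq by (rule openin_Union_level) simp
  have stab_0: "\<forall>P\<in>level 0. restr_to_plane (Stab G0_set P) P = pm_id P"
    using stabilizer_eq_pm_id[of _ 0] by simp
  have stab_quarter: "\<forall>P\<in>level (1/4). restr_to_plane (Stab G_set P) P = SO_plane P
      \<and> restr_to_plane (Stab G0_set P) P = SO_plane P"
    using stabilizer_eq_SO_plane[OF K_set_subset_G_set subset_refl]
      stabilizer_eq_SO_plane[OF K_set_subset_G0_set G0_set_subset_G_set] by blast
  have stab_U: "\<forall>P\<in>U_set. restr_to_plane (Stab G0_set P) P = pm_id P"
  proof
    fix P assume "P \<in> U_set"
    then obtain d where "P \<in> level d" "d < 1/4" by (auto simp: U_set_eq)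
    then show "restr_to_plane (Stab G0_set P) P = pm_id P" by (intro stabilizer_eq_pm_id) auto
  qed
  show ?thesis
    unfolding O1 O2 lin_dep_iff_level_0 conformal_iff_level_quarter
    by (intro conjI part dist open_U refl ballI[OF U8] deg_orbits other_orbits G0_orbits
        stab_0 stab_quarter stab_U)
qed

end
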